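(* Fix a time step $n$ and let $\varphi_h^{n-1}\in Q_h$, $\boldsymbol u_h^{n-1}\in\boldsymbol V_h$ be given. Consider the alternating minimization decoupling scheme with $\varphi_h^{n,0}=\varphi_h^{n-1}$, $\boldsymbol u_h^{n,0}=\boldsymbol u_h^{n-1}$: for each iteration $i\ge1$, given $\boldsymbol u_h^{n,i-1}\in\boldsymbol V_h$, find $(\varphi_h^{n,i},\mu_h^{n,i},\boldsymbol u_h^{n,i})\in Q_h\times Q_h\times\boldsymbol V_h$ such that $$\left(\frac{\varphi_h^{n,i}-\varphi_h^{n-1}}{\tau},q_h^\varphi\right)+(m\nabla\mu_h^{n,i},\nabla q_h^\varphi)-(R^n,q_h^\varphi)=0,$$ $$(\mu_h^{n,i},q_h^\mu)-\gamma\ell(\nabla\varphi_h^{n,i},\nabla q_h^\mu)-\frac{\gamma}{\ell}\left(\Psi_c'(\varphi_h^{n,i})-\Psi_e'(\varphi_h^{n-1}),q_h^\mu\right)-\left(\mathcal E_{\mathrm e,\varphi}^{\mathrm{si}}(\varphi_h^{n,i},\boldsymbol u_h^{n,i-1};\varphi_h^{n-1},\boldsymbol u_h^{n-1}),q_h^\mu\right)=0,$$ $$\left(\mathbb C(\varphi_h^{n-1})(\boldsymbol\varepsilon(\boldsymbol u_h^{n,i})-\xi\varphi_h^{n,i}\boldsymbol I);\boldsymbol\varepsilon(\boldsymbol v_h)\right)-(\boldsymbol f^n,\boldsymbol v_h)=0$$ for all $(q_h^\varphi,q_h^\mu,\boldsymbol v_h)\in Q_h\times Q_h\times\boldsymbol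 V_h$. Let $(\varphi_h^n,\boldsymbol u_h^n)$ be the minimizer of $\mathcal F_\tau^n$ (defined in the context) over $\bar Q_h^n\times\boldsymbol V_h$. Then the scheme converges in each time step $n$, with convergence rate given, for every iteration $i\ge1$, by $$\mathcal F_\tau^n(\varphi_h^{n,i},\boldsymbol u_h^{n,i})-\mathcal F_\tau^n(\varphi_h^n,\boldsymbol u_h^n)\le\left(1-\frac{\beta_{\mathrm{ch}}}{L_{\mathrm{ch}}}\right)(1-\beta_{\mathrm e})\left(\mathcal F_\tau^n(\varphi_h^{n,i-1},\boldsymbol u_h^{n,i-1})-\mathcal F_\tau^n(\varphi_h^n,\boldsymbol u_h^n)\right),$$ where $$\beta_{\mathrm{ch}}=\beta_{\mathrm e}=1-\left(\frac{h^2}{\tau C_{\mathrm{inv}}^2\xi^2(\boldsymbol I:\boldsymbol I)C_{\mathbb C}}+\frac{\gamma\ell}{C_\Omega^2\xi^2(\boldsymbol I:\boldsymbol I)C_{\mathbb C}}+1\right)^{-1},$$ $$L_{\mathrm{ch}}=1+L_{\Psi_c}\left(\frac{h^2}{\tau C_{\mathrm{inv}}^2}+\frac{\gamma\ell}{C_\Omega^2}+\xi^2(\boldsymbol I:\boldsymbol I)c_{\mathbb C}\right)^{-1}.$$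
   Context: Domain and spaces: $\Omega\subset\mathbb R^d$ is a bounded (connected) domain with Lipschitz boundary. $Q_h\subseteq H^1(\Omega)$ and $\boldsymbol V_h\subseteq (H^1_0(\Omega))^d$ are conforming finite element spaces (finite-dimensional spaces of piecewise polynomial functions; $Q_h$ contains the constants) with mesh diameter $h>0$. $(\cdot,\cdot)$ is the $L^2(\Omega)$ inner product of scalar or vector functions, $(\cdot;\cdot)$ the $L^2(\Omega)$ inner product of second-order tensor functions, $:$ the pointwise contraction of second-order tensors. $\boldsymbol I$ is the identity tensor in $\mathbb R^{d\times d}$ and $\boldsymbol\varepsilon(\boldsymbol u)=\frac12(\nabla\boldsymbol u+\nabla\boldsymbol u^\top)$. Parameters and data: constants $\gamma,\ell,\tau,m>0$ (with $\tau$ the time-step size), $\xi\in\mathbb R\setminus\{0\}$; $R^n\in L^2(\Omega)$, $\boldsymbol f^n\in L^2(\Omega)^d$. Dual norm: $Q_{h,0}:=\{q_h\in Q_h:\int_\Omega q_h\,dx=0\}$ with norm $\|q_h\|_{h,m}:=\|m^{1/2}\nabla q_h\|_{L^2(\Omega)}$; its dual space is $Q_{h,m}^*$, with norm $\|s\|_{Q_{h,m}^*}:=\sup_{0\neq q_h\in Q_{h,0}}\langle s,q_h\rangle/\|q_h\|_{h,m}$. An $L^2(\Omega)$ function $s$ is identified with the functional $q_h\mapsto(s,q_h)$. Constants: $C_{\mathrm{inv}}>0$ is a constant such that $C_{\mathrm{inv}}h^{-1}\|s_h\|_{Q_{h,m}^*}\ge\|s_h\|_{L^2(\Omega)}$ for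 all $s_h\in Q_{h,0}$, and $C_\Omega>0$ is the Poincaré constant: $\|s_h\|_{L^2(\Omega)}\le C_\Omega\|\nabla s_h\|_{L^2(\Omega)}$ for all $s_h\in Q_{h,0}$. Assumption on the double-well potential: $\Psi=\Psi_c-\Psi_e$ with $\Psi_c,\Psi_e:\mathbb R\to\mathbb R$ convex and differentiable, and $(\Psi_c'(a)-\Psi_c'(b))(a-b)\le L_{\Psi_c}(a-b)^2$ for all $a,b\in\mathbb R$, for a constant $L_{\Psi_c}$. Elasticity tensor: $\mathbb C(\varphi)=\mathbb C_{-1}+\pi(\varphi)(\mathbb C_1-\mathbb C_{-1})$ with constant fourth-order tensors $\mathbb C_{\pm1}$ and a $C^1$ interpolation function $\pi:\mathbb R\to\mathbb R$; $\mathbb C'(\varphi)=\pi'(\varphi)(\mathbb C_1-\mathbb C_{-1})$. The constants $c_{\mathbb C},C_{\mathbb C}>0$ satisfy $c_{\mathbb C}\|\boldsymbol e\|_{L^2(\Omega)}^2\le(\mathbb C(s)\boldsymbol e;\boldsymbol e)\le C_{\mathbb C}\|\boldsymbol e\|_{L^2(\Omega)}^2$ for all symmetric second-order tensor functions $\boldsymbol e\in L^2(\Omega)$ and scalar functions $s\in L^\infty(\Omega)$, and $(\boldsymbol e,\boldsymbol w)\mapsto(\mathbb C(s)\boldsymbol e;\boldsymbol w)$ is an inner product (in particular symmetric). Definitions of the functionals: $$\mathcal E_e^e(\varphi_h^{n-1},\boldsymbol u_h^{n-1}):=\frac12\left(\boldsymbol\varepsilon(\boldsymbol u_h^{n-1})-\xi\varphi_h^{n-1}\boldsymbol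 I\right):\mathbb C'(\varphi_h^{n-1})\left(\boldsymbol\varepsilon(\boldsymbol u_h^{n-1})-\xi\varphi_h^{n-1}\boldsymbol I\right),$$ $$\mathcal E_{\mathrm e,\varphi}^{\mathrm{si}}(\varphi,\boldsymbol u;\varphi_h^{n-1},\boldsymbol u_h^{n-1}):=\mathcal E_e^e(\varphi_h^{n-1},\boldsymbol u_h^{n-1})-\xi\boldsymbol I:\mathbb C(\varphi_h^{n-1})\left(\boldsymbol\varepsilon(\boldsymbol u)-\xi\varphi\boldsymbol I\right),$$ $$\mathcal E_c^c(s_h,\boldsymbol w_h,\varphi_h^{n-1}):=\int_\Omega\frac{\gamma}{\ell}\Psi_c(s_h)+\gamma\ell\frac{|\nabla s_h|^2}{2}+\frac12\left(\boldsymbol\varepsilon(\boldsymbol w_h)-\xi s_h\boldsymbol I\right):\mathbb C(\varphi_h^{n-1})\left(\boldsymbol\varepsilon(\boldsymbol w_h)-\xi s_h\boldsymbol I\right)dx,$$ $$\mathcal F_\tau^n(s_h,\boldsymbol w_h):=\frac{\|s_h-\varphi_h^{n-1}-\tau R^n\|_{Q_{h,m}^*}^2}{2\tau}+\mathcal E_c^c(s_h,\boldsymbol w_h,\varphi_h^{n-1})+\left(\mathcal E_e^e(\varphi_h^{n-1},\boldsymbol u_h^{n-1}),s_h\right)-\frac{\gamma}{\ell}\left(\Psi_e'(\varphi_h^{n-1}),s_h\right)-(\boldsymbol f^n,\boldsymbol w_h),$$ for $(s_h,\boldsymbol w_h)\in\bar Q_h^n\times\boldsymbol V_h$, where $\bar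 Q_h^n:=\{s_h\in Q_h:\int_\Omega\frac{s_h-\varphi_h^{n-1}}{\tau}dx=\int_\Omega R^n\,dx\}$.
   Formalization: At i=1 the stated rate fails in general; it is proved for all i≥2, and for i=1 only if φ_h^{n-1} lies in Q̄_h^n and (φ_h^{n-1},u_h^{n-1}) satisfies the elasticity equation; with only φ_h^{n-1} in Q̄_h^n, the factor at i=1 is 1−β_e. *)

theory Defs
  imports "HOL-Analysis.Analysis"
begin

(* Functions on Omega are total functions on real ^ 'd of which only the values on Omega, up to
   null sets, matter. *)

section \<open>Lipschitz domains\<close>

definition lipschitz_boundary :: "(real ^ 'd) set \<Rightarrow> bool" where
  "lipschitz_boundary \<Omega> \<longleftrightarrow>
     (\<forall>p \<in> frontier \<Omega>. \<exists>r e g L. r > 0 \<and> norm e = 1 \<and> L-lipschitz_on {y. y \<bullet> e = 0} g \<and>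
        \<Omega> \<inter> ball p r = {x \<in> ball p r. x \<bullet> e < g (x - (x \<bullet> e) *\<^sub>R e)})"

definition lipschitz_domain :: "(real ^ 'd) set \<Rightarrow> bool" where
  "lipschitz_domain \<Omega> \<longleftrightarrow>
     open \<Omega> \<and> connected \<Omega> \<and> \<Omega> \<noteq> {} \<and> bounded \<Omega> \<and> lipschitz_boundary \<Omega>"


section \<open>Lebesgue and Sobolev spaces\<close>

definition L2 :: "(real ^ 'd) set \<Rightarrow> (real ^ 'd \<Rightarrow> 'b::euclidean_space) set" where
  "L2 \<Omega> = {f. f \<in> borel_measurable (lebesgue_on \<Omega>) \<and>
               integrable (lebesgue_on \<Omega>) (\<lambda>x. (norm (f x))\<^sup>2)}"

definition Linf :: "(real ^ 'd) set \<Rightarrow> (real ^ 'd \<Rightarrow> real) set" where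
  "Linf \<Omega> = {f. f \<in> borel_measurable (lebesgue_on \<Omega>) \<and>
                 (\<exists>c. AE x in lebesgue_on \<Omega>. \<bar>f x\<bar> \<le> c)}"

(* For tensors, i.e. 'b = real ^ 'd ^ 'd, the inner product of 'b is the double contraction and
   the norm is the Frobenius norm. *)
definition l2_inner :: "(real ^ 'd) set \<Rightarrow> (real ^ 'd \<Rightarrow> 'b::euclidean_space) \<Rightarrow> (real ^ 'd \<Rightarrow> 'b) \<Rightarrow> real" where
  "l2_inner \<Omega> f g = (LINT x|lebesgue_on \<Omega>. f x \<bullet> g x)"

definition l2_norm :: "(real ^ 'd) set \<Rightarrow> (real ^ 'd \<Rightarrow> 'b::euclidean_space) \<Rightarrow> real" where
  "l2_norm \<Omega> f = sqrt (l2_inner \<Omega> f f)"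

definition partial_deriv :: "'d \<Rightarrow> (real ^ 'd \<Rightarrow> real) \<Rightarrow> real ^ 'd \<Rightarrow> real" where
  "partial_deriv i f = (\<lambda>x. frechet_derivative f (at x) (axis i 1))"

primrec C_k :: "nat \<Rightarrow> (real ^ 'd \<Rightarrow> real) \<Rightarrow> bool" where
  "C_k 0 f \<longleftrightarrow> continuous_on UNIV f"
| "C_k (Suc k) f \<longleftrightarrow> f differentiable_on UNIV \<and> (\<forall>i. C_k k (partial_deriv i f))"

definition test_functions :: "(real ^ 'd) set \<Rightarrow> (real ^ 'd \<Rightarrow> real) set" where
  "test_functions \<Omega> = {\<psi>. (\<forall>k. C_k k \<psi>) \<and> (\<exists>K. compact K \<and> K \<subseteq> \<Omega> \<and> (\<forall>x. x \<notin> K \<longrightarrow> \<psi> x = 0))}"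

definition is_weak_grad :: "(real ^ 'd) set \<Rightarrow> (real ^ 'd \<Rightarrow> real) \<Rightarrow> (real ^ 'd \<Rightarrow> real ^ 'd) \<Rightarrow> bool" where
  "is_weak_grad \<Omega> f g \<longleftrightarrow> g \<in> L2 \<Omega> \<and>
     (\<forall>\<psi> \<in> test_functions \<Omega>. \<forall>i.
        l2_inner \<Omega> f (partial_deriv i \<psi>) = - l2_inner \<Omega> (\<lambda>x. g x $ i) \<psi>)"

definition H1 :: "(real ^ 'd) set \<Rightarrow> (real ^ 'd \<Rightarrow> real) set" where
  "H1 \<Omega> = {f \<in> L2 \<Omega>. \<exists>g. is_weak_grad \<Omega> f g}"

(* A representative of the weak gradient, which is unique up to null sets for f in H1. *)
definition wgrad :: "(real ^ 'd) set \<Rightarrow> (real ^ 'd \<Rightarrow> real) \<Rightarrow> real ^ 'd \<Rightarrow> real ^ 'd" where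
  "wgrad \<Omega> f = (SOME g. is_weak_grad \<Omega> f g)"

definition h1_norm :: "(real ^ 'd) set \<Rightarrow> (real ^ 'd \<Rightarrow> real) \<Rightarrow> real" where
  "h1_norm \<Omega> f = sqrt ((l2_norm \<Omega> f)\<^sup>2 + (l2_norm \<Omega> (wgrad \<Omega> f))\<^sup>2)"

definition H10 :: "(real ^ 'd) set \<Rightarrow> (real ^ 'd \<Rightarrow> real) set" where
  "H10 \<Omega> = {f \<in> H1 \<Omega>. \<exists>\<psi> :: nat \<Rightarrow> real ^ 'd \<Rightarrow> real. (\<forall>k. \<psi> k \<in> test_functions \<Omega>) \<and>
                (\<lambda>k. h1_norm \<Omega> (\<lambda>x. f x - \<psi> k x)) \<longlonglongrightarrow> 0}"

definition vgrad :: "(real ^ 'd) set \<Rightarrow> (real ^ 'd \<Rightarrow> real ^ 'd) \<Rightarrow> real ^ 'd \<Rightarrow> real ^ 'd ^ 'd" where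
  "vgrad \<Omega> u x = (\<chi> i. wgrad \<Omega> (\<lambda>y. u y $ i) x)"

definition vh1_norm :: "(real ^ 'd) set \<Rightarrow> (real ^ 'd \<Rightarrow> real ^ 'd) \<Rightarrow> real" where
  "vh1_norm \<Omega> u = sqrt ((l2_norm \<Omega> u)\<^sup>2 + (l2_norm \<Omega> (vgrad \<Omega> u))\<^sup>2)"

definition strain :: "(real ^ 'd) set \<Rightarrow> (real ^ 'd \<Rightarrow> real ^ 'd) \<Rightarrow> real ^ 'd \<Rightarrow> real ^ 'd ^ 'd" where
  "strain \<Omega> u x = (1 / 2) *\<^sub>R (vgrad \<Omega> u x + transpose (vgrad \<Omega> u x))"


section \<open>Finite element spaces\<close>

(* Ciarlet's axioms of a finite element mesh of the closure of Omega. *)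
definition is_mesh :: "(real ^ 'd) set \<Rightarrow> (real ^ 'd) set set \<Rightarrow> bool" where
  "is_mesh \<Omega> T \<longleftrightarrow> finite T \<and> \<Union>T = closure \<Omega> \<and>
     (\<forall>K \<in> T. lipschitz_domain (interior K) \<and> K = closure (interior K)) \<and>
     (\<forall>K \<in> T. \<forall>K' \<in> T. K \<noteq> K' \<longrightarrow> interior K \<inter> interior K' = {})"

definition mesh_diameter :: "(real ^ 'd) set set \<Rightarrow> real" where
  "mesh_diameter T = Max (diameter ` T)"

definition piecewise_polynomial ::
    "(real ^ 'd) set \<Rightarrow> (real ^ 'd) set set \<Rightarrow> (real ^ 'd \<Rightarrow> real) \<Rightarrow> bool" where
  "piecewise_polynomial \<Omega> T f \<longleftrightarrow>
     (\<forall>K \<in> T. \<exists>p. real_polynomial_function p \<and> (AE x in lebesgue_on (K \<inter> \<Omega>). f x = p x))"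

definition fin_dim_space :: "(real ^ 'd \<Rightarrow> 'b::real_vector) set \<Rightarrow> bool" where
  "fin_dim_space X \<longleftrightarrow> (\<exists>B. finite B \<and> X = {\<lambda>x. \<Sum>b\<in>B. c b *\<^sub>R b x | c. True})"

definition scalar_fe_space ::
    "(real ^ 'd) set \<Rightarrow> (real ^ 'd) set set \<Rightarrow> (real ^ 'd \<Rightarrow> real) set \<Rightarrow> bool" where
  "scalar_fe_space \<Omega> T Q \<longleftrightarrow> fin_dim_space Q \<and> Q \<subseteq> H1 \<Omega> \<and>
     (\<forall>q \<in> Q. piecewise_polynomial \<Omega> T q) \<and> (\<exists>q \<in> Q. AE x in lebesgue_on \<Omega>. q x = 1)"

definition vector_fe_space ::
    "(real ^ 'd) set \<Rightarrow> (real ^ 'd) set set \<Rightarrow> (real ^ 'd \<Rightarrow> real ^ 'd) set \<Rightarrow> bool" where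
  "vector_fe_space \<Omega> T V \<longleftrightarrow> fin_dim_space V \<and>
     (\<forall>v \<in> V. \<forall>i. (\<lambda>x. v x $ i) \<in> H10 \<Omega> \<and> piecewise_polynomial \<Omega> T (\<lambda>x. v x $ i))"

definition mean_free :: "(real ^ 'd) set \<Rightarrow> (real ^ 'd \<Rightarrow> real) set \<Rightarrow> (real ^ 'd \<Rightarrow> real) set" where
  "mean_free \<Omega> Q = {q \<in> Q. (LINT x|lebesgue_on \<Omega>. q x) = 0}"

definition hm_norm :: "(real ^ 'd) set \<Rightarrow> real \<Rightarrow> (real ^ 'd \<Rightarrow> real) \<Rightarrow> real" where
  "hm_norm \<Omega> m q = l2_norm \<Omega> (\<lambda>x. sqrt m *\<^sub>R wgrad \<Omega> q x)"

(* The inserted 0 changes the supremum only if there is no nonzero mean-free function in Q; the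
   norm on the trivial dual space is then 0. *)
definition dual_norm :: "(real ^ 'd) set \<Rightarrow> (real ^ 'd \<Rightarrow> real) set \<Rightarrow> real \<Rightarrow> (real ^ 'd \<Rightarrow> real) \<Rightarrow> real" where
  "dual_norm \<Omega> Q m s =
     Sup (insert 0 {l2_inner \<Omega> s q / hm_norm \<Omega> m q | q.
            q \<in> mean_free \<Omega> Q \<and> \<not> (AE x in lebesgue_on \<Omega>. q x = 0)})"


section \<open>Elasticity tensor and energies\<close>

(* Fourth-order tensors are linear maps on second-order tensors. *)
type_synonym 'd tensor4 = "(real ^ 'd ^ 'd) \<Rightarrow>\<^sub>L (real ^ 'd ^ 'd)"

definition elast :: "'d::finite tensor4 \<Rightarrow> 'd tensor4 \<Rightarrow> (real \<Rightarrow> real) \<Rightarrow> real \<Rightarrow> 'd tensor4" where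
  "elast C\<^sub>m C\<^sub>p \<pi> s = C\<^sub>m + \<pi> s *\<^sub>R (C\<^sub>p - C\<^sub>m)"

definition elast' :: "'d::finite tensor4 \<Rightarrow> 'd tensor4 \<Rightarrow> (real \<Rightarrow> real) \<Rightarrow> real \<Rightarrow> 'd tensor4" where
  "elast' C\<^sub>m C\<^sub>p \<pi> s = deriv \<pi> s *\<^sub>R (C\<^sub>p - C\<^sub>m)"

definition elastic_strain ::
    "(real ^ 'd) set \<Rightarrow> real \<Rightarrow> (real ^ 'd \<Rightarrow> real) \<Rightarrow> (real ^ 'd \<Rightarrow> real ^ 'd) \<Rightarrow> real ^ 'd \<Rightarrow> real ^ 'd ^ 'd" where
  "elastic_strain \<Omega> \<xi> \<phi> u x = strain \<Omega> u x - (\<xi> * \<phi> x) *\<^sub>R mat 1"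

(* In the following the tensor-valued arguments A, A' are elast C_m C_p pi and
   elast' C_m C_p pi, and phi0, u0 are the values at the previous time step. *)

definition E_ee ::
    "(real ^ 'd) set \<Rightarrow> real \<Rightarrow> (real \<Rightarrow> 'd::finite tensor4) \<Rightarrow>
     (real ^ 'd \<Rightarrow> real) \<Rightarrow> (real ^ 'd \<Rightarrow> real ^ 'd) \<Rightarrow> real ^ 'd \<Rightarrow> real" where
  "E_ee \<Omega> \<xi> A' \<phi>0 u0 x =
     1 / 2 * (elastic_strain \<Omega> \<xi> \<phi>0 u0 x \<bullet> blinfun_apply (A' (\<phi>0 x)) (elastic_strain \<Omega> \<xi> \<phi>0 u0 x))"

definition E_si ::
    "(real ^ 'd) set \<Rightarrow> real \<Rightarrow> (real \<Rightarrow> 'd::finite tensor4) \<Rightarrow> (real \<Rightarrow> 'd tensor4) \<Rightarrow>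
     (real ^ 'd \<Rightarrow> real) \<Rightarrow> (real ^ 'd \<Rightarrow> real ^ 'd) \<Rightarrow>
     (real ^ 'd \<Rightarrow> real) \<Rightarrow> (real ^ 'd \<Rightarrow> real ^ 'd) \<Rightarrow> real ^ 'd \<Rightarrow> real" where
  "E_si \<Omega> \<xi> A A' \<phi> u \<phi>0 u0 x =
     E_ee \<Omega> \<xi> A' \<phi>0 u0 x - (\<xi> *\<^sub>R mat 1) \<bullet> blinfun_apply (A (\<phi>0 x)) (elastic_strain \<Omega> \<xi> \<phi> u x)"

definition E_cc ::
    "(real ^ 'd) set \<Rightarrow> real \<Rightarrow> real \<Rightarrow> real \<Rightarrow> (real \<Rightarrow> real) \<Rightarrow> (real \<Rightarrow> 'd::finite tensor4) \<Rightarrow>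
     (real ^ 'd \<Rightarrow> real) \<Rightarrow> (real ^ 'd \<Rightarrow> real ^ 'd) \<Rightarrow> (real ^ 'd \<Rightarrow> real) \<Rightarrow> real" where
  "E_cc \<Omega> \<gamma> ell \<xi> \<Psi>\<^sub>c A s w \<phi>0 =
     (LINT x|lebesgue_on \<Omega>. \<gamma> / ell * \<Psi>\<^sub>c (s x) + \<gamma> * ell * ((norm (wgrad \<Omega> s x))\<^sup>2 / 2) +
        1 / 2 * (elastic_strain \<Omega> \<xi> s w x \<bullet> blinfun_apply (A (\<phi>0 x)) (elastic_strain \<Omega> \<xi> s w x)))"

definition F_tau ::
    "(real ^ 'd) set \<Rightarrow> (real ^ 'd \<Rightarrow> real) set \<Rightarrow> real \<Rightarrow> real \<Rightarrow> real \<Rightarrow> real \<Rightarrow> real \<Rightarrow>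
     (real \<Rightarrow> real) \<Rightarrow> (real \<Rightarrow> real) \<Rightarrow> (real \<Rightarrow> 'd::finite tensor4) \<Rightarrow> (real \<Rightarrow> 'd tensor4) \<Rightarrow>
     (real ^ 'd \<Rightarrow> real) \<Rightarrow> (real ^ 'd \<Rightarrow> real ^ 'd) \<Rightarrow>
     (real ^ 'd \<Rightarrow> real) \<Rightarrow> (real ^ 'd \<Rightarrow> real ^ 'd) \<Rightarrow>
     (real ^ 'd \<Rightarrow> real) \<Rightarrow> (real ^ 'd \<Rightarrow> real ^ 'd) \<Rightarrow> real" where
  "F_tau \<Omega> Q \<gamma> ell \<tau> m \<xi> \<Psi>\<^sub>c \<Psi>\<^sub>e A A' R f \<phi>0 u0 s w =
     (dual_norm \<Omega> Q m (\<lambda>x. s x - \<phi>0 x - \<tau> * R x))\<^sup>2 / (2 * \<tau>) +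
     E_cc \<Omega> \<gamma> ell \<xi> \<Psi>\<^sub>c A s w \<phi>0 +
     l2_inner \<Omega> (E_ee \<Omega> \<xi> A' \<phi>0 u0) s -
     \<gamma> / ell * l2_inner \<Omega> (\<lambda>x. deriv \<Psi>\<^sub>e (\<phi>0 x)) s -
     l2_inner \<Omega> f w"

definition Q_bar ::
    "(real ^ 'd) set \<Rightarrow> (real ^ 'd \<Rightarrow> real) set \<Rightarrow> real \<Rightarrow> (real ^ 'd \<Rightarrow> real) \<Rightarrow> (real ^ 'd \<Rightarrow> real) \<Rightarrow>
     (real ^ 'd \<Rightarrow> real) set" where
  "Q_bar \<Omega> Q \<tau> R \<phi>0 =
     {s \<in> Q. (LINT x|lebesgue_on \<Omega>. (s x - \<phi>0 x) / \<tau>) = (LINT x|lebesgue_on \<Omega>. R x)}"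


section \<open>The three equations of the decoupling scheme\<close>

definition phase_eq ::
    "(real ^ 'd) set \<Rightarrow> (real ^ 'd \<Rightarrow> real) set \<Rightarrow> real \<Rightarrow> real \<Rightarrow> (real ^ 'd \<Rightarrow> real) \<Rightarrow>
     (real ^ 'd \<Rightarrow> real) \<Rightarrow> (real ^ 'd \<Rightarrow> real) \<Rightarrow> (real ^ 'd \<Rightarrow> real) \<Rightarrow> bool" where
  "phase_eq \<Omega> Q \<tau> m R \<phi>0 \<phi> \<mu> \<longleftrightarrow>
     (\<forall>q \<in> Q. l2_inner \<Omega> (\<lambda>x. (\<phi> x - \<phi>0 x) / \<tau>) q
              + l2_inner \<Omega> (\<lambda>x. m *\<^sub>R wgrad \<Omega> \<mu> x) (wgrad \<Omega> q) - l2_inner \<Omega> R q = 0)"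

definition potential_eq ::
    "(real ^ 'd) set \<Rightarrow> (real ^ 'd \<Rightarrow> real) set \<Rightarrow> real \<Rightarrow> real \<Rightarrow> real \<Rightarrow>
     (real \<Rightarrow> real) \<Rightarrow> (real \<Rightarrow> real) \<Rightarrow> (real \<Rightarrow> 'd::finite tensor4) \<Rightarrow> (real \<Rightarrow> 'd tensor4) \<Rightarrow>
     (real ^ 'd \<Rightarrow> real) \<Rightarrow> (real ^ 'd \<Rightarrow> real ^ 'd) \<Rightarrow>
     (real ^ 'd \<Rightarrow> real) \<Rightarrow> (real ^ 'd \<Rightarrow> real) \<Rightarrow> (real ^ 'd \<Rightarrow> real ^ 'd) \<Rightarrow> bool" where
  "potential_eq \<Omega> Q \<gamma> ell \<xi> \<Psi>\<^sub>c \<Psi>\<^sub>e A A' \<phi>0 u0 \<phi> \<mu> u \<longleftrightarrow>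
     (\<forall>q \<in> Q. l2_inner \<Omega> \<mu> q - \<gamma> * ell * l2_inner \<Omega> (wgrad \<Omega> \<phi>) (wgrad \<Omega> q)
              - \<gamma> / ell * l2_inner \<Omega> (\<lambda>x. deriv \<Psi>\<^sub>c (\<phi> x) - deriv \<Psi>\<^sub>e (\<phi>0 x)) q
              - l2_inner \<Omega> (E_si \<Omega> \<xi> A A' \<phi> u \<phi>0 u0) q = 0)"

definition elasticity_eq ::
    "(real ^ 'd) set \<Rightarrow> (real ^ 'd \<Rightarrow> real ^ 'd) set \<Rightarrow> real \<Rightarrow> (real \<Rightarrow> 'd::finite tensor4) \<Rightarrow>
     (real ^ 'd \<Rightarrow> real ^ 'd) \<Rightarrow> (real ^ 'd \<Rightarrow> real) \<Rightarrow>
     (real ^ 'd \<Rightarrow> real) \<Rightarrow> (real ^ 'd \<Rightarrow> real ^ 'd) \<Rightarrow> bool" where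
  "elasticity_eq \<Omega> V \<xi> A f \<phi>0 \<phi> u \<longleftrightarrow>
     (\<forall>v \<in> V. l2_inner \<Omega> (\<lambda>x. blinfun_apply (A (\<phi>0 x)) (elastic_strain \<Omega> \<xi> \<phi> u x)) (strain \<Omega> v)
              - l2_inner \<Omega> f v = 0)"

end

theory Submission
  imports Defs
begin

text \<open>
  The scheme is exact alternating minimization of one convex functional, and its rate is the rate of
  alternating minimization for a quadratic form that couples two variables.

  Write \<open>q\<close> for a mean-free increment of the phase field and \<open>v\<close> for an increment of the displacement.
  The functional expands exactly into its value, its two partial derivatives, half of the quadratic
  form
  \<open>N(q, v) = \<parallel>q\<parallel>\<^sub>*\<^sup>2 / \<tau> + \<gamma> ell \<parallel>\<nabla>q\<parallel>\<^sup>2 + (C (\<epsilon>(v) - \<xi> q I); \<epsilon>(v) - \<xi> q I)\<close>,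
  and a multiple of the Bregman distance of the convex part of the potential (\<open>F_expansion\<close>). The phase and potential
  equations say that the phase derivative vanishes (\<open>phase_stationary\<close>), because the chemical
  potential represents the residual of the phase equation in the dual inner product; the elasticity
  equation says that the displacement derivative vanishes.

  The phase part of \<open>N\<close> dominates \<open>\<rho>\<close> times the elastic energy of the dilation \<open>\<xi> q I\<close>, by the inverse
  estimate and the Poincare inequality (\<open>dilation_le_phase_form\<close>). Therefore \<open>N(q, v)\<close> dominates both
  \<open>N(q, 0)\<close> and \<open>N(0, v)\<close> up to the factor \<open>\<beta> = \<rho> / (\<rho> + 1)\<close>, which is the constant of the theorem. After
  a half step one partial derivative vanishes. Expanding towards the minimizer then bounds the other
  partial derivative by minus the energy gap, and moving the other variable by the fraction \<open>\<beta>\<close> of the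
  way towards the minimizer closes the fraction \<open>\<beta>\<close> of the gap (\<open>displacement_half_step\<close>,
  \<open>phase_half_step\<close>). The Bregman distance is convex along the segment and so takes part in this gain.
  Every half step thus contracts the gap by \<open>1 - \<beta>\<close>, which is at most \<open>1 - \<beta> / L\<close> for every \<open>L \<ge> 1\<close>. The
  gap at an iterate dominates \<open>N / 2\<close> of its distance to the minimizer (\<open>minimizer_quadratic_growth\<close>),
  so convergence of the energy gives convergence of the iterates.

  Four analytic facts support this algebra. Weak gradients, given only as a choice, are unique and
  linear almost everywhere (\<open>test_function_vanishing_ae\<close>). The squared dual norm is a quadratic form
  with a Riesz representation (\<open>dual_form\<close>). The strain controls displacements with zero boundary
  values (\<open>vh1_norm_le_strain\<close>), since its diagonal already does so by a Poincare inequality in one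
  direction. Finite element functions are essentially bounded
  (\<open>piecewise_polynomial_ess_bounded\<close>), so that all nonlinear terms are integrable.
\<close>

section \<open>Spaces of functions with a positive semidefinite form\<close>

text \<open>The \<open>L\<^sup>2\<close> inner product, the Dirichlet form, the elastic energy form and the discrete dual inner
  product are all bilinear and positive only up to a kernel, on sets of functions that are not
  quotiented by null sets. Their common algebra is collected once, relative to a carrier.\<close>

locale semi_inner =
  fixes Y :: "('a \<Rightarrow> 'b::real_vector) set" and p :: "('a \<Rightarrow> 'b) \<Rightarrow> ('a \<Rightarrow> 'b) \<Rightarrow> real"
  assumes zero_mem: "(\<lambda>x. 0) \<in> Y"
    and add_mem: "f \<in> Y \<Longrightarrow> g \<in> Y \<Longrightarrow> (\<lambda>x. f x + g x) \<in> Y"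
    and scale_mem: "f \<in> Y \<Longrightarrow> (\<lambda>x. c *\<^sub>R f x) \<in> Y"
    and add_left: "f \<in> Y \<Longrightarrow> g \<in> Y \<Longrightarrow> h \<in> Y \<Longrightarrow> p (\<lambda>x. f x + g x) h = p f h + p g h"
    and scale_left: "f \<in> Y \<Longrightarrow> h \<in> Y \<Longrightarrow> p (\<lambda>x. c *\<^sub>R f x) h = c * p f h"
    and sym: "f \<in> Y \<Longrightarrow> g \<in> Y \<Longrightarrow> p f g = p g f"
    and nonneg: "f \<in> Y \<Longrightarrow> 0 \<le> p f f"
begin

lemma add_right: "f \<in> Y \<Longrightarrow> g \<in> Y \<Longrightarrow> h \<in> Y \<Longrightarrow> p h (\<lambda>x. f x + g x) = p h f + p h g"
  by (simp add: sym[of h] add_left add_mem)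

lemma scale_right: "f \<in> Y \<Longrightarrow> h \<in> Y \<Longrightarrow> p h (\<lambda>x. c *\<^sub>R f x) = c * p h f"
  by (simp add: sym[of h] scale_left scale_mem)

lemma diff_mem: "f \<in> Y \<Longrightarrow> g \<in> Y \<Longrightarrow> (\<lambda>x. f x - g x) \<in> Y"
  using add_mem[of f "\<lambda>x. (-1) *\<^sub>R g x"] scale_mem[of g "-1"] by simp

lemma diff_left: "f \<in> Y \<Longrightarrow> g \<in> Y \<Longrightarrow> h \<in> Y \<Longrightarrow> p (\<lambda>x. f x - g x) h = p f h - p g h"
  using add_left[of f "\<lambda>x. (-1) *\<^sub>R g x" h] scale_left[of g h "-1"] scale_mem[of g "-1"] by simp

lemma diff_right: "f \<in> Y \<Longrightarrow> g \<in> Y \<Longrightarrow> h \<in> Y \<Longrightarrow> p h (\<lambda>x. f x - g x) = p h f - p h g"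
  by (simp add: sym[of h] diff_left diff_mem)

lemma sum_mem:
  "(\<And>i. i \<in> I \<Longrightarrow> v i \<in> Y) \<Longrightarrow> (\<lambda>x. \<Sum>i\<in>I. c i *\<^sub>R v i x) \<in> Y"
proof (induction I rule: infinite_finite_induct)
  case (insert i I)
  then show ?case
    using add_mem[OF scale_mem[of "v i" "c i"], of "\<lambda>x. \<Sum>i\<in>I. c i *\<^sub>R v i x"] by simp
qed (simp_all add: zero_mem)

lemma zero_left: "h \<in> Y \<Longrightarrow> p (\<lambda>x. 0) h = 0"
  using scale_left[of "\<lambda>x. 0" h 0] zero_mem by simp

lemma sum_left:
  "(\<And>i. i \<in> I \<Longrightarrow> v i \<in> Y) \<Longrightarrow> h \<in> Y \<Longrightarrow>
     p (\<lambda>x. \<Sum>i\<in>I. c i *\<^sub>R v i x) h = (\<Sum>i\<in>I. c i * p (v i) h)"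
proof (induction I rule: infinite_finite_induct)
  case (insert i I)
  then show ?case
    using add_left[OF scale_mem[of "v i" "c i"], of "\<lambda>x. \<Sum>i\<in>I. c i *\<^sub>R v i x" h]
      sum_mem[of I v c] by (simp add: scale_left)
qed (simp_all add: zero_left)

lemma expand:
  assumes "f \<in> Y" "g \<in> Y"
  shows "p (\<lambda>x. f x + g x) (\<lambda>x. f x + g x) = p f f + 2 * p f g + p g g"
  using assms by (simp add: add_left add_right add_mem sym[of g f])

lemma expand_diff:
  assumes "f \<in> Y" "g \<in> Y"
  shows "p (\<lambda>x. f x - g x) (\<lambda>x. f x - g x) = p f f - 2 * p f g + p g g"
  using assms by (simp add: diff_left diff_right diff_mem sym[of g f])

lemma scale_scale: "f \<in> Y \<Longrightarrow> p (\<lambda>x. c *\<^sub>R f x) (\<lambda>x. c *\<^sub>R f x) = c\<^sup>2 * p f f"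
  by (simp add: scale_left scale_right scale_mem power2_eq_square)

lemma Cauchy_Schwarz:
  assumes "f \<in> Y" "g \<in> Y"
  shows "\<bar>p f g\<bar> \<le> sqrt (p f f) * sqrt (p g g)"
proof -
  have quad: "0 \<le> p f f + 2 * (c * p f g) + c\<^sup>2 * p g g" for c
    using nonneg[OF add_mem[OF assms(1) scale_mem[OF assms(2), of c]]]
    unfolding expand[OF assms(1) scale_mem[OF assms(2)]] scale_scale[OF assms(2)]
      scale_right[OF assms(2,1)] by simp
  have "(p f g)\<^sup>2 \<le> p f f * p g g"
  proof (cases "p g g = 0")
    case True
    have "p f g = 0"
    proof (rule ccontr)
      assume "p f g \<noteq> 0"
      then show False
        using quad[of "- (p f f + 1) / (2 * p f g)"] True by (simp add: field_simps)
    qed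
    then show ?thesis using True by simp
  next
    case False
    then have pos: "p g g > 0" using nonneg[OF assms(2)] by simp
    have "0 \<le> (p f f + 2 * (- (p f g / p g g) * p f g) + (p f g / p g g)\<^sup>2 * p g g) * p g g"
      using quad[of "- (p f g / p g g)"] pos by (simp add: mult_nonneg_nonneg)
    then show ?thesis
      using pos by (simp add: algebra_simps power2_eq_square)
  qed
  then have "\<bar>p f g\<bar>\<^sup>2 \<le> (sqrt (p f f) * sqrt (p g g))\<^sup>2"
    using nonneg[OF assms(1)] nonneg[OF assms(2)] by (simp add: power_mult_distrib)
  then show ?thesis
    by (rule power2_le_imp_le) (simp add: nonneg assms)
qed

text \<open>By Cauchy-Schwarz the null vectors are exactly the kernel, so they can be dropped from any value
  of the form.\<close>

lemma null_left: "f \<in> Y \<Longrightarrow> g \<in> Y \<Longrightarrow> p f f = 0 \<Longrightarrow> p f g = 0"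
  using Cauchy_Schwarz[of f g] by simp

lemma triangle:
  assumes "f \<in> Y" "g \<in> Y"
  shows "sqrt (p (\<lambda>x. f x + g x) (\<lambda>x. f x + g x)) \<le> sqrt (p f f) + sqrt (p g g)"
proof (rule real_le_lsqrt)
  show "p (\<lambda>x. f x + g x) (\<lambda>x. f x + g x) \<le> (sqrt (p f f) + sqrt (p g g))\<^sup>2"
    using Cauchy_Schwarz[OF assms] nonneg[OF assms(1)] nonneg[OF assms(2)]
    unfolding expand[OF assms] by (simp add: power2_sum)
qed (use nonneg assms add_mem in auto)

text \<open>Gram--Schmidt for a form that may have a kernel: vectors whose component orthogonal to the
  earlier ones has length zero are dropped, so the expansion holds only up to a remainder of
  length zero.\<close>

lemma gram_schmidt:
  fixes v :: "'i \<Rightarrow> 'a \<Rightarrow> 'b"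
  assumes "finite I" "\<And>i. i \<in> I \<Longrightarrow> v i \<in> Y"
  defines "X \<equiv> {\<lambda>x. \<Sum>i\<in>I. c i *\<^sub>R v i x | c. True}"
  obtains n :: nat and e where
    "\<And>k. k < n \<Longrightarrow> e k \<in> X"
    "\<And>j k. j < n \<Longrightarrow> k < n \<Longrightarrow> p (e j) (e k) = (if j = k then 1 else 0)"
    "\<And>f. f \<in> X \<Longrightarrow> p (\<lambda>x. f x - (\<Sum>k<n. p f (e k) *\<^sub>R e k x)) (\<lambda>x. f x - (\<Sum>k<n. p f (e k) *\<^sub>R e k x)) = 0"
proof -
  define span where "span J = {\<lambda>x. \<Sum>i\<in>J. c i *\<^sub>R v i x | c. True}" for J
  define onb where "onb n e J \<longleftrightarrow>
     (\<forall>k<n. e k \<in> span J) \<and> (\<forall>j<n. \<forall>k<n. p (e j) (e k) = (if j = k then 1 else 0)) \<and>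
     (\<forall>f \<in> span J. p (\<lambda>x. f x - (\<Sum>k<n. p f (e k) *\<^sub>R e k x)) (\<lambda>x. f x - (\<Sum>k<n. p f (e k) *\<^sub>R e k x)) = 0)"
     for n :: nat and e J
  have "\<exists>n e. onb n e I"
    using assms(1,2)
  proof (induction I rule: finite_induct)
    case empty
    show ?case
      by (rule exI[of _ 0]) (simp add: onb_def span_def zero_left zero_mem)
  next
    case (insert a I)
    have "\<exists>n e. onb n e I"
      by (rule insert.IH) (simp add: insert.prems)
    then obtain n e where "onb n e I" by blast
    then have e:
      "k < n \<Longrightarrow> e k \<in> span I"
      "j < n \<Longrightarrow> k < n \<Longrightarrow> p (e j) (e k) = (if j = k then 1 else 0)"
      "f \<in> span I \<Longrightarrow> p (\<lambda>x. f x - (\<Sum>k<n. p f (e k) *\<^sub>R e k x)) (\<lambda>x. f x - (\<Sum>k<n. p f (e k) *\<^sub>R e k x)) = 0"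
      for f j k unfolding onb_def by auto
    have span_sub: "span I \<subseteq> Y"
      using insert.prems sum_mem[of I v] by (auto simp: span_def)
    have eY: "k < n \<Longrightarrow> e k \<in> Y" for k using e(1) span_sub by auto
    have va: "v a \<in> Y" using insert.prems by simp
    define P where "P f x = (\<Sum>k<n. p f (e k) *\<^sub>R e k x)" for f x
    have PY: "P f \<in> Y" for f unfolding P_def using sum_mem[of "{..<n}" e] eY by simp
    define b where "b x = v a x - P (v a) x" for x
    have bY: "b \<in> Y" unfolding b_def using diff_mem[OF va PY] .
    have Pe: "p (P f) (e k) = p f (e k)" if "k < n" for f k
    proof -
      have "p (P f) (e k) = (\<Sum>j<n. p f (e j) * p (e j) (e k))"
        unfolding P_def using sum_left[of "{..<n}" e "e k"] eY that by simp
      also have "\<dots> = (\<Sum>j<n. if j = k then p f (e j) else 0)"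
        by (rule sum.cong) (auto simp: e(2) that)
      finally show ?thesis using that by simp
    qed
    have be: "p b (e k) = 0" if "k < n" for k
      unfolding b_def using that by (subst diff_left) (auto simp: va PY eY Pe)
    have span_mono: "f \<in> span (insert a I)" if fs: "f \<in> span I" for f
    proof -
      obtain c where f: "f = (\<lambda>x. \<Sum>i\<in>I. c i *\<^sub>R v i x)" using fs by (auto simp: span_def)
      have "f = (\<lambda>x. \<Sum>i\<in>insert a I. (c(a := 0)) i *\<^sub>R v i x)"
        unfolding f using insert.hyps by (auto intro!: ext sum.cong)
      then show ?thesis unfolding span_def by blast
    qed
    have Pspan: "\<exists>c. P f = (\<lambda>x. \<Sum>i\<in>I. c i *\<^sub>R v i x)" for f
    proof -
      have "\<forall>k<n. \<exists>c. e k = (\<lambda>x. \<Sum>i\<in>I. c i *\<^sub>R v i x)" using e(1) by (auto simp: span_def)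
      then obtain c where c: "\<And>k. k < n \<Longrightarrow> e k = (\<lambda>x. \<Sum>i\<in>I. c k i *\<^sub>R v i x)" by metis
      have "P f = (\<lambda>x. \<Sum>i\<in>I. (\<Sum>k<n. p f (e k) * c k i) *\<^sub>R v i x)"
      proof
        fix x
        have "P f x = (\<Sum>k<n. \<Sum>i\<in>I. (p f (e k) * c k i) *\<^sub>R v i x)"
          unfolding P_def by (rule sum.cong) (auto simp: c scaleR_sum_right)
        then show "P f x = (\<Sum>i\<in>I. (\<Sum>k<n. p f (e k) * c k i) *\<^sub>R v i x)"
          by (simp add: scaleR_sum_left sum.swap[of _ I])
      qed
      then show ?thesis by (rule exI[of _ "\<lambda>i. \<Sum>k<n. p f (e k) * c k i"])
    qed
    have b_span: "(\<lambda>x. r *\<^sub>R b x) \<in> span (insert a I)" for r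
    proof -
      obtain c where c: "P (v a) = (\<lambda>x. \<Sum>i\<in>I. c i *\<^sub>R v i x)" using Pspan by blast
      have "(\<lambda>x. r *\<^sub>R b x) = (\<lambda>x. \<Sum>i\<in>insert a I. ((\<lambda>i. - r * c i)(a := r)) i *\<^sub>R v i x)"
      proof
        fix x
        have "(\<Sum>i\<in>I. ((\<lambda>i. - r * c i)(a := r)) i *\<^sub>R v i x) = - (r *\<^sub>R (\<Sum>i\<in>I. c i *\<^sub>R v i x))"
          unfolding scaleR_sum_right sum_negf[symmetric]
          using insert.hyps by (intro sum.cong) auto
        then show "r *\<^sub>R b x = (\<Sum>i\<in>insert a I. ((\<lambda>i. - r * c i)(a := r)) i *\<^sub>R v i x)"
          unfolding b_def c using insert.hyps by (simp add: scaleR_diff_right)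
      qed
      then show ?thesis unfolding span_def by blast
    qed
    have dec: "\<exists>g \<in> span I. \<exists>r. f = (\<lambda>x. g x + r *\<^sub>R v a x)" if fs: "f \<in> span (insert a I)" for f
    proof -
      obtain c where "f = (\<lambda>x. \<Sum>i\<in>insert a I. c i *\<^sub>R v i x)" using fs by (auto simp: span_def)
      then have "f = (\<lambda>x. (\<Sum>i\<in>I. c i *\<^sub>R v i x) + c a *\<^sub>R v a x)"
        using insert.hyps by (simp add: add.commute)
      then show ?thesis by (auto simp: span_def)
    qed
    have Padd: "P (\<lambda>x. g x + r *\<^sub>R v a x) x = P g x + r *\<^sub>R P (v a) x" if "g \<in> Y" for g r x
    proof -
      have "p (\<lambda>x. g x + r *\<^sub>R v a x) (e k) = p g (e k) + r * p (v a) (e k)" if "k < n" for k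
        using \<open>g \<in> Y\<close> va eY[OF that] by (simp add: add_left scale_left scale_mem)
      then show ?thesis
        unfolding P_def by (simp add: scaleR_add_left sum.distrib scaleR_sum_right)
    qed
    \<comment> \<open>only one direction is new, so the part of f that P misses is a multiple of b up to a null vector\<close>
    have rem: "\<exists>g \<in> Y. \<exists>r. p g g = 0 \<and> (\<forall>x. f x - P f x = g x + r *\<^sub>R b x)"
      if f: "f \<in> span (insert a I)" for f
    proof -
      obtain g r where g: "g \<in> span I" "f = (\<lambda>x. g x + r *\<^sub>R v a x)" using dec[OF f] by blast
      have "g \<in> Y" using g span_sub by auto
      have "(\<lambda>x. g x - P g x) \<in> Y" using diff_mem[OF \<open>g \<in> Y\<close> PY] .
      moreover have "p (\<lambda>x. g x - P g x) (\<lambda>x. g x - P g x) = 0"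
        using e(3)[OF g(1)] unfolding P_def .
      moreover have "\<forall>x. f x - P f x = (g x - P g x) + r *\<^sub>R b x"
        unfolding g(2) Padd[OF \<open>g \<in> Y\<close>] b_def by (simp add: scaleR_diff_right)
      ultimately show ?thesis by (intro bexI[of _ "\<lambda>x. g x - P g x"] exI[of _ r]) auto
    qed
    show ?case
    proof (cases "p b b = 0")
      case True
      have "p (\<lambda>x. f x - P f x) (\<lambda>x. f x - P f x) = 0" if fs: "f \<in> span (insert a I)" for f
      proof -
        obtain g r where g: "g \<in> Y" "p g g = 0" and fx: "\<And>x. f x - P f x = g x + r *\<^sub>R b x"
          using rem[OF fs] by blast
        have "p (\<lambda>x. g x + r *\<^sub>R b x) (\<lambda>x. g x + r *\<^sub>R b x) = 0"
          unfolding expand[OF g(1) scale_mem[OF bY]] scale_scale[OF bY]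
          using g True null_left[OF g(1) scale_mem[OF bY] g(2), of r] by simp
        then show ?thesis unfolding fx .
      qed
      then show ?thesis
        using e(1,2) span_mono unfolding P_def onb_def by (intro exI[of _ n] exI[of _ e]) auto
    next
      case False
      then have pos: "p b b > 0" using nonneg[OF bY] by simp
      define w where "w x = inverse (sqrt (p b b)) *\<^sub>R b x" for x
      have "w = (\<lambda>x. inverse (sqrt (p b b)) *\<^sub>R b x)" unfolding w_def ..
      then have w_span: "w \<in> span (insert a I)" using b_span by simp
      have wY: "w \<in> Y" unfolding w_def using scale_mem[OF bY] .
      have ww: "p w w = 1"
        unfolding w_def using pos scale_scale[OF bY] by (simp add: power_inverse)
      have we: "p w (e k) = 0" if "k < n" for k
        unfolding w_def using be[OF that] scale_left[OF bY eY[OF that]] by simp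
      define e' where "e' = e(n := w)"
      have e'Y: "k < Suc n \<Longrightarrow> e' k \<in> Y" for k
        using eY wY by (auto simp: e'_def less_Suc_eq)
      have 1: "\<forall>k<Suc n. e' k \<in> span (insert a I)"
        using e(1) span_mono w_span by (auto simp: e'_def less_Suc_eq)
      have 2: "\<forall>j<Suc n. \<forall>k<Suc n. p (e' j) (e' k) = (if j = k then 1 else 0)"
        using e(2) ww we eY wY sym by (auto simp: e'_def less_Suc_eq)
      have 3: "p (\<lambda>x. f x - (\<Sum>k<Suc n. p f (e' k) *\<^sub>R e' k x)) (\<lambda>x. f x - (\<Sum>k<Suc n. p f (e' k) *\<^sub>R e' k x)) = 0"
        if fs: "f \<in> span (insert a I)" for f
      proof -
        obtain g r where g: "g \<in> Y" "p g g = 0" and fx: "\<And>x. f x - P f x = g x + r *\<^sub>R b x"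
          using rem[OF fs] by blast
        have f_eq: "f = (\<lambda>x. P f x + (g x + r *\<^sub>R b x))" using fx by (metis add.commute diff_add_cancel)
        have pbw: "p b w = sqrt (p b b)"
          unfolding w_def using bY pos by (simp add: scale_right field_simps)
        have "p (P f) w = 0"
        proof -
          have "p (P f) w = (\<Sum>k<n. p f (e k) * p (e k) w)"
            unfolding P_def using sum_left[of "{..<n}" e w] eY wY by simp
          also have "\<dots> = 0" using we sym wY eY by (auto intro!: sum.neutral)
          finally show ?thesis .
        qed
        moreover have "p f w = p (P f) w + (p g w + r * p b w)"
          using f_eq add_left[OF PY add_mem[OF g(1) scale_mem[OF bY]] wY, of f r]
            add_left[OF g(1) scale_mem[OF bY] wY, of r] scale_left[OF bY wY, of r] by simp
        ultimately have "p f w = r * sqrt (p b b)"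
          using null_left[OF g(1) wY g(2)] pbw by simp
        then have "p f w *\<^sub>R w x = r *\<^sub>R b x" for x
          unfolding w_def using pos by simp
        moreover have "(\<Sum>k<n. p f (e' k) *\<^sub>R e' k x) = P f x" for x
          unfolding P_def e'_def by simp
        ultimately have "(\<Sum>k<Suc n. p f (e' k) *\<^sub>R e' k x) = P f x + r *\<^sub>R b x" for x
          by (simp add: e'_def)
        then have "f x - (\<Sum>k<Suc n. p f (e' k) *\<^sub>R e' k x) = g x" for x
          using fx[of x] by (simp add: algebra_simps)
        then show ?thesis using g(2) by simp
      qed
      show ?thesis using 1 2 3 unfolding onb_def by blast
    qed
  qed
  then obtain n e where "onb n e I" by blast
  then show ?thesis using that[of n e] unfolding onb_def span_def X_def by simp
qed

end

section \<open>Square integrable functions on a bounded open set\<close>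

lemma L2_D:
  assumes "f \<in> L2 \<Omega>"
  shows "f \<in> borel_measurable (lebesgue_on \<Omega>)" "integrable (lebesgue_on \<Omega>) (\<lambda>x. (norm (f x))\<^sup>2)"
  using assms by (auto simp: L2_def)

text \<open>The criterion behind all membership proofs in \<open>L\<^sup>2\<close>: measurability and domination by a multiple of
  a square integrable function.\<close>

lemma L2_dominated:
  fixes f :: "real ^ 'd::finite \<Rightarrow> 'b::euclidean_space"
  assumes "g \<in> L2 \<Omega>" "f \<in> borel_measurable (lebesgue_on \<Omega>)"
    and "AE x in lebesgue_on \<Omega>. norm (f x) \<le> c * norm (g x)"
  shows "f \<in> L2 \<Omega>"
proof -
  have "integrable (lebesgue_on \<Omega>) (\<lambda>x. c\<^sup>2 * (norm (g x))\<^sup>2)"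
    using L2_D[OF assms(1)] by simp
  moreover have "(\<lambda>x. (norm (f x))\<^sup>2) \<in> borel_measurable (lebesgue_on \<Omega>)"
    using assms(2) by measurable
  moreover have "AE x in lebesgue_on \<Omega>. norm ((norm (f x))\<^sup>2) \<le> norm (c\<^sup>2 * (norm (g x))\<^sup>2)"
    using assms(3)
  proof eventually_elim
    case (elim x)
    have "(norm (f x))\<^sup>2 \<le> (c * norm (g x))\<^sup>2"
      using elim by (intro power_mono) auto
    then show ?case by (simp add: power_mult_distrib)
  qed
  ultimately have "integrable (lebesgue_on \<Omega>) (\<lambda>x. (norm (f x))\<^sup>2)"
    by (rule Bochner_Integration.integrable_bound)
  then show ?thesis using assms(2) by (simp add: L2_def)
qed

lemma L2_add:
  fixes f g :: "real ^ 'd::finite \<Rightarrow> 'b::euclidean_space"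
  assumes "f \<in> L2 \<Omega>" "g \<in> L2 \<Omega>"
  shows "(\<lambda>x. f x + g x) \<in> L2 \<Omega>"
proof -
  note [measurable] = L2_D(1)[OF assms(1)] L2_D(1)[OF assms(2)]
  have "integrable (lebesgue_on \<Omega>) (\<lambda>x. 2 * (norm (f x))\<^sup>2 + 2 * (norm (g x))\<^sup>2)"
    using L2_D[OF assms(1)] L2_D[OF assms(2)] by simp
  moreover have "(norm (f x + g x))\<^sup>2 \<le> 2 * (norm (f x))\<^sup>2 + 2 * (norm (g x))\<^sup>2" for x
  proof -
    have "(norm (f x + g x))\<^sup>2 \<le> (norm (f x) + norm (g x))\<^sup>2"
      by (intro power_mono norm_triangle_ineq) auto
    also have "\<dots> \<le> 2 * (norm (f x))\<^sup>2 + 2 * (norm (g x))\<^sup>2"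
      using sum_squares_bound[of "norm (f x)" "norm (g x)"] by (simp add: power2_sum)
    finally show ?thesis .
  qed
  ultimately have "integrable (lebesgue_on \<Omega>) (\<lambda>x. (norm (f x + g x))\<^sup>2)"
    by - (rule Bochner_Integration.integrable_bound, auto)
  then show ?thesis by (simp add: L2_def)
qed

lemma L2_scaleR: "f \<in> L2 \<Omega> \<Longrightarrow> (\<lambda>x. c *\<^sub>R f x) \<in> L2 \<Omega>"
  by (rule L2_dominated[where c = "\<bar>c\<bar>" and g = f]) (auto simp: L2_def)

lemma L2_integrable_inner:
  fixes f g :: "real ^ 'd::finite \<Rightarrow> 'b::euclidean_space"
  assumes "f \<in> L2 \<Omega>" "g \<in> L2 \<Omega>"
  shows "integrable (lebesgue_on \<Omega>) (\<lambda>x. f x \<bullet> g x)"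
proof -
  note [measurable] = L2_D(1)[OF assms(1)] L2_D(1)[OF assms(2)]
  have "integrable (lebesgue_on \<Omega>) (\<lambda>x. (norm (f x))\<^sup>2 + (norm (g x))\<^sup>2)"
    using L2_D[OF assms(1)] L2_D[OF assms(2)] by simp
  moreover have "\<bar>f x \<bullet> g x\<bar> \<le> (norm (f x))\<^sup>2 + (norm (g x))\<^sup>2" for x
  proof -
    have "\<bar>f x \<bullet> g x\<bar> \<le> norm (f x) * norm (g x)" by (rule Cauchy_Schwarz_ineq2)
    also have "\<dots> \<le> (norm (f x))\<^sup>2 + (norm (g x))\<^sup>2"
      using sum_squares_bound[of "norm (f x)" "norm (g x)"]
        mult_nonneg_nonneg[OF norm_ge_zero[of "f x"] norm_ge_zero[of "g x"]] by linarith
    finally show ?thesis .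
  qed
  ultimately show ?thesis
    by - (rule Bochner_Integration.integrable_bound, auto)
qed

lemma semi_inner_l2: "semi_inner (L2 \<Omega>) (l2_inner \<Omega> :: (real ^ 'd::finite \<Rightarrow> 'b::euclidean_space) \<Rightarrow> _)"
proof
  show "(\<lambda>x. 0) \<in> L2 \<Omega>" by (simp add: L2_def)
  show "l2_inner \<Omega> f g = l2_inner \<Omega> g f" for f g :: "real ^ 'd \<Rightarrow> 'b"
    by (simp add: l2_inner_def inner_commute)
qed (simp_all add: L2_add L2_scaleR l2_inner_def inner_add_left L2_integrable_inner)

lemma l2_norm_sq: "(l2_norm \<Omega> f)\<^sup>2 = l2_inner \<Omega> f f"
  by (simp add: l2_norm_def l2_inner_def integral_nonneg_AE)

lemma l2_norm_nonneg: "0 \<le> l2_norm \<Omega> f"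
  by (simp add: l2_norm_def l2_inner_def integral_nonneg_AE)

lemma l2_inner_cong_AE:
  fixes f g f' g' :: "real ^ 'd::finite \<Rightarrow> 'b::euclidean_space"
  assumes "f \<in> L2 \<Omega>" "f' \<in> L2 \<Omega>" "g \<in> L2 \<Omega>" "g' \<in> L2 \<Omega>"
    and "AE x in lebesgue_on \<Omega>. f x = f' x" "AE x in lebesgue_on \<Omega>. g x = g' x"
  shows "l2_inner \<Omega> f g = l2_inner \<Omega> f' g'"
  unfolding l2_inner_def
proof (rule integral_cong_AE)
  show "AE x in lebesgue_on \<Omega>. f x \<bullet> g x = f' x \<bullet> g' x"
    using assms(5,6) by eventually_elim simp
qed (use assms L2_integrable_inner borel_measurable_integrable in blast)+

lemma l2_inner_self_eq_0_iff:
  fixes f :: "real ^ 'd::finite \<Rightarrow> 'b::euclidean_space"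
  assumes "f \<in> L2 \<Omega>"
  shows "l2_inner \<Omega> f f = 0 \<longleftrightarrow> (AE x in lebesgue_on \<Omega>. f x = 0)"
  unfolding l2_inner_def
  by (subst integral_nonneg_eq_0_iff_AE) (auto intro!: L2_integrable_inner assms)

lemma L2_linear_image:
  fixes f :: "real ^ 'd::finite \<Rightarrow> 'b::euclidean_space" and l :: "'b \<Rightarrow> 'c::euclidean_space"
  assumes "f \<in> L2 \<Omega>" "bounded_linear l"
  shows "(\<lambda>x. l (f x)) \<in> L2 \<Omega>"
proof -
  obtain K where K: "\<And>x. norm (l x) \<le> norm x * K" using bounded_linear.bounded[OF assms(2)] by blast
  have "continuous_on UNIV l" using assms(2) by (simp add: linear_continuous_on)
  then have "l \<in> borel_measurable borel" by (rule borel_measurable_continuous_onI)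
  then have "(\<lambda>x. l (f x)) \<in> borel_measurable (lebesgue_on \<Omega>)"
    using L2_D(1)[OF assms(1)] by (rule measurable_compose_rev)
  then show ?thesis
    by (rule L2_dominated[OF assms(1), where c = K]) (use K in \<open>simp add: mult.commute\<close>)
qed

text \<open>Finite element functions are piecewise polynomial on a bounded domain, hence essentially bounded;
  compositions of such functions with continuous or monotone functions keep this property, and
  multiplication by them preserves integrability. This is what makes all nonlinear terms of the
  energy finite.\<close>

definition ess_bounded :: "(real ^ 'd) set \<Rightarrow> (real ^ 'd \<Rightarrow> 'b::euclidean_space) \<Rightarrow> bool" where
  "ess_bounded \<Omega> a \<longleftrightarrow> a \<in> borel_measurable (lebesgue_on \<Omega>) \<and> (\<exists>c. AE x in lebesgue_on \<Omega>. norm (a x) \<le> c)"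

lemma L2_mult_bounded:
  fixes f :: "real ^ 'd::finite \<Rightarrow> 'b::euclidean_space" and a :: "real ^ 'd \<Rightarrow> real"
  assumes "f \<in> L2 \<Omega>" "ess_bounded \<Omega> a"
  shows "(\<lambda>x. a x *\<^sub>R f x) \<in> L2 \<Omega>"
proof -
  obtain c where c: "AE x in lebesgue_on \<Omega>. norm (a x) \<le> c"
    and m[measurable]: "a \<in> borel_measurable (lebesgue_on \<Omega>)"
    using assms(2) by (auto simp: ess_bounded_def)
  note [measurable] = L2_D(1)[OF assms(1)]
  show ?thesis
    by (rule L2_dominated[OF assms(1), where c = c])
      (use c in \<open>auto elim!: eventually_mono simp: mult_right_mono\<close>)
qed

lemma ess_bounded_compose:
  fixes a :: "real ^ 'd::finite \<Rightarrow> real" and g :: "real \<Rightarrow> real"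
  assumes "ess_bounded \<Omega> a" "g \<in> borel_measurable borel" "\<And>c. \<exists>K. \<forall>x. \<bar>x\<bar> \<le> c \<longrightarrow> \<bar>g x\<bar> \<le> K"
  shows "ess_bounded \<Omega> (\<lambda>x. g (a x))"
proof -
  obtain c where c: "AE x in lebesgue_on \<Omega>. norm (a x) \<le> c"
    and m: "a \<in> borel_measurable (lebesgue_on \<Omega>)"
    using assms(1) by (auto simp: ess_bounded_def)
  obtain K where "\<And>x. \<bar>x\<bar> \<le> c \<Longrightarrow> \<bar>g x\<bar> \<le> K" using assms(3) by blast
  then have "AE x in lebesgue_on \<Omega>. norm (g (a x)) \<le> K"
    using c by (auto elim!: eventually_mono)
  then show ?thesis
    using measurable_compose[OF m assms(2)] by (auto simp: ess_bounded_def)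
qed

lemma ess_bounded_continuous:
  fixes a :: "real ^ 'd::finite \<Rightarrow> real" and g :: "real \<Rightarrow> real"
  assumes "ess_bounded \<Omega> a" "continuous_on UNIV g"
  shows "ess_bounded \<Omega> (\<lambda>x. g (a x))"
proof (rule ess_bounded_compose[OF assms(1)])
  show "\<exists>K. \<forall>x. \<bar>x\<bar> \<le> c \<longrightarrow> \<bar>g x\<bar> \<le> K" for c
  proof -
    have "compact (g ` {-c..c})"
      by (intro compact_continuous_image continuous_on_subset[OF assms(2)]) auto
    then obtain K where "\<And>y. y \<in> g ` {-c..c} \<Longrightarrow> norm y \<le> K"
      using compact_imp_bounded bounded_iff by metis
    then show ?thesis by (intro exI[of _ K]) (auto simp: abs_le_iff)
  qed
qed (use assms(2) in \<open>simp add: borel_measurable_continuous_onI\<close>)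

locale bounded_open =
  fixes \<Omega> :: "(real ^ 'd::finite) set"
  assumes open_dom: "open \<Omega>" and bounded_dom: "bounded \<Omega>"
begin

sublocale l2: semi_inner "L2 \<Omega>" "l2_inner \<Omega> :: (real ^ 'd \<Rightarrow> 'b::euclidean_space) \<Rightarrow> _"
  by (rule semi_inner_l2)

sublocale fin: finite_measure "lebesgue_on \<Omega>"
proof
  have "\<Omega> \<in> lmeasurable" using open_dom bounded_dom by (simp add: lmeasurable_open)
  moreover from this have "emeasure (lebesgue_on \<Omega>) \<Omega> = emeasure lebesgue \<Omega>"
    by (intro emeasure_restrict_space) (auto dest: fmeasurableD)
  ultimately show "emeasure (lebesgue_on \<Omega>) (space (lebesgue_on \<Omega>)) \<noteq> \<infinity>"
    using fmeasurableD2[of \<Omega> lebesgue] by (simp add: space_restrict_space)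
qed

lemma ess_bounded_L2:
  fixes a :: "real ^ 'd \<Rightarrow> 'b::euclidean_space"
  assumes "ess_bounded \<Omega> a"
  shows "a \<in> L2 \<Omega>"
proof -
  obtain c where c: "AE x in lebesgue_on \<Omega>. norm (a x) \<le> c"
    and m[measurable]: "a \<in> borel_measurable (lebesgue_on \<Omega>)"
    using assms by (auto simp: ess_bounded_def)
  have "integrable (lebesgue_on \<Omega>) (\<lambda>x. (norm (a x))\<^sup>2)"
  proof (rule fin.integrable_const_bound[where B = "c\<^sup>2"])
    show "AE x in lebesgue_on \<Omega>. norm ((norm (a x))\<^sup>2) \<le> c\<^sup>2"
      using c by eventually_elim (simp add: power_mono)
  qed simp
  then show ?thesis by (simp add: L2_def)
qed

lemma L2_integrable: "f \<in> L2 \<Omega> \<Longrightarrow> integrable (lebesgue_on \<Omega>) (f :: real ^ 'd \<Rightarrow> real)"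
  using L2_integrable_inner[OF _ ess_bounded_L2, of f "\<lambda>x. 1::real"] by (auto simp: ess_bounded_def)

end

section \<open>Test functions\<close>

text \<open>The family \<open>(1/t)^k exp (-1/t)\<close>, extended by zero to \<open>t \<le> 0\<close>: derivatives of members are linear
  combinations of members, so smoothness follows from differentiability alone.\<close>

definition flat :: "nat \<Rightarrow> real \<Rightarrow> real" where
  "flat k t = (if t > 0 then (1 / t) ^ k * exp (- (1 / t)) else 0)"

lemma flat_nonneg: "0 \<le> flat k t"
  by (simp add: flat_def)

text \<open>A single term of the exponential series at \<open>1/t\<close> already beats the power; the factor \<open>t\<close> that is
  left over gives the vanishing derivative at the origin, applied to the next member of the family.\<close>

lemma flat_bound: "flat k t \<le> fact (Suc k) * \<bar>t\<bar>"
proof (cases "t > 0")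
  case True
  define y where "y = 1 / t"
  have y: "y > 0" using True by (simp add: y_def)
  have "y ^ Suc k /\<^sub>R fact (Suc k) \<le> exp y"
    unfolding exp_def using sum_le_suminf[OF summable_exp_generic, of "{Suc k}" y] y by simp
  then have "y ^ Suc k \<le> fact (Suc k) * exp y"
    by (simp add: field_simps del: fact_Suc)
  then have "y ^ k * exp (- y) \<le> fact (Suc k) * (1 / y)"
    using y by (simp add: exp_minus field_simps)
  then show ?thesis using True by (simp add: flat_def y_def)
next
  case False
  then have "flat k t = 0" by (simp add: flat_def)
  then show ?thesis by (simp del: fact_Suc)
qed

lemma flat_has_derivative:
  "(flat k has_real_derivative flat (k + 2) t - real k * flat (k + 1) t) (at t)"
proof -
  consider "t > 0" | "t < 0" | "t = 0" by linarith
  then show ?thesis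
  proof cases
    case 1
    have "((\<lambda>t. (1 / t) ^ k * exp (- (1 / t))) has_real_derivative
        flat (k + 2) t - real k * flat (k + 1) t) (at t)"
    proof (cases k)
      case 0
      then show ?thesis
        using 1 by (auto simp: flat_def power2_eq_square intro!: derivative_eq_intros)
    next
      case (Suc j)
      have "((\<lambda>t. (1 / t) ^ k * exp (- (1 / t))) has_real_derivative
        (real k * (1 / t) ^ (k - 1) * (- 1 / t^2)) * exp (- (1 / t)) + (1 / t) ^ k * (exp (- (1 / t)) * (1 / t^2))) (at t)"
        using 1 by (auto simp: power2_eq_square intro!: derivative_eq_intros)
      also have "(real k * (1 / t) ^ (k - 1) * (- 1 / t^2)) * exp (- (1 / t)) + (1 / t) ^ k * (exp (- (1 / t)) * (1 / t^2))
        = flat (k + 2) t - real k * flat (k + 1) t"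
        using 1 Suc by (simp add: flat_def power2_eq_square field_simps)
      finally show ?thesis .
    qed
    then show ?thesis
      by (rule has_field_derivative_transform_within_open[where S = "{0<..}"]) (use 1 in \<open>auto simp: flat_def\<close>)
  next
    case 2
    have "((\<lambda>t. 0) has_real_derivative flat (k + 2) t - real k * flat (k + 1) t) (at t)"
      using 2 by (simp add: flat_def)
    then show ?thesis
      by (rule has_field_derivative_transform_within_open[where S = "{..<0}"]) (use 2 in \<open>auto simp: flat_def\<close>)
  next
    case 3
    have "((\<lambda>h. (flat k (0 + h) - flat k 0) / h) \<longlongrightarrow> 0) (at 0)"
    proof (rule Lim_null_comparison)
      show "\<forall>\<^sub>F h in at 0. norm ((flat k (0 + h) - flat k 0) / h) \<le> fact (Suc (Suc k)) * \<bar>h\<bar>"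
      proof (rule always_eventually, rule allI)
        fix h :: real
        have "norm ((flat k (0 + h) - flat k 0) / h) \<le> flat (Suc k) h"
          by (auto simp: flat_def)
        then show "norm ((flat k (0 + h) - flat k 0) / h) \<le> fact (Suc (Suc k)) * \<bar>h\<bar>"
          using flat_bound[of "Suc k" h] by linarith
      qed
      show "((\<lambda>h. fact (Suc (Suc k)) * \<bar>h\<bar>) \<longlongrightarrow> (0::real)) (at 0)"
        by (auto intro!: tendsto_eq_intros)
    qed
    then show ?thesis unfolding 3 DERIV_def by (simp add: flat_def)
  qed
qed

text \<open>An algebra of functions that is closed under partial derivatives, so that its members are
  differentiable to all orders.\<close>

inductive_set smooth_algebra :: "(real ^ 'd::finite \<Rightarrow> real) set" where
  const: "(\<lambda>x. c) \<in> smooth_algebra"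
| flat: "(\<lambda>x. flat k (a * x $ i + b)) \<in> smooth_algebra"
| add: "f \<in> smooth_algebra \<Longrightarrow> g \<in> smooth_algebra \<Longrightarrow> (\<lambda>x. f x + g x) \<in> smooth_algebra"
| mult: "f \<in> smooth_algebra \<Longrightarrow> g \<in> smooth_algebra \<Longrightarrow> (\<lambda>x. f x * g x) \<in> smooth_algebra"

lemma smooth_algebra_has_derivative:
  fixes f :: "real ^ 'd::finite \<Rightarrow> real"
  assumes "f \<in> smooth_algebra"
  shows "\<exists>D. (\<forall>i. D i \<in> smooth_algebra) \<and> (\<forall>x. (f has_derivative (\<lambda>v. \<Sum>i\<in>UNIV. v $ i * D i x)) (at x))"
  using assms
proof induction
  case (const c)
  then show ?case
    by (intro exI[of _ "\<lambda>i x. 0"]) (auto intro: smooth_algebra.const)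
next
  case (flat k a j b)
  define D where "D = (\<lambda>i (x::real^'d). (if i = j then 1 else 0) * (a * (flat (k + 2) (a * x $ j + b) + (- real k) * flat (k + 1) (a * x $ j + b))))"
  have "\<forall>i. D i \<in> smooth_algebra"
    unfolding D_def by (intro allI smooth_algebra.intros)
  moreover have "((\<lambda>x. flat k (a * x $ j + b)) has_derivative (\<lambda>v. \<Sum>i\<in>UNIV. v $ i * D i x)) (at x)" for x
  proof -
    have lin: "((\<lambda>x::real^'d. a * x $ j + b) has_derivative (\<lambda>v. a * v $ j)) (at x)"
      by (auto intro!: derivative_eq_intros bounded_linear_imp_has_derivative bounded_linear_vec_nth)
    have eq: "(\<Sum>i\<in>UNIV. v $ i * D i x) = (a * v $ j) * (flat (k + 2) (a * x $ j + b) - real k * flat (k + 1) (a * x $ j + b))" for v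
    proof -
      have "(\<Sum>i\<in>UNIV. v $ i * D i x) = (\<Sum>i\<in>UNIV. if i = j then v $ j * D j x else 0)"
        by (rule sum.cong) (auto simp: D_def)
      then show ?thesis by (simp add: D_def algebra_simps)
    qed
    show ?thesis
      using DERIV_compose_FDERIV[OF flat_has_derivative lin] unfolding eq .
  qed
  ultimately show ?case by blast
next
  case (add f g)
  then obtain D E where D: "\<forall>i. D i \<in> smooth_algebra" "\<And>x. (f has_derivative (\<lambda>v. \<Sum>i\<in>UNIV. v $ i * D i x)) (at x)"
    and E: "\<forall>i. E i \<in> smooth_algebra" "\<And>x. (g has_derivative (\<lambda>v. \<Sum>i\<in>UNIV. v $ i * E i x)) (at x)"
    by blast
  have "((\<lambda>x. f x + g x) has_derivative (\<lambda>v. \<Sum>i\<in>UNIV. v $ i * (D i x + E i x))) (at x)" for x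
    using has_derivative_add[OF D(2) E(2), of x] by (simp add: algebra_simps sum.distrib)
  then show ?case
    using D(1) E(1) by (intro exI[of _ "\<lambda>i x. D i x + E i x"]) (auto intro: smooth_algebra.add)
next
  case (mult f g)
  then obtain D E where D: "\<forall>i. D i \<in> smooth_algebra" "\<And>x. (f has_derivative (\<lambda>v. \<Sum>i\<in>UNIV. v $ i * D i x)) (at x)"
    and E: "\<forall>i. E i \<in> smooth_algebra" "\<And>x. (g has_derivative (\<lambda>v. \<Sum>i\<in>UNIV. v $ i * E i x)) (at x)"
    by blast
  have "((\<lambda>x. f x * g x) has_derivative (\<lambda>v. \<Sum>i\<in>UNIV. v $ i * (f x * E i x + D i x * g x))) (at x)" for x
    using has_derivative_mult[OF D(2) E(2), of x]
    by (simp add: algebra_simps sum.distrib sum_distrib_left sum_distrib_right)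
  then show ?case
    using D(1) E(1) mult.hyps
    by (intro exI[of _ "\<lambda>i x. f x * E i x + D i x * g x"])
      (simp add: smooth_algebra.add[OF smooth_algebra.mult smooth_algebra.mult])
qed

lemma partial_deriv_eq:
  fixes f :: "real ^ 'd::finite \<Rightarrow> real"
  assumes "(f has_derivative f') (at x)"
  shows "partial_deriv i f x = f' (axis i 1)"
  unfolding partial_deriv_def using frechet_derivative_at[OF assms] by simp

lemma smooth_algebra_C_k:
  fixes f :: "real ^ 'd::finite \<Rightarrow> real"
  assumes "f \<in> smooth_algebra"
  shows "C_k k f"
  using assms
proof (induction k arbitrary: f)
  case 0
  obtain D where "\<And>x. (f has_derivative (\<lambda>v. \<Sum>i\<in>UNIV. v $ i * D i x)) (at x)"
    using smooth_algebra_has_derivative[OF 0] by blast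
  then have "isCont f x" for x by (rule has_derivative_continuous)
  then show ?case by (simp add: continuous_at_imp_continuous_on)
next
  case (Suc k)
  obtain D where D: "\<And>i. D i \<in> smooth_algebra" "\<And>x. (f has_derivative (\<lambda>v. \<Sum>i\<in>UNIV. v $ i * D i x)) (at x)"
    using smooth_algebra_has_derivative[OF Suc.prems] by blast
  have "partial_deriv i f = D i" for i
  proof
    fix x
    have "(\<Sum>j\<in>UNIV. axis i 1 $ j * D j x) = (\<Sum>j\<in>UNIV. if j = i then D i x else 0)"
      by (rule sum.cong) (auto simp: axis_def)
    then show "partial_deriv i f x = D i x"
      using partial_deriv_eq[OF D(2)] by simp
  qed
  moreover have "f differentiable_on UNIV"
    using D(2) unfolding differentiable_on_def differentiable_def by blast
  ultimately show ?case
    using Suc.IH D(1) by simp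
qed

text \<open>Products of one-dimensional bumps that increase to the indicator function of a box.\<close>

definition box_bump :: "nat \<Rightarrow> real ^ 'd::finite \<Rightarrow> real ^ 'd \<Rightarrow> real ^ 'd \<Rightarrow> real" where
  "box_bump n a b x = (\<Prod>i\<in>UNIV. flat 0 (real n * x $ i + (- real n * a $ i)) * flat 0 (- real n * x $ i + real n * b $ i))"

lemma flat_0_le_1: "flat 0 t \<le> 1"
  by (simp add: flat_def)

lemma box_bump_range: "0 \<le> box_bump n a b x" "box_bump n a b x \<le> 1"
  unfolding box_bump_def by (auto intro!: prod_nonneg prod_le_1 mult_le_one simp: flat_nonneg flat_0_le_1)

lemma box_bump_outside:
  assumes "x \<notin> box a b"
  shows "box_bump n a b x = 0"
proof -
  obtain i where "x $ i \<le> a $ i \<or> b $ i \<le> x $ i"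
    using assms by (auto simp: mem_box_cart not_less)
  then have "flat 0 (real n * x $ i + (- real n * a $ i)) * flat 0 (- real n * x $ i + real n * b $ i) = 0"
    using mult_left_mono[of "x $ i" "a $ i" "real n"] mult_left_mono[of "b $ i" "x $ i" "real n"]
    by (auto simp: flat_def)
  then show ?thesis unfolding box_bump_def by (intro prod_zero) auto
qed

lemma box_bump_tendsto:
  "(\<lambda>n. box_bump n a b x) \<longlonglongrightarrow> indicator (box a b) x"
proof (cases "x \<in> box a b")
  case True
  have flat_lim: "(\<lambda>n. flat 0 (real n * t)) \<longlonglongrightarrow> 1" if "t > 0" for t
  proof -
    have "(\<lambda>n. exp (- ((1 / t) / real n))) \<longlonglongrightarrow> exp (- 0)"
      by (intro tendsto_exp tendsto_minus lim_const_over_n)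
    then have "(\<lambda>n. exp (- (1 / (real n * t)))) \<longlonglongrightarrow> 1"
      by (simp add: mult.commute)
    moreover have "\<forall>\<^sub>F n in sequentially. exp (- (1 / (real n * t))) = flat 0 (real n * t)"
      using eventually_gt_at_top[of "0::nat"] by eventually_elim (use that in \<open>simp add: flat_def\<close>)
    ultimately show ?thesis using Lim_transform_eventually by fastforce
  qed
  have "(\<lambda>n. \<Prod>i\<in>(UNIV::'a set). flat 0 (real n * (x $ i - a $ i)) * flat 0 (real n * (b $ i - x $ i))) \<longlonglongrightarrow> (\<Prod>i\<in>(UNIV::'a set). 1 * 1)"
    using True by (intro tendsto_prod tendsto_mult flat_lim) (auto simp: mem_box_cart)
  then show ?thesis using True by (simp add: box_bump_def algebra_simps)
qed (simp add: box_bump_outside)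

lemma smooth_algebra_prod:
  "finite I \<Longrightarrow> (\<And>i. i \<in> I \<Longrightarrow> f i \<in> smooth_algebra) \<Longrightarrow> (\<lambda>x. \<Prod>i\<in>I. f i x) \<in> smooth_algebra"
  by (induction I rule: finite_induct) (auto intro: smooth_algebra.const smooth_algebra.mult)

lemma box_bump_test_function:
  assumes "cbox a b \<subseteq> \<Omega>"
  shows "box_bump n a b \<in> test_functions \<Omega>"
proof -
  have "box_bump n a b \<in> smooth_algebra"
    unfolding box_bump_def[abs_def]
    by (intro smooth_algebra_prod smooth_algebra.mult smooth_algebra.flat) auto
  moreover have "x \<notin> cbox a b \<Longrightarrow> box_bump n a b x = 0" for x
    using box_bump_outside[of x a b n] box_subset_cbox[of a b] by blast
  ultimately show ?thesis
    using assms compact_cbox[of a b] by (auto simp: test_functions_def smooth_algebra_C_k intro!: exI[of _ "cbox a b"])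
qed

section \<open>The fundamental lemma of the calculus of variations\<close>

context bounded_open
begin

lemma borel_on: "g \<in> borel_measurable borel \<Longrightarrow> g \<in> borel_measurable (lebesgue_on \<Omega>)"
  by (simp add: measurable_completion measurable_restrict_space1)

text \<open>The bumps increase to the indicator function of a box, so the function integrates to zero over every
  box inside the domain, and Lebesgue differentiation identifies it with its box averages almost
  everywhere.\<close>

lemma test_function_vanishing_ae:
  fixes g :: "real ^ 'd \<Rightarrow> real"
  assumes g: "integrable (lebesgue_on \<Omega>) g"
    and zero: "\<And>\<psi>. \<psi> \<in> test_functions \<Omega> \<Longrightarrow> (LINT x|lebesgue_on \<Omega>. g x * \<psi> x) = 0"
  shows "AE x in lebesgue_on \<Omega>. g x = 0"
proof -
  have \<Omega>_sets: "\<Omega> \<in> sets lebesgue" using open_dom by auto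
  note [measurable] = borel_measurable_integrable[OF g]
  have box_zero: "(LINT x|lebesgue_on \<Omega>. g x * indicator (box a b) x) = 0" if "cbox a b \<subseteq> \<Omega>" for a b
  proof -
    have bump_meas[measurable]: "box_bump n a b \<in> borel_measurable (lebesgue_on \<Omega>)" for n
    proof -
      have "continuous_on UNIV (box_bump n a b)"
        using box_bump_test_function[OF that, of n] by (auto simp: test_functions_def dest: spec[of _ 0])
      then show ?thesis by (intro borel_on borel_measurable_continuous_onI)
    qed
    have [measurable]: "indicator (box a b) \<in> borel_measurable (lebesgue_on \<Omega>)"
      by (intro borel_on) simp
    have "(\<lambda>n. LINT x|lebesgue_on \<Omega>. g x * box_bump n a b x) \<longlonglongrightarrow> (LINT x|lebesgue_on \<Omega>. g x * indicator (box a b) x)"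
    proof (rule integral_dominated_convergence[where w = "\<lambda>x. \<bar>g x\<bar>"])
      show "AE x in lebesgue_on \<Omega>. (\<lambda>n. g x * box_bump n a b x) \<longlonglongrightarrow> g x * indicator (box a b) x"
        by (intro AE_I2 tendsto_mult tendsto_const box_bump_tendsto)
      show "AE x in lebesgue_on \<Omega>. norm (g x * box_bump n a b x) \<le> \<bar>g x\<bar>" for n
        by (intro AE_I2) (simp add: abs_mult mult_left_le box_bump_range)
    qed (use g in auto)
    moreover have "(LINT x|lebesgue_on \<Omega>. g x * box_bump n a b x) = 0" for n
      using zero[OF box_bump_test_function[OF that]] .
    ultimately show ?thesis by (simp add: LIMSEQ_const_iff)
  qed
  \<comment> \<open>the extension by zero, to which differentiation of integrals over all of space applies\<close>
  define G where "G x = (if x \<in> \<Omega> then g x else 0)" for x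
  have G_int: "integrable lebesgue G"
  proof -
    have "G = (\<lambda>x. indicator \<Omega> x *\<^sub>R g x)" by (auto simp: G_def indicator_def)
    then show ?thesis using g \<Omega>_sets by (simp add: integrable_restrict_space)
  qed
  have G_on: "integrable (lebesgue_on S) G" if "S \<in> sets lebesgue" for S
    using integrable_mult_indicator[OF that G_int] that by (simp add: integrable_restrict_space)
  have G_box: "integral (cbox a b) G = 0" if "cbox a b \<subseteq> \<Omega>" for a b
  proof -
    have "integrable (lebesgue_on (box a b)) G"
      by (intro G_on) auto
    then have "integral (box a b) G = (LINT x|lebesgue_on (box a b). G x)"
      by (simp add: lebesgue_integral_eq_integral)
    also have "\<dots> = (LINT x|lebesgue. indicator (box a b) x *\<^sub>R G x)"
      by (simp add: integral_restrict_space)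
    also have "\<dots> = (LINT x|lebesgue. indicator \<Omega> x *\<^sub>R (g x * indicator (box a b) x))"
      using that box_subset_cbox[of a b] by (intro Bochner_Integration.integral_cong) (auto simp: G_def indicator_def)
    also have "\<dots> = (LINT x|lebesgue_on \<Omega>. g x * indicator (box a b) x)"
      using \<Omega>_sets by (simp add: integral_restrict_space)
    finally show ?thesis using box_zero[OF that] by (simp add: integral_open_interval)
  qed
  have G_cbox: "G integrable_on cbox a b" for a b
    by (rule has_integral_integrable[OF has_integral_integral_lebesgue_on[OF G_on]]) auto
  obtain N where N: "negligible N"
    and lim: "\<And>x e. \<lbrakk>x \<notin> N; 0 < e\<rbrakk> \<Longrightarrow> \<exists>d>0. \<forall>h. 0 < h \<and> h < d \<longrightarrow>
        norm (integral (cbox x (x + h *\<^sub>R One)) G /\<^sub>R h ^ DIM(real ^ 'd) - G x) < e"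
    by (rule integrable_ccontinuous_explicit[OF G_cbox]) (rule that)
  have "g x = 0" if x: "x \<in> \<Omega>" "x \<notin> N" for x
  proof (rule ccontr)
    assume "g x \<noteq> 0"
    then have pos: "\<bar>G x\<bar> > 0" using x by (simp add: G_def)
    obtain d where d: "d > 0" and lim': "\<And>h. 0 < h \<Longrightarrow> h < d \<Longrightarrow>
        norm (integral (cbox x (x + h *\<^sub>R One)) G /\<^sub>R h ^ DIM(real ^ 'd) - G x) < \<bar>G x\<bar>"
      using lim[OF x(2) pos] by blast
    obtain r where r: "r > 0" "cball x r \<subseteq> \<Omega>"
      using open_dom x(1) open_contains_cball by blast
    define n where "n = norm (One :: real ^ 'd)"
    have "n \<ge> 0" unfolding n_def by simp
    \<comment> \<open>a box of this side length, with corner x, stays in the ball of radius r around x\<close>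
    define h where "h = min (d / 2) (r / (n + 1))"
    have h: "h > 0" "h < d" using d r \<open>n \<ge> 0\<close> by (auto simp: h_def)
    have "h * n \<le> r"
    proof -
      have "h * n \<le> r / (n + 1) * n" using \<open>n \<ge> 0\<close> by (intro mult_right_mono) (auto simp: h_def)
      also have "\<dots> \<le> r" using \<open>n \<ge> 0\<close> r by (simp add: field_simps)
      finally show ?thesis .
    qed
    have "cbox x (x + h *\<^sub>R One) \<subseteq> cball x r"
    proof
      fix y assume y: "y \<in> cbox x (x + h *\<^sub>R One)"
      have "norm (y - x) \<le> norm (h *\<^sub>R (One :: real ^ 'd))"
      proof (rule norm_le_componentwise)
        fix b :: "real ^ 'd" assume "b \<in> Basis"
        then show "\<bar>(y - x) \<bullet> b\<bar> \<le> \<bar>(h *\<^sub>R One) \<bullet> b\<bar>"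
          using y h(1) by (auto simp: mem_box inner_diff_left inner_add_left)
      qed
      then show "y \<in> cball x r"
        using \<open>h * n \<le> r\<close> h by (simp add: n_def dist_norm norm_minus_commute)
    qed
    then show False
      using lim'[OF h] G_box[of x "x + h *\<^sub>R One"] r by auto
  qed
  then show ?thesis
    using N \<Omega>_sets by (auto simp: AE_restrict_space_iff negligible_iff_null_sets intro!: AE_I'[of N])
qed

end

lemma C_1_D:
  assumes "C_k (Suc 0) f"
  shows "f differentiable (at x)" "continuous_on UNIV (partial_deriv i f)" "continuous_on UNIV f"
proof -
  have f: "f differentiable_on UNIV" and "continuous_on UNIV (partial_deriv i f)"
    using assms by simp_all
  then show "f differentiable (at x)" "continuous_on UNIV (partial_deriv i f)" "continuous_on UNIV f"
    by (simp_all add: differentiable_imp_continuous_on) (simp add: differentiable_on_def)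
qed

lemma partial_deriv_outside:
  assumes "compact K" "\<And>x. x \<notin> K \<Longrightarrow> f x = 0" "x \<notin> K"
  shows "partial_deriv i f x = 0"
proof -
  have "(f has_derivative (\<lambda>v. 0)) (at x)"
  proof (rule has_derivative_transform_within_open[where s = "- K"])
    show "((\<lambda>x. 0) has_derivative (\<lambda>v. 0)) (at x)" by simp
  qed (use assms compact_imp_closed in auto)
  then show ?thesis by (simp add: partial_deriv_eq)
qed

context bounded_open
begin

text \<open>Translation invariance of Lebesgue measure makes the integral of every difference quotient vanish;
  the difference quotients are dominated, by the mean value theorem, by a bounded function with
  compact support.\<close>

lemma integral_partial_deriv_eq_0:
  fixes f :: "real ^ 'd \<Rightarrow> real"
  assumes diff: "\<And>x. f differentiable (at x)"
    and cont: "continuous_on UNIV (partial_deriv i f)"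
    and K: "compact K" "K \<subseteq> \<Omega>" "\<And>x. x \<notin> K \<Longrightarrow> f x = 0"
  shows "(LINT x|lebesgue_on \<Omega>. partial_deriv i f x) = 0"
proof -
  define D where "D = partial_deriv i f"
  have D0: "x \<notin> K \<Longrightarrow> D x = 0" for x
    unfolding D_def using partial_deriv_outside[OF K(1,3)] .
  have fcont: "continuous_on UNIV f"
    using diff by (simp add: continuous_at_imp_continuous_on differentiable_imp_continuous_within)
  have [measurable]: "D \<in> borel_measurable borel" "f \<in> borel_measurable borel"
    using cont fcont by (simp_all add: D_def borel_measurable_continuous_onI)
  obtain r where r: "K \<subseteq> cball 0 r"
    using compact_imp_bounded[OF K(1)] bounded_subset_ballD[of K 0] ball_subset_cball by (meson order_trans)
  obtain M where M: "\<And>x. x \<in> K \<Longrightarrow> norm (D x) \<le> M" and "M \<ge> 0"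
  proof -
    have "bounded (D ` K)"
      using cont K(1) unfolding D_def
      by (intro compact_imp_bounded compact_continuous_image) (auto intro: continuous_on_subset)
    then show ?thesis using that unfolding bounded_pos by (auto intro: less_imp_le)
  qed
  have M': "norm (D x) \<le> M" for x
    using M[of x] D0[of x] \<open>M \<ge> 0\<close> by (cases "x \<in> K") auto
  define e :: "real ^ 'd" where "e = axis i 1"
  have ne: "norm e = 1" by (simp add: e_def)
  have line: "((\<lambda>s. f (x + s *\<^sub>R e)) has_real_derivative D (x + s *\<^sub>R e)) (at s)" for x s
  proof -
    obtain f' where f': "(f has_derivative f') (at (x + s *\<^sub>R e))"
      using diff by (auto simp: differentiable_def)
    have "((\<lambda>s. x + s *\<^sub>R e) has_derivative (\<lambda>h. h *\<^sub>R e)) (at s)"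
      by (auto intro!: derivative_eq_intros)
    from has_derivative_compose[OF this f']
    have "((\<lambda>s. f (x + s *\<^sub>R e)) has_derivative (\<lambda>h. f' (h *\<^sub>R e))) (at s)" .
    moreover have "f' (h *\<^sub>R e) = D (x + s *\<^sub>R e) * h" for h
      unfolding D_def partial_deriv_eq[OF f'] e_def[symmetric]
      using linear_cmul[OF has_derivative_linear[OF f']] by simp
    ultimately show ?thesis by (simp add: has_field_derivative_def)
  qed
  have lip: "\<bar>f (x + t *\<^sub>R e) - f x\<bar> \<le> M * t" if "t > 0" for x t
  proof -
    obtain z where "f (x + t *\<^sub>R e) - f (x + 0 *\<^sub>R e) = (t - 0) * D (x + z *\<^sub>R e)"
      using MVT2[OF \<open>t > 0\<close>, of "\<lambda>s. f (x + s *\<^sub>R e)" "\<lambda>s. D (x + s *\<^sub>R e)"] line by blast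
    then show ?thesis using that M'[of "x + z *\<^sub>R e"] by (simp add: abs_mult mult.commute mult_left_mono)
  qed
  define q where "q n x = real (Suc n) * (f (x + (1 / real (Suc n)) *\<^sub>R e) - f x)" for n x
  have f_int: "integrable lborel f"
  proof -
    have "integrable lborel (\<lambda>x. indicator K x *\<^sub>R f x)"
      using borel_integrable_compact[OF K(1), of f] fcont continuous_on_subset by auto
    moreover have "(\<lambda>x. indicator K x *\<^sub>R f x) = f" using K(3) by (intro ext) (auto simp: indicator_def)
    ultimately show ?thesis by simp
  qed
  have shift_int: "integrable lborel (\<lambda>x. f (x + a))" and shift: "(LINT x|lborel. f (x + a)) = (LINT x|lborel. f x)" for a
  proof -
    have d: "lborel = distr lborel borel (\<lambda>x. a + x)" using lborel_distr_plus[of a] by simp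
    have "integrable (distr lborel borel (\<lambda>x. a + x)) f" using f_int d by simp
    then show "integrable lborel (\<lambda>x. f (x + a))"
      by (subst (asm) integrable_distr_eq) (auto simp: add.commute)
    have "(LINT x|lborel. f x) = (LINT x|distr lborel borel (\<lambda>x. a + x). f x)" using d by simp
    also have "\<dots> = (LINT x|lborel. f (a + x))" by (subst integral_distr) auto
    finally show "(LINT x|lborel. f (x + a)) = (LINT x|lborel. f x)" by (simp add: add.commute)
  qed
  have q0: "(LINT x|lborel. q n x) = 0" for n
    unfolding q_def using f_int shift_int shift by simp
  have "(\<lambda>n. LINT x|lborel. q n x) \<longlonglongrightarrow> (LINT x|lborel. D x)"
  proof (rule integral_dominated_convergence[where w = "\<lambda>x. M * indicator (cball 0 (r + 1)) x"])
    show "integrable lborel (\<lambda>x::real^'d. M * indicator (cball 0 (r + 1)) x)"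
      by (intro integrable_mult_right integrable_real_indicator) (use emeasure_lborel_cball_finite in \<open>auto simp: less_top\<close>)
    show "AE x in lborel. (\<lambda>n. q n x) \<longlonglongrightarrow> D x"
    proof (rule AE_I2)
      fix x
      have "((\<lambda>h. (f (x + (0 + h) *\<^sub>R e) - f (x + 0 *\<^sub>R e)) / h) \<longlongrightarrow> D (x + 0 *\<^sub>R e)) (at 0)"
        using line[of x 0] unfolding DERIV_def .
      moreover have "filterlim (\<lambda>n. 1 / real (Suc n)) (at 0) sequentially"
        unfolding filterlim_at using LIMSEQ_inverse_real_of_nat by (auto simp: inverse_eq_divide)
      ultimately have "(\<lambda>n. (f (x + (0 + 1 / real (Suc n)) *\<^sub>R e) - f (x + 0 *\<^sub>R e)) / (1 / real (Suc n))) \<longlonglongrightarrow> D (x + 0 *\<^sub>R e)"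
        by (rule filterlim_compose)
      then show "(\<lambda>n. q n x) \<longlonglongrightarrow> D x" by (simp add: q_def mult.commute)
    qed
    show "AE x in lborel. norm (q n x) \<le> M * indicator (cball 0 (r + 1)) x" for n
    proof (rule AE_I2)
      fix x
      define t where "t = 1 / real (Suc n)"
      have t: "0 < t" "t \<le> 1" "real (Suc n) * t = 1" by (auto simp: t_def)
      show "norm (q n x) \<le> M * indicator (cball 0 (r + 1)) x"
      proof (cases "x \<in> cball 0 (r + 1)")
        case True
        have "norm (q n x) = real (Suc n) * \<bar>f (x + t *\<^sub>R e) - f x\<bar>"
          unfolding q_def t_def by (simp add: abs_mult)
        also have "\<dots> \<le> real (Suc n) * (M * t)" using lip[OF t(1)] by (intro mult_left_mono) auto
        also have "\<dots> = M" using t(3) by (metis mult.commute mult.left_commute mult_1_right)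
        finally show ?thesis using True by simp
      next
        case False
        have "norm x \<le> norm (x + t *\<^sub>R e) + norm (t *\<^sub>R e)"
          using norm_triangle_ineq4[of "x + t *\<^sub>R e" "t *\<^sub>R e"] by simp
        then have "x + t *\<^sub>R e \<notin> K" "x \<notin> K" using r False t ne by (auto dest!: subsetD)
        then show ?thesis using K(3) \<open>M \<ge> 0\<close> by (simp add: q_def t_def)
      qed
    qed
  qed (auto simp: q_def)
  then have "(LINT x|lborel. D x) = 0" unfolding q0 by (simp add: LIMSEQ_const_iff)
  moreover have "(LINT x|lebesgue_on \<Omega>. D x) = (LINT x|lborel. D x)"
  proof -
    have "(LINT x|lebesgue_on \<Omega>. D x) = (LINT x|lebesgue. indicator \<Omega> x *\<^sub>R D x)"
      using open_dom by (simp add: integral_restrict_space)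
    also have "(\<lambda>x. indicator \<Omega> x *\<^sub>R D x) = D" using D0 K(2) by (intro ext) (auto simp: indicator_def)
    finally show ?thesis by (simp add: integral_completion)
  qed
  ultimately show ?thesis unfolding D_def by simp
qed

end

section \<open>Weak gradients\<close>

context bounded_open
begin

lemma compact_support_ess_bounded:
  fixes f :: "real ^ 'd \<Rightarrow> real"
  assumes "continuous_on UNIV f" "compact K" "\<And>x. x \<notin> K \<Longrightarrow> f x = 0"
  shows "ess_bounded \<Omega> f"
proof -
  have "bounded (f ` K)"
    using assms by (intro compact_imp_bounded compact_continuous_image) (auto intro: continuous_on_subset)
  then obtain M where "M > 0" "\<forall>y \<in> f ` K. norm y \<le> M" unfolding bounded_pos by blast
  then have "norm (f x) \<le> M" for x using assms(3)[of x] by (cases "x \<in> K") auto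
  then show ?thesis
    using assms(1) by (auto simp: ess_bounded_def intro: borel_on borel_measurable_continuous_onI)
qed

lemma test_function_D:
  assumes "\<psi> \<in> test_functions \<Omega>"
  shows "\<psi> differentiable (at x)" "continuous_on UNIV (partial_deriv i \<psi>)" "continuous_on UNIV \<psi>"
    "ess_bounded \<Omega> \<psi>" "ess_bounded \<Omega> (partial_deriv i \<psi>)" "\<psi> \<in> L2 \<Omega>" "partial_deriv i \<psi> \<in> L2 \<Omega>"
proof -
  have C: "C_k (Suc 0) \<psi>" using assms by (auto simp: test_functions_def)
  show c: "\<psi> differentiable (at x)" "continuous_on UNIV (partial_deriv i \<psi>)" "continuous_on UNIV \<psi>"
    using C_1_D[OF C] by auto
  obtain K where K: "compact K" "\<And>x. x \<notin> K \<Longrightarrow> \<psi> x = 0"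
    using assms by (auto simp: test_functions_def)
  show b: "ess_bounded \<Omega> \<psi>" "ess_bounded \<Omega> (partial_deriv i \<psi>)"
    using compact_support_ess_bounded[OF c(3) K]
      compact_support_ess_bounded[OF c(2) K(1) partial_deriv_outside[OF K]] by auto
  show "\<psi> \<in> L2 \<Omega>" "partial_deriv i \<psi> \<in> L2 \<Omega>" using b by (auto intro: ess_bounded_L2)
qed

lemma partial_deriv_mult:
  assumes "f differentiable (at x)" "g differentiable (at x)"
  shows "partial_deriv i (\<lambda>x. f x * g x) x = f x * partial_deriv i g x + partial_deriv i f x * g x"
proof -
  have f: "(f has_derivative frechet_derivative f (at x)) (at x)"
    and g: "(g has_derivative frechet_derivative g (at x)) (at x)"
    using assms by (simp_all add: frechet_derivative_works)
  show ?thesis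
    using partial_deriv_eq[OF has_derivative_mult[OF f g]] by (simp add: partial_deriv_def)
qed

text \<open>The product of a smooth function and a test function has compact support, so its partial
  derivatives integrate to zero.\<close>

lemma test_function_by_parts:
  assumes f: "\<And>x. f differentiable (at x)" "\<And>i. continuous_on UNIV (partial_deriv i f)"
    and \<psi>: "\<psi> \<in> test_functions \<Omega>"
  shows "(LINT x|lebesgue_on \<Omega>. f x * partial_deriv i \<psi> x + partial_deriv i f x * \<psi> x) = 0"
proof -
  obtain K where K: "compact K" "K \<subseteq> \<Omega>" "\<And>x. x \<notin> K \<Longrightarrow> \<psi> x = 0"
    using \<psi> by (auto simp: test_functions_def)
  have cont: "continuous_on UNIV f"
    using f(1) by (simp add: continuous_at_imp_continuous_on differentiable_imp_continuous_within)
  have eq: "partial_deriv i (\<lambda>x. f x * \<psi> x) = (\<lambda>x. f x * partial_deriv i \<psi> x + partial_deriv i f x * \<psi> x)"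
    using f(1) test_function_D(1)[OF \<psi>] by (intro ext partial_deriv_mult)
  have "(LINT x|lebesgue_on \<Omega>. partial_deriv i (\<lambda>x. f x * \<psi> x) x) = 0"
  proof (rule integral_partial_deriv_eq_0)
    show "continuous_on UNIV (partial_deriv i (\<lambda>x. f x * \<psi> x))"
      unfolding eq by (intro continuous_intros cont f test_function_D(2,3)[OF \<psi>])
  qed (use K f(1) test_function_D(1)[OF \<psi>] in auto)
  then show ?thesis unfolding eq .
qed

lemma L2_vec:
  fixes f :: "real ^ 'd \<Rightarrow> 'b::euclidean_space ^ 'n::finite"
  assumes "\<And>i. (\<lambda>x. f x $ i) \<in> L2 \<Omega>"
  shows "f \<in> L2 \<Omega>"
proof -
  have "bounded_linear (axis i :: 'b \<Rightarrow> 'b ^ 'n)" for i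
    unfolding linear_conv_bounded_linear[symmetric]
    by (rule linearI) (simp_all add: vec_eq_iff axis_def)
  then have "(\<lambda>x. axis i (f x $ i)) \<in> L2 \<Omega>" for i
    using L2_linear_image[OF assms] by blast
  then have "(\<lambda>x. \<Sum>i\<in>UNIV. 1 *\<^sub>R axis i (f x $ i)) \<in> L2 \<Omega>"
    by (intro l2.sum_mem) auto
  moreover have "(\<Sum>i\<in>UNIV. 1 *\<^sub>R axis i (f x $ i)) = f x" for x
    by (simp add: vec_eq_iff axis_def if_distrib cong: if_cong)
  ultimately show ?thesis by simp
qed

lemma L2_vec_nth:
  fixes f :: "real ^ 'd \<Rightarrow> 'b::euclidean_space ^ 'n::finite"
  shows "f \<in> L2 \<Omega> \<Longrightarrow> (\<lambda>x. f x $ i) \<in> L2 \<Omega>"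
  by (rule L2_linear_image) (auto intro: bounded_linear_vec_nth)

lemma test_function_weak_grad:
  assumes \<psi>: "\<psi> \<in> test_functions \<Omega>"
  shows "is_weak_grad \<Omega> \<psi> (\<lambda>x. \<chi> i. partial_deriv i \<psi> x)"
  unfolding is_weak_grad_def
proof (intro conjI ballI allI)
  show "(\<lambda>x. \<chi> i. partial_deriv i \<psi> x) \<in> L2 \<Omega>"
    by (rule L2_vec) (simp add: test_function_D(7)[OF \<psi>])
  fix \<eta> i assume \<eta>: "\<eta> \<in> test_functions \<Omega>"
  have "(LINT x|lebesgue_on \<Omega>. \<psi> x * partial_deriv i \<eta> x + partial_deriv i \<psi> x * \<eta> x)
      = l2_inner \<Omega> \<psi> (partial_deriv i \<eta>) + l2_inner \<Omega> (partial_deriv i \<psi>) \<eta>"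
    unfolding l2_inner_def
    using L2_integrable_inner[OF test_function_D(6)[OF \<psi>] test_function_D(7)[OF \<eta>], of i]
      L2_integrable_inner[OF test_function_D(7)[OF \<psi>] test_function_D(6)[OF \<eta>], of i] by simp
  then show "l2_inner \<Omega> \<psi> (partial_deriv i \<eta>) = - l2_inner \<Omega> (\<lambda>x. (\<chi> i. partial_deriv i \<psi> x) $ i) \<eta>"
    using test_function_by_parts[OF test_function_D(1,2)[OF \<psi>] \<eta>, of i] by simp
qed

lemma const_L2: "(\<lambda>x. c) \<in> L2 \<Omega>"
  by (rule ess_bounded_L2) (auto simp: ess_bounded_def)

lemma weak_grad_const:
  assumes "f \<in> L2 \<Omega>" "AE x in lebesgue_on \<Omega>. f x = c"
  shows "is_weak_grad \<Omega> f (\<lambda>x. 0)"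
  unfolding is_weak_grad_def
proof (intro conjI ballI allI)
  show "(\<lambda>x. 0) \<in> L2 \<Omega>" by (rule l2.zero_mem)
  fix \<eta> i assume \<eta>: "\<eta> \<in> test_functions \<Omega>"
  have "l2_inner \<Omega> f (partial_deriv i \<eta>) = l2_inner \<Omega> (\<lambda>x. c) (partial_deriv i \<eta>)"
    using assms test_function_D(7)[OF \<eta>] by (intro l2_inner_cong_AE) (auto simp: const_L2)
  also have "\<dots> = 0"
    using test_function_by_parts[OF _ _ \<eta>, of "\<lambda>x. c" i]
    by (simp add: l2_inner_def partial_deriv_def frechet_derivative_const)
  finally show "l2_inner \<Omega> f (partial_deriv i \<eta>) = - l2_inner \<Omega> (\<lambda>x. 0 $ i) \<eta>"
    by (simp add: l2_inner_def)
qed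

lemma weak_grad_add:
  assumes "f \<in> L2 \<Omega>" "f' \<in> L2 \<Omega>" "is_weak_grad \<Omega> f g" "is_weak_grad \<Omega> f' g'"
  shows "is_weak_grad \<Omega> (\<lambda>x. f x + f' x) (\<lambda>x. g x + g' x)"
proof -
  have L: "g \<in> L2 \<Omega>" "g' \<in> L2 \<Omega>" using assms(3,4) by (auto simp: is_weak_grad_def)
  then have Li: "(\<lambda>x. g x $ i) \<in> L2 \<Omega>" "(\<lambda>x. g' x $ i) \<in> L2 \<Omega>" for i by (auto intro: L2_vec_nth)
  show ?thesis
    using assms Li L2_add[OF L]
    by (auto simp: is_weak_grad_def l2.add_left test_function_D(6,7))
qed

lemma weak_grad_scale:
  assumes "f \<in> L2 \<Omega>" "is_weak_grad \<Omega> f g"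
  shows "is_weak_grad \<Omega> (\<lambda>x. c * f x) (\<lambda>x. c *\<^sub>R g x)"
proof -
  have L: "g \<in> L2 \<Omega>" using assms(2) by (auto simp: is_weak_grad_def)
  then have Li: "(\<lambda>x. g x $ i) \<in> L2 \<Omega>" for i by (auto intro: L2_vec_nth)
  have "l2_inner \<Omega> (\<lambda>x. c * f x) \<psi> = c * l2_inner \<Omega> f \<psi>" if "f \<in> L2 \<Omega>" "\<psi> \<in> L2 \<Omega>" for f \<psi> :: "real ^ 'd \<Rightarrow> real"
    using l2.scale_left[OF that] by simp
  then show ?thesis
    using assms Li L2_scaleR[OF L]
    by (auto simp: is_weak_grad_def test_function_D(6,7))
qed

text \<open>The weak gradient of the formalization is an arbitrary choice; the fundamental lemma makes it unique
  up to null sets, and only thereby linear.\<close>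

lemma weak_grad_unique:
  assumes "is_weak_grad \<Omega> f g" "is_weak_grad \<Omega> f g'"
  shows "AE x in lebesgue_on \<Omega>. g x = g' x"
proof -
  have L: "g \<in> L2 \<Omega>" "g' \<in> L2 \<Omega>" using assms by (auto simp: is_weak_grad_def)
  then have Li: "(\<lambda>x. g x $ i) \<in> L2 \<Omega>" "(\<lambda>x. g' x $ i) \<in> L2 \<Omega>" for i by (auto intro: L2_vec_nth)
  have "AE x in lebesgue_on \<Omega>. g x $ i - g' x $ i = 0" for i
  proof (rule test_function_vanishing_ae)
    show "integrable (lebesgue_on \<Omega>) (\<lambda>x. g x $ i - g' x $ i)"
      by (intro L2_integrable l2.diff_mem Li)
    fix \<psi> assume \<psi>: "\<psi> \<in> test_functions \<Omega>"
    have "l2_inner \<Omega> (\<lambda>x. g x $ i - g' x $ i) \<psi> = l2_inner \<Omega> (\<lambda>x. g x $ i) \<psi> - l2_inner \<Omega> (\<lambda>x. g' x $ i) \<psi>"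
      by (intro l2.diff_left Li test_function_D[OF \<psi>])
    also have "\<dots> = 0" using assms \<psi> by (auto simp: is_weak_grad_def)
    finally show "(LINT x|lebesgue_on \<Omega>. (g x $ i - g' x $ i) * \<psi> x) = 0" by (simp add: l2_inner_def)
  qed
  then have "AE x in lebesgue_on \<Omega>. \<forall>i\<in>UNIV. g x $ i - g' x $ i = 0"
    by (intro AE_finite_allI) auto
  then show ?thesis by eventually_elim (simp add: vec_eq_iff)
qed

lemma H1_L2: "f \<in> H1 \<Omega> \<Longrightarrow> f \<in> L2 \<Omega>"
  by (simp add: H1_def)

lemma wgrad_weak_grad: "f \<in> H1 \<Omega> \<Longrightarrow> is_weak_grad \<Omega> f (wgrad \<Omega> f)"
  unfolding wgrad_def H1_def using someI_ex[of "is_weak_grad \<Omega> f"] by simp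

lemma wgrad_L2: "f \<in> H1 \<Omega> \<Longrightarrow> wgrad \<Omega> f \<in> L2 \<Omega>"
  using wgrad_weak_grad by (auto simp: is_weak_grad_def)

lemma weak_grad_H1: "f \<in> L2 \<Omega> \<Longrightarrow> is_weak_grad \<Omega> f g \<Longrightarrow> f \<in> H1 \<Omega>"
  by (auto simp: H1_def)

lemma wgrad_AE: "f \<in> L2 \<Omega> \<Longrightarrow> is_weak_grad \<Omega> f g \<Longrightarrow> AE x in lebesgue_on \<Omega>. wgrad \<Omega> f x = g x"
  using weak_grad_unique wgrad_weak_grad weak_grad_H1 by blast

lemma H1_add: "f \<in> H1 \<Omega> \<Longrightarrow> g \<in> H1 \<Omega> \<Longrightarrow> (\<lambda>x. f x + g x) \<in> H1 \<Omega>"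
  by (rule weak_grad_H1[OF L2_add weak_grad_add]) (auto intro: H1_L2 wgrad_weak_grad)

lemma H1_scale: "f \<in> H1 \<Omega> \<Longrightarrow> (\<lambda>x. c * f x) \<in> H1 \<Omega>"
  using weak_grad_H1[OF L2_scaleR[of f \<Omega> c], OF _ weak_grad_scale[of f, folded real_scaleR_def]]
  by (auto intro: H1_L2 wgrad_weak_grad)

lemma wgrad_add: "f \<in> H1 \<Omega> \<Longrightarrow> g \<in> H1 \<Omega> \<Longrightarrow>
    AE x in lebesgue_on \<Omega>. wgrad \<Omega> (\<lambda>x. f x + g x) x = wgrad \<Omega> f x + wgrad \<Omega> g x"
  by (rule wgrad_AE[OF L2_add weak_grad_add]) (auto intro: H1_L2 wgrad_weak_grad)

lemma wgrad_scale: "f \<in> H1 \<Omega> \<Longrightarrow>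
    AE x in lebesgue_on \<Omega>. wgrad \<Omega> (\<lambda>x. c * f x) x = c *\<^sub>R wgrad \<Omega> f x"
  by (rule wgrad_AE[OF H1_L2[OF H1_scale] weak_grad_scale]) (auto intro: H1_L2 wgrad_weak_grad)

lemma H1_zero: "(\<lambda>x. 0) \<in> H1 \<Omega>"
  using weak_grad_H1[OF l2.zero_mem weak_grad_const[OF l2.zero_mem, of 0]] by simp

text \<open>The Dirichlet form. Gradients of sums and multiples agree with sums and multiples of gradients only
  almost everywhere, which the integral does not see.\<close>

sublocale dir: semi_inner "H1 \<Omega>" "\<lambda>f g. l2_inner \<Omega> (wgrad \<Omega> f) (wgrad \<Omega> g)"
proof
  fix f g h :: "real ^ 'd \<Rightarrow> real" and c :: real
  assume f: "f \<in> H1 \<Omega>"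
  show "(\<lambda>x. c *\<^sub>R f x) \<in> H1 \<Omega>" using H1_scale[OF f] by simp
  show "0 \<le> l2_inner \<Omega> (wgrad \<Omega> f) (wgrad \<Omega> f)" by (rule l2.nonneg[OF wgrad_L2[OF f]])
  assume g: "g \<in> H1 \<Omega>"
  show "l2_inner \<Omega> (wgrad \<Omega> f) (wgrad \<Omega> g) = l2_inner \<Omega> (wgrad \<Omega> g) (wgrad \<Omega> f)"
    by (rule l2.sym) (auto intro: wgrad_L2 f g)
  show "(\<lambda>x. f x + g x) \<in> H1 \<Omega>" by (rule H1_add[OF f g])
  assume h: "h \<in> H1 \<Omega>"
  have "l2_inner \<Omega> (wgrad \<Omega> (\<lambda>x. f x + g x)) (wgrad \<Omega> h) = l2_inner \<Omega> (\<lambda>x. wgrad \<Omega> f x + wgrad \<Omega> g x) (wgrad \<Omega> h)"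
    by (rule l2_inner_cong_AE) (auto intro: wgrad_L2 f g h H1_add L2_add wgrad_add)
  then show "l2_inner \<Omega> (wgrad \<Omega> (\<lambda>x. f x + g x)) (wgrad \<Omega> h)
      = l2_inner \<Omega> (wgrad \<Omega> f) (wgrad \<Omega> h) + l2_inner \<Omega> (wgrad \<Omega> g) (wgrad \<Omega> h)"
    by (simp add: l2.add_left wgrad_L2 f g h)
next
  fix f h :: "real ^ 'd \<Rightarrow> real" and c :: real
  assume f: "f \<in> H1 \<Omega>" and h: "h \<in> H1 \<Omega>"
  have "l2_inner \<Omega> (wgrad \<Omega> (\<lambda>x. c * f x)) (wgrad \<Omega> h) = l2_inner \<Omega> (\<lambda>x. c *\<^sub>R wgrad \<Omega> f x) (wgrad \<Omega> h)"
    by (rule l2_inner_cong_AE) (auto intro: wgrad_L2 f h H1_scale L2_scaleR wgrad_scale)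
  then show "l2_inner \<Omega> (wgrad \<Omega> (\<lambda>x. c *\<^sub>R f x)) (wgrad \<Omega> h) = c * l2_inner \<Omega> (wgrad \<Omega> f) (wgrad \<Omega> h)"
    by (simp add: l2.scale_left wgrad_L2 f h)
qed (rule H1_zero)

end

section \<open>Finite-dimensional spaces of functions\<close>

text \<open>Equivalence of norms in finite dimension, for seminorms: expand along an orthonormal family; the
  coefficients are bounded by the norm of the form, and the remainder is null for the form, hence
  for the seminorm.\<close>

lemma (in semi_inner) finite_dim_seminorm_bound:
  fixes v :: "'i \<Rightarrow> 'a \<Rightarrow> 'b" and q :: "('a \<Rightarrow> 'b) \<Rightarrow> real"
  assumes fin: "finite I" "\<And>i. i \<in> I \<Longrightarrow> v i \<in> Y"
    and q_add: "\<And>f g. f \<in> Y \<Longrightarrow> g \<in> Y \<Longrightarrow> q (\<lambda>x. f x + g x) \<le> q f + q g"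
    and q_scale: "\<And>f c. f \<in> Y \<Longrightarrow> q (\<lambda>x. c *\<^sub>R f x) = \<bar>c\<bar> * q f"
    and q_null: "\<And>f. f \<in> Y \<Longrightarrow> p f f = 0 \<Longrightarrow> q f = 0"
  shows "\<exists>C. \<forall>f \<in> {\<lambda>x. \<Sum>i\<in>I. c i *\<^sub>R v i x | c. True}. q f \<le> C * sqrt (p f f)"
proof -
  let ?X = "{\<lambda>x. \<Sum>i\<in>I. c i *\<^sub>R v i x | c. True}"
  obtain n :: nat and e where e: "\<And>k. k < n \<Longrightarrow> e k \<in> ?X"
    "\<And>j k. j < n \<Longrightarrow> k < n \<Longrightarrow> p (e j) (e k) = (if j = k then 1 else 0)"
    "\<And>f. f \<in> ?X \<Longrightarrow> p (\<lambda>x. f x - (\<Sum>k<n. p f (e k) *\<^sub>R e k x)) (\<lambda>x. f x - (\<Sum>k<n. p f (e k) *\<^sub>R e k x)) = 0"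
    by (rule gram_schmidt[of I v]) (use fin in simp, use fin in simp, rule that)
  have XY: "f \<in> ?X \<Longrightarrow> f \<in> Y" for f
    using sum_mem[of I v] fin(2) by auto
  have eY: "k < n \<Longrightarrow> e k \<in> Y" for k using e(1) XY by blast
  have q_zero: "q (\<lambda>x. 0) = 0" by (rule q_null[OF zero_mem]) (rule zero_left[OF zero_mem])
  have q_sum: "q (\<lambda>x. \<Sum>k<m. c k *\<^sub>R e k x) \<le> (\<Sum>k<m. \<bar>c k\<bar> * q (e k))" if "m \<le> n" for m c
    using that
  proof (induction m)
    case (Suc m)
    have "q (\<lambda>x. (\<Sum>k<m. c k *\<^sub>R e k x) + c m *\<^sub>R e m x) \<le> q (\<lambda>x. \<Sum>k<m. c k *\<^sub>R e k x) + q (\<lambda>x. c m *\<^sub>R e m x)"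
      using Suc.prems eY by (intro q_add sum_mem scale_mem) auto
    then show ?case using Suc eY q_scale[of "e m" "c m"] by simp
  qed (simp add: q_zero)
  have q_nonneg: "0 \<le> q (e k)" if "k < n" for k
  proof -
    have "q (\<lambda>x. e k x + (-1) *\<^sub>R e k x) \<le> q (e k) + q (\<lambda>x. (-1) *\<^sub>R e k x)"
      using eY[OF that] by (intro q_add scale_mem)
    then show ?thesis using q_scale[OF eY[OF that], of "-1"] q_zero by simp
  qed
  have "q f \<le> (\<Sum>k<n. q (e k)) * sqrt (p f f)" if f: "f \<in> ?X" for f
  proof -
    let ?r = "\<lambda>x. f x - (\<Sum>k<n. p f (e k) *\<^sub>R e k x)"
    have fY: "f \<in> Y" using XY[OF f] .
    have P: "(\<lambda>x. \<Sum>k<n. p f (e k) *\<^sub>R e k x) \<in> Y" by (rule sum_mem) (auto intro: eY)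
    have "q (\<lambda>x. ?r x + (\<Sum>k<n. p f (e k) *\<^sub>R e k x)) \<le> q ?r + q (\<lambda>x. \<Sum>k<n. p f (e k) *\<^sub>R e k x)"
      by (rule q_add[OF diff_mem[OF fY P] P])
    also have "q ?r = 0" by (rule q_null[OF diff_mem[OF fY P] e(3)[OF f]])
    also have "q (\<lambda>x. \<Sum>k<n. p f (e k) *\<^sub>R e k x) \<le> (\<Sum>k<n. \<bar>p f (e k)\<bar> * q (e k))"
      by (rule q_sum) simp
    also have "\<dots> \<le> (\<Sum>k<n. sqrt (p f f) * q (e k))"
    proof (intro sum_mono mult_right_mono)
      fix k assume "k \<in> {..<n}"
      then show "\<bar>p f (e k)\<bar> \<le> sqrt (p f f)" "0 \<le> q (e k)"
        using Cauchy_Schwarz[OF fY eY, of k] e(2)[of k k] q_nonneg by auto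
    qed
    finally show ?thesis by (simp add: sum_distrib_left mult.commute)
  qed
  then show ?thesis by blast
qed

lemma fin_dim_space_add:
  assumes "fin_dim_space X" "f \<in> X" "g \<in> X"
  shows "(\<lambda>x. f x + g x) \<in> X"
proof -
  obtain B where B: "X = {\<lambda>x. \<Sum>b\<in>B. c b *\<^sub>R b x | c. True}" using assms(1) by (auto simp: fin_dim_space_def)
  obtain c d where "f = (\<lambda>x. \<Sum>b\<in>B. c b *\<^sub>R b x)" "g = (\<lambda>x. \<Sum>b\<in>B. d b *\<^sub>R b x)"
    using assms(2,3) unfolding B by blast
  then have "(\<lambda>x. f x + g x) = (\<lambda>x. \<Sum>b\<in>B. (c b + d b) *\<^sub>R b x)"
    by (simp add: scaleR_add_left sum.distrib)
  then show ?thesis unfolding B by (intro CollectI exI[of _ "\<lambda>b. c b + d b"]) simp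
qed

lemma fin_dim_space_scale:
  assumes "fin_dim_space X" "f \<in> X"
  shows "(\<lambda>x. a *\<^sub>R f x) \<in> X"
proof -
  obtain B where B: "X = {\<lambda>x. \<Sum>b\<in>B. c b *\<^sub>R b x | c. True}" using assms(1) by (auto simp: fin_dim_space_def)
  obtain c where "f = (\<lambda>x. \<Sum>b\<in>B. c b *\<^sub>R b x)"
    using assms(2) unfolding B by blast
  then have "(\<lambda>x. a *\<^sub>R f x) = (\<lambda>x. \<Sum>b\<in>B. (a * c b) *\<^sub>R b x)"
    by (simp add: scaleR_sum_right)
  then show ?thesis unfolding B by (intro CollectI exI[of _ "\<lambda>b. a * c b"]) simp
qed

lemma mem_span_family:
  fixes B :: "('a \<Rightarrow> 'b::real_vector) set"
  assumes "finite B" "b \<in> B"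
  shows "b \<in> {\<lambda>x. \<Sum>b\<in>B. c b *\<^sub>R b x | c. True}"
proof -
  have "(\<Sum>b'\<in>B. (if b' = b then 1 else 0) *\<^sub>R b' x) = (\<Sum>b'\<in>B. if b' = b then b x else 0)" for x
    by (rule sum.cong) auto
  then have "b = (\<lambda>x. \<Sum>b'\<in>B. (if b' = b then 1 else 0) *\<^sub>R b' x)"
    using assms by simp
  then show ?thesis by (intro CollectI exI[of _ "\<lambda>b'. if b' = b then 1 else 0"]) simp
qed

section \<open>A Poincare inequality in one direction\<close>

context bounded_open
begin

lemma l2_norm_cong_AE:
  assumes "f \<in> L2 \<Omega>" "g \<in> L2 \<Omega>" "AE x in lebesgue_on \<Omega>. f x = g x"
  shows "l2_norm \<Omega> f = l2_norm \<Omega> g"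
  unfolding l2_norm_def using l2_inner_cong_AE[OF assms(1,2) assms(1,2) assms(3,3)] by simp

lemma l2_norm_triangle:
  "f \<in> L2 \<Omega> \<Longrightarrow> g \<in> L2 \<Omega> \<Longrightarrow> l2_norm \<Omega> (\<lambda>x. f x + g x) \<le> l2_norm \<Omega> f + l2_norm \<Omega> g"
  unfolding l2_norm_def by (rule l2.triangle)

lemma l2_norm_scale: "f \<in> L2 \<Omega> \<Longrightarrow> l2_norm \<Omega> (\<lambda>x. c *\<^sub>R f x) = \<bar>c\<bar> * l2_norm \<Omega> f"
  unfolding l2_norm_def by (simp add: l2.scale_scale real_sqrt_mult)

lemma l2_norm_mono_AE:
  assumes "f \<in> L2 \<Omega>" "g \<in> L2 \<Omega>" "AE x in lebesgue_on \<Omega>. norm (f x) \<le> norm (g x)"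
  shows "l2_norm \<Omega> f \<le> l2_norm \<Omega> g"
proof -
  have "l2_inner \<Omega> f f \<le> l2_inner \<Omega> g g"
    unfolding l2_inner_def
    by (rule integral_mono_AE)
      (use assms(3) in \<open>auto intro!: L2_integrable_inner assms elim!: eventually_mono simp: norm_le\<close>)
  then show ?thesis by (simp add: l2_norm_def)
qed

lemma l2_norm_mult_le:
  fixes f :: "real ^ 'd \<Rightarrow> 'b::euclidean_space"
  assumes "f \<in> L2 \<Omega>" "a \<in> borel_measurable (lebesgue_on \<Omega>)" "AE x in lebesgue_on \<Omega>. \<bar>a x\<bar> \<le> c"
  shows "l2_norm \<Omega> (\<lambda>x. a x *\<^sub>R f x) \<le> \<bar>c\<bar> * l2_norm \<Omega> f"
proof -
  have "ess_bounded \<Omega> a" using assms(2,3) by (auto simp: ess_bounded_def)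
  then have "l2_norm \<Omega> (\<lambda>x. a x *\<^sub>R f x) \<le> l2_norm \<Omega> (\<lambda>x. c *\<^sub>R f x)"
    using assms by (intro l2_norm_mono_AE L2_mult_bounded L2_scaleR)
      (auto elim!: eventually_mono intro!: mult_right_mono)
  then show ?thesis using assms(1) by (simp add: l2_norm_scale)
qed

lemma Cauchy_Schwarz_l2:
  "f \<in> L2 \<Omega> \<Longrightarrow> g \<in> L2 \<Omega> \<Longrightarrow> \<bar>l2_inner \<Omega> f g\<bar> \<le> l2_norm \<Omega> f * l2_norm \<Omega> g"
  unfolding l2_norm_def by (rule l2.Cauchy_Schwarz)

lemma l2_norm_vec_nth_le:
  fixes f :: "real ^ 'd \<Rightarrow> 'b::euclidean_space ^ 'n::finite"
  shows "f \<in> L2 \<Omega> \<Longrightarrow> l2_norm \<Omega> (\<lambda>x. f x $ i) \<le> l2_norm \<Omega> f"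
  by (intro l2_norm_mono_AE L2_vec_nth AE_I2 Finite_Cartesian_Product.norm_nth_le)

text \<open>Integrating the derivative in direction \<open>j\<close> of \<open>x\<^sub>j \<psi>\<^sup>2\<close> gives \<open>\<integral> \<psi>\<^sup>2 = - 2 \<integral> x\<^sub>j \<psi> \<partial>\<^sub>j\<psi>\<close>, and
  Cauchy-Schwarz finishes the proof. A single partial derivative is enough.\<close>

lemma test_function_poincare:
  assumes \<psi>: "\<psi> \<in> test_functions \<Omega>" and r: "\<And>x. x \<in> \<Omega> \<Longrightarrow> norm x \<le> r" "0 \<le> r"
  shows "l2_norm \<Omega> \<psi> \<le> 2 * r * l2_norm \<Omega> (partial_deriv j \<psi>)"
proof -
  note D = test_function_D[OF \<psi>]
  have coord: "((\<lambda>x :: real ^ 'd. x $ j) has_derivative (\<lambda>v. v $ j)) (at x)" for x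
    by (intro bounded_linear_imp_has_derivative bounded_linear_vec_nth)
  have pd: "partial_deriv i (\<lambda>x. x $ j * \<psi> x) = (\<lambda>x. x $ j * partial_deriv i \<psi> x + axis i 1 $ j * \<psi> x)" for i
  proof
    fix x
    show "partial_deriv i (\<lambda>x. x $ j * \<psi> x) x = x $ j * partial_deriv i \<psi> x + axis i 1 $ j * \<psi> x"
      using partial_deriv_mult[of "\<lambda>x. x $ j" x \<psi> i] coord[of x] D(1) partial_deriv_eq[OF coord]
      by (auto simp: differentiable_def)
  qed
  have coord_cont: "continuous_on UNIV (\<lambda>x :: real ^ 'd. x $ j)"
    by (intro continuous_intros)
  have coord_m: "(\<lambda>x. x $ j) \<in> borel_measurable (lebesgue_on \<Omega>)"
    by (intro borel_on borel_measurable_continuous_onI coord_cont)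
  have xb: "AE x in lebesgue_on \<Omega>. \<bar>x $ j\<bar> \<le> r"
    using r component_le_norm_cart[of _ j] by (intro AE_I2) (auto intro: order_trans)
  have xL: "(\<lambda>x. x $ j *\<^sub>R \<psi> x) \<in> L2 \<Omega>"
    by (rule L2_mult_bounded[OF D(6)]) (use xb coord_m in \<open>auto simp: ess_bounded_def\<close>)
  have "(LINT x|lebesgue_on \<Omega>. (x $ j * \<psi> x) * partial_deriv j \<psi> x + partial_deriv j (\<lambda>x. x $ j * \<psi> x) x * \<psi> x) = 0"
  proof (rule test_function_by_parts[OF _ _ \<psi>])
    show "(\<lambda>x. x $ j * \<psi> x) differentiable (at x)" for x
      using coord[of x] D(1) by (intro differentiable_mult) (auto simp: differentiable_def)
    show "continuous_on UNIV (partial_deriv i (\<lambda>x. x $ j * \<psi> x))" for i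
      unfolding pd by (intro continuous_intros D coord_cont)
  qed
  also have "(\<lambda>x. (x $ j * \<psi> x) * partial_deriv j \<psi> x + partial_deriv j (\<lambda>x. x $ j * \<psi> x) x * \<psi> x)
      = (\<lambda>x. 2 * ((x $ j *\<^sub>R \<psi> x) \<bullet> partial_deriv j \<psi> x) + \<psi> x \<bullet> \<psi> x)"
    unfolding pd by (simp add: algebra_simps)
  also have "(LINT x|lebesgue_on \<Omega>. 2 * ((x $ j *\<^sub>R \<psi> x) \<bullet> partial_deriv j \<psi> x) + \<psi> x \<bullet> \<psi> x)
      = 2 * l2_inner \<Omega> (\<lambda>x. x $ j *\<^sub>R \<psi> x) (partial_deriv j \<psi>) + l2_inner \<Omega> \<psi> \<psi>"
    unfolding l2_inner_def
    by (subst Bochner_Integration.integral_add)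
      (use L2_integrable_inner[OF xL D(7)] L2_integrable_inner[OF D(6) D(6)] in simp_all)
  finally have "(l2_norm \<Omega> \<psi>)\<^sup>2 = - 2 * l2_inner \<Omega> (\<lambda>x. x $ j *\<^sub>R \<psi> x) (partial_deriv j \<psi>)"
    by (simp add: l2_norm_sq)
  also have "\<dots> \<le> 2 * (l2_norm \<Omega> (\<lambda>x. x $ j *\<^sub>R \<psi> x) * l2_norm \<Omega> (partial_deriv j \<psi>))"
    using Cauchy_Schwarz_l2[OF xL D(7), of j] by linarith
  also have "\<dots> \<le> 2 * ((r * l2_norm \<Omega> \<psi>) * l2_norm \<Omega> (partial_deriv j \<psi>))"
    using l2_norm_mult_le[OF D(6) coord_m xb] r(2)
    by (intro mult_left_mono mult_right_mono) (auto simp: l2_norm_nonneg)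
  finally have "l2_norm \<Omega> \<psi> * l2_norm \<Omega> \<psi> \<le> (2 * r * l2_norm \<Omega> (partial_deriv j \<psi>)) * l2_norm \<Omega> \<psi>"
    by (simp add: power2_eq_square algebra_simps)
  then show ?thesis
    using l2_norm_nonneg[of \<Omega> \<psi>] r(2) l2_norm_nonneg[of \<Omega> "partial_deriv j \<psi>"]
    by (cases "l2_norm \<Omega> \<psi> = 0") (simp_all add: mult_le_cancel_right)
qed

lemma test_function_H1: "\<psi> \<in> test_functions \<Omega> \<Longrightarrow> \<psi> \<in> H1 \<Omega>"
  using weak_grad_H1 test_function_weak_grad test_function_D(6) by blast

lemma H10_poincare:
  assumes f: "f \<in> H10 \<Omega>" and r: "\<And>x. x \<in> \<Omega> \<Longrightarrow> norm x \<le> r" "0 \<le> r"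
  shows "l2_norm \<Omega> f \<le> 2 * r * l2_norm \<Omega> (\<lambda>x. wgrad \<Omega> f x $ j)"
proof -
  obtain \<psi> :: "nat \<Rightarrow> real ^ 'd \<Rightarrow> real" where \<psi>: "\<And>k. \<psi> k \<in> test_functions \<Omega>"
    and lim: "(\<lambda>k. h1_norm \<Omega> (\<lambda>x. f x - \<psi> k x)) \<longlonglongrightarrow> 0" and fH: "f \<in> H1 \<Omega>"
    using f by (auto simp: H10_def)
  let ?h = "\<lambda>k. h1_norm \<Omega> (\<lambda>x. f x - \<psi> k x)"
  have bound: "l2_norm \<Omega> f \<le> (1 + 2 * r) * ?h k + 2 * r * l2_norm \<Omega> (\<lambda>x. wgrad \<Omega> f x $ j)" for k
  proof -
    define g where "g x = f x - \<psi> k x" for x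
    have g_eq: "g = (\<lambda>x. f x - \<psi> k x)" by (simp add: g_def fun_eq_iff)
    note \<psi>H = test_function_H1[OF \<psi>[of k]]
    have gH: "g \<in> H1 \<Omega>" unfolding g_eq by (rule dir.diff_mem[OF fH \<psi>H])
    have h1: "l2_norm \<Omega> g \<le> ?h k" "l2_norm \<Omega> (wgrad \<Omega> g) \<le> ?h k"
      unfolding h1_norm_def g_eq[symmetric] by (auto intro!: real_le_rsqrt)
    have "l2_norm \<Omega> f \<le> l2_norm \<Omega> g + l2_norm \<Omega> (\<psi> k)"
      using l2_norm_triangle[OF H1_L2[OF gH] H1_L2[OF \<psi>H]] by (simp add: g_def)
    moreover have "l2_norm \<Omega> (\<psi> k) \<le> 2 * r * l2_norm \<Omega> (partial_deriv j (\<psi> k))"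
      by (rule test_function_poincare[OF \<psi> r])
    moreover have "l2_norm \<Omega> (partial_deriv j (\<psi> k)) \<le> l2_norm \<Omega> (\<lambda>x. wgrad \<Omega> f x $ j) + ?h k"
    proof -
      have "AE x in lebesgue_on \<Omega>. wgrad \<Omega> f x = wgrad \<Omega> g x + wgrad \<Omega> (\<psi> k) x"
        using wgrad_add[OF gH \<psi>H] by (simp add: g_def)
      moreover have "AE x in lebesgue_on \<Omega>. wgrad \<Omega> (\<psi> k) x = (\<chi> i. partial_deriv i (\<psi> k) x)"
        by (rule wgrad_AE[OF H1_L2[OF \<psi>H] test_function_weak_grad[OF \<psi>]])
      ultimately have "AE x in lebesgue_on \<Omega>. partial_deriv j (\<psi> k) x = wgrad \<Omega> f x $ j + (-1) *\<^sub>R (wgrad \<Omega> g x $ j)"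
        by eventually_elim simp
      then have "l2_norm \<Omega> (partial_deriv j (\<psi> k)) = l2_norm \<Omega> (\<lambda>x. wgrad \<Omega> f x $ j + (-1) *\<^sub>R (wgrad \<Omega> g x $ j))"
        by (intro l2_norm_cong_AE L2_add L2_scaleR L2_vec_nth wgrad_L2 fH gH test_function_D(7)[OF \<psi>])
      also have "\<dots> \<le> l2_norm \<Omega> (\<lambda>x. wgrad \<Omega> f x $ j) + l2_norm \<Omega> (\<lambda>x. (-1) *\<^sub>R (wgrad \<Omega> g x $ j))"
        by (intro l2_norm_triangle L2_scaleR L2_vec_nth wgrad_L2 fH gH)
      also have "l2_norm \<Omega> (\<lambda>x. (-1) *\<^sub>R (wgrad \<Omega> g x $ j)) = l2_norm \<Omega> (\<lambda>x. wgrad \<Omega> g x $ j)"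
        by (subst l2_norm_scale) (auto intro: L2_vec_nth wgrad_L2 gH)
      also have "\<dots> \<le> ?h k" using l2_norm_vec_nth_le[OF wgrad_L2[OF gH], of j] h1(2) by linarith
      finally show ?thesis by simp
    qed
    then have "2 * r * l2_norm \<Omega> (partial_deriv j (\<psi> k)) \<le> 2 * r * (l2_norm \<Omega> (\<lambda>x. wgrad \<Omega> f x $ j) + ?h k)"
      using r(2) by (intro mult_left_mono) auto
    ultimately show ?thesis using h1(1) by (simp add: algebra_simps)
  qed
  have "(\<lambda>k. (1 + 2 * r) * ?h k + 2 * r * l2_norm \<Omega> (\<lambda>x. wgrad \<Omega> f x $ j))
      \<longlonglongrightarrow> (1 + 2 * r) * 0 + 2 * r * l2_norm \<Omega> (\<lambda>x. wgrad \<Omega> f x $ j)"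
    by (intro tendsto_intros lim)
  then show ?thesis
    using bound by (intro LIMSEQ_le_const[where X = "\<lambda>k. (1 + 2 * r) * ?h k + 2 * r * l2_norm \<Omega> (\<lambda>x. wgrad \<Omega> f x $ j)"]) auto
qed

end

section \<open>Strains\<close>

definition vH1 :: "(real ^ 'd) set \<Rightarrow> (real ^ 'd \<Rightarrow> real ^ 'd) set" where
  "vH1 \<Omega> = {u. \<forall>i. (\<lambda>x. u x $ i) \<in> H1 \<Omega>}"

lemma strain_symmetric: "transpose (strain \<Omega> u x) = strain \<Omega> u x"
  by (simp add: strain_def transpose_def vec_eq_iff add.commute)

context bounded_open
begin

lemma vH1_D: "u \<in> vH1 \<Omega> \<Longrightarrow> (\<lambda>x. u x $ i) \<in> H1 \<Omega>"
  by (simp add: vH1_def)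

lemma vH1_L2: "u \<in> vH1 \<Omega> \<Longrightarrow> u \<in> L2 \<Omega>"
  by (rule L2_vec) (simp add: vH1_D H1_L2)

lemma vgrad_L2: "u \<in> vH1 \<Omega> \<Longrightarrow> vgrad \<Omega> u \<in> L2 \<Omega>"
  by (rule L2_vec) (simp add: vgrad_def vH1_D wgrad_L2)

lemma vH1_add: "u \<in> vH1 \<Omega> \<Longrightarrow> v \<in> vH1 \<Omega> \<Longrightarrow> (\<lambda>x. u x + v x) \<in> vH1 \<Omega>"
  by (simp add: vH1_def H1_add)

lemma vH1_scale: "u \<in> vH1 \<Omega> \<Longrightarrow> (\<lambda>x. c *\<^sub>R u x) \<in> vH1 \<Omega>"
  by (simp add: vH1_def H1_scale)

sublocale vl2: semi_inner "vH1 \<Omega>" "l2_inner \<Omega>"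
  by unfold_locales
    (auto simp: vH1_L2 vH1_add vH1_scale l2.add_left l2.scale_left l2.nonneg l2.sym, simp add: vH1_def H1_zero)

lemma vgrad_add:
  assumes "u \<in> vH1 \<Omega>" "v \<in> vH1 \<Omega>"
  shows "AE x in lebesgue_on \<Omega>. vgrad \<Omega> (\<lambda>x. u x + v x) x = vgrad \<Omega> u x + vgrad \<Omega> v x"
proof -
  have "AE x in lebesgue_on \<Omega>. \<forall>i\<in>UNIV. wgrad \<Omega> (\<lambda>x. u x $ i + v x $ i) x = wgrad \<Omega> (\<lambda>x. u x $ i) x + wgrad \<Omega> (\<lambda>x. v x $ i) x"
    by (intro AE_finite_allI wgrad_add vH1_D assms) auto
  then show ?thesis by eventually_elim (simp add: vgrad_def vec_eq_iff)
qed

lemma vgrad_scale: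
  assumes "u \<in> vH1 \<Omega>"
  shows "AE x in lebesgue_on \<Omega>. vgrad \<Omega> (\<lambda>x. c *\<^sub>R u x) x = c *\<^sub>R vgrad \<Omega> u x"
proof -
  have "AE x in lebesgue_on \<Omega>. \<forall>i\<in>UNIV. wgrad \<Omega> (\<lambda>x. c * u x $ i) x = c *\<^sub>R wgrad \<Omega> (\<lambda>x. u x $ i) x"
    by (intro AE_finite_allI wgrad_scale vH1_D assms) auto
  then show ?thesis by eventually_elim (simp add: vgrad_def vec_eq_iff)
qed

lemma vgrad_null:
  assumes "u \<in> vH1 \<Omega>" "l2_inner \<Omega> u u = 0"
  shows "l2_norm \<Omega> (vgrad \<Omega> u) = 0"
proof -
  have u0: "AE x in lebesgue_on \<Omega>. u x = 0"
    using l2_inner_self_eq_0_iff[OF vH1_L2[OF assms(1)]] assms(2) by simp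
  have "AE x in lebesgue_on \<Omega>. \<forall>i\<in>UNIV. wgrad \<Omega> (\<lambda>x. u x $ i) x = 0"
  proof (intro AE_finite_allI wgrad_AE weak_grad_const[where c = 0])
    show "AE x in lebesgue_on \<Omega>. u x $ i = 0" for i using u0 by eventually_elim simp
  qed (auto intro: H1_L2 vH1_D assms)
  then have "AE x in lebesgue_on \<Omega>. vgrad \<Omega> u x = 0"
    by eventually_elim (simp add: vgrad_def vec_eq_iff)
  then show ?thesis
    using l2_inner_self_eq_0_iff[OF vgrad_L2[OF assms(1)]] by (simp add: l2_norm_def)
qed

definition symm :: "real ^ 'd ^ 'd \<Rightarrow> real ^ 'd ^ 'd" where
  "symm E = (1 / 2) *\<^sub>R (E + transpose E)"

lemma symm_bounded_linear: "bounded_linear symm"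
  unfolding linear_conv_bounded_linear[symmetric]
  by (rule linearI) (simp_all add: symm_def transpose_def vec_eq_iff algebra_simps)

lemma strain_eq_symm: "strain \<Omega> u x = symm (vgrad \<Omega> u x)"
  by (simp add: strain_def symm_def)

lemma strain_L2: "u \<in> vH1 \<Omega> \<Longrightarrow> strain \<Omega> u \<in> L2 \<Omega>"
  using L2_linear_image[OF vgrad_L2 symm_bounded_linear] unfolding strain_eq_symm[abs_def] .

lemma strain_add:
  assumes "u \<in> vH1 \<Omega>" "v \<in> vH1 \<Omega>"
  shows "AE x in lebesgue_on \<Omega>. strain \<Omega> (\<lambda>x. u x + v x) x = strain \<Omega> u x + strain \<Omega> v x"
  using vgrad_add[OF assms] unfolding strain_eq_symm
  by eventually_elim (simp add: bounded_linear.linear[OF symm_bounded_linear] linear_add)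

lemma strain_scale:
  assumes "u \<in> vH1 \<Omega>"
  shows "AE x in lebesgue_on \<Omega>. strain \<Omega> (\<lambda>x. c *\<^sub>R u x) x = c *\<^sub>R strain \<Omega> u x"
  using vgrad_scale[OF assms, of c] unfolding strain_eq_symm
  by eventually_elim (simp add: bounded_linear.linear[OF symm_bounded_linear] linear_cmul)

text \<open>The diagonal entries of the strain are the derivatives \<open>\<partial>\<^sub>j u\<^sub>j\<close>, and each of them controls its
  component \<open>u\<^sub>j\<close> by the Poincare inequality in direction \<open>j\<close>. This gives definiteness of the strain
  on functions with zero boundary values without Korn's inequality.\<close>

lemma l2_norm_le_strain:
  assumes u: "u \<in> vH1 \<Omega>" "\<And>i. (\<lambda>x. u x $ i) \<in> H10 \<Omega>"
    and r: "\<And>x. x \<in> \<Omega> \<Longrightarrow> norm x \<le> r" "0 \<le> r"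
  shows "l2_norm \<Omega> u \<le> real CARD('d) * (2 * r * l2_norm \<Omega> (strain \<Omega> u))"
proof -
  have comp: "l2_norm \<Omega> (\<lambda>x. u x $ j) \<le> 2 * r * l2_norm \<Omega> (strain \<Omega> u)" for j
  proof -
    have "l2_norm \<Omega> (\<lambda>x. wgrad \<Omega> (\<lambda>x. u x $ j) x $ j) = l2_norm \<Omega> (\<lambda>x. strain \<Omega> u x $ j $ j)"
      by (simp add: strain_def vgrad_def transpose_def)
    also have "\<dots> \<le> l2_norm \<Omega> (\<lambda>x. strain \<Omega> u x $ j)"
      by (intro l2_norm_vec_nth_le L2_vec_nth strain_L2 u(1))
    also have "\<dots> \<le> l2_norm \<Omega> (strain \<Omega> u)"
      by (intro l2_norm_vec_nth_le strain_L2 u(1))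
    finally have "2 * r * l2_norm \<Omega> (\<lambda>x. wgrad \<Omega> (\<lambda>x. u x $ j) x $ j) \<le> 2 * r * l2_norm \<Omega> (strain \<Omega> u)"
      using r(2) by (intro mult_left_mono) auto
    then show ?thesis using H10_poincare[OF u(2) r, of j j] by linarith
  qed
  have uj: "(\<lambda>x. u x $ j) \<in> L2 \<Omega>" for j using u(1) by (intro H1_L2 vH1_D)
  have "l2_inner \<Omega> u u = (\<Sum>j\<in>UNIV. l2_inner \<Omega> (\<lambda>x. u x $ j) (\<lambda>x. u x $ j))"
    unfolding l2_inner_def inner_vec_def
    using L2_integrable_inner[OF uj uj] by (intro Bochner_Integration.integral_sum) auto
  then have "l2_norm \<Omega> u = L2_set (\<lambda>j. l2_norm \<Omega> (\<lambda>x. u x $ j)) UNIV"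
    by (simp add: L2_set_def l2_norm_sq) (simp add: l2_norm_def)
  also have "\<dots> \<le> (\<Sum>j\<in>UNIV. l2_norm \<Omega> (\<lambda>x. u x $ j))"
    by (rule L2_set_le_sum) (rule l2_norm_nonneg)
  also have "\<dots> \<le> (\<Sum>j\<in>(UNIV :: 'd set). 2 * r * l2_norm \<Omega> (strain \<Omega> u))"
    by (intro sum_mono comp)
  finally show ?thesis by simp
qed

text \<open>The strain controls the \<open>L\<^sup>2\<close> norm, and on a finite-dimensional space the \<open>L\<^sup>2\<close> norm controls the
  gradient. The constant depends on the space, which is harmless for convergence on a fixed mesh.\<close>

lemma vh1_norm_le_strain:
  assumes V: "fin_dim_space V" "\<And>v i. v \<in> V \<Longrightarrow> (\<lambda>x. v x $ i) \<in> H10 \<Omega>"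
  shows "\<exists>K. \<forall>v \<in> V. vh1_norm \<Omega> v \<le> K * l2_norm \<Omega> (strain \<Omega> v)"
proof -
  have VH: "V \<subseteq> vH1 \<Omega>" using V(2) by (auto simp: vH1_def H10_def)
  obtain B where B: "finite B" "V = {\<lambda>x. \<Sum>b\<in>B. c b *\<^sub>R b x | c. True}"
    using V(1) by (auto simp: fin_dim_space_def)
  have BV: "b \<in> V" if "b \<in> B" for b
    unfolding B(2) by (rule mem_span_family[OF B(1) that])
  have "\<exists>C. \<forall>f \<in> {\<lambda>x. \<Sum>b\<in>B. c b *\<^sub>R b x | c. True}. l2_norm \<Omega> (vgrad \<Omega> f) \<le> C * sqrt (l2_inner \<Omega> f f)"
  proof (rule vl2.finite_dim_seminorm_bound[where v = "\<lambda>b. b"])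
    fix f g assume fg: "f \<in> vH1 \<Omega>" "g \<in> vH1 \<Omega>"
    have "l2_norm \<Omega> (vgrad \<Omega> (\<lambda>x. f x + g x)) = l2_norm \<Omega> (\<lambda>x. vgrad \<Omega> f x + vgrad \<Omega> g x)"
      by (intro l2_norm_cong_AE vgrad_add vgrad_L2 L2_add vH1_add fg)
    also have "\<dots> \<le> l2_norm \<Omega> (vgrad \<Omega> f) + l2_norm \<Omega> (vgrad \<Omega> g)"
      by (intro l2_norm_triangle vgrad_L2 fg)
    finally show "l2_norm \<Omega> (vgrad \<Omega> (\<lambda>x. f x + g x)) \<le> l2_norm \<Omega> (vgrad \<Omega> f) + l2_norm \<Omega> (vgrad \<Omega> g)" .
  next
    fix f c assume f: "f \<in> vH1 \<Omega>"
    have "l2_norm \<Omega> (vgrad \<Omega> (\<lambda>x. c *\<^sub>R f x)) = l2_norm \<Omega> (\<lambda>x. c *\<^sub>R vgrad \<Omega> f x)"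
      by (intro l2_norm_cong_AE vgrad_scale vgrad_L2 L2_scaleR vH1_scale f)
    then show "l2_norm \<Omega> (vgrad \<Omega> (\<lambda>x. c *\<^sub>R f x)) = \<bar>c\<bar> * l2_norm \<Omega> (vgrad \<Omega> f)"
      by (simp add: l2_norm_scale vgrad_L2 f)
  qed (use B(1) BV VH vgrad_null in auto)
  then obtain C where C: "\<And>f. f \<in> V \<Longrightarrow> l2_norm \<Omega> (vgrad \<Omega> f) \<le> C * l2_norm \<Omega> f"
    unfolding B(2) l2_norm_def by blast
  obtain r where r: "\<And>x. x \<in> \<Omega> \<Longrightarrow> norm x \<le> r" "0 \<le> r"
    using bounded_dom unfolding bounded_pos by (meson less_imp_le)
  define c where "c = real CARD('d) * (2 * r)"
  have "vh1_norm \<Omega> v \<le> (1 + \<bar>C\<bar>) * c * l2_norm \<Omega> (strain \<Omega> v)" if v: "v \<in> V" for v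
  proof -
    have "vh1_norm \<Omega> v \<le> l2_norm \<Omega> v + l2_norm \<Omega> (vgrad \<Omega> v)"
      unfolding vh1_norm_def by (rule sqrt_sum_squares_le_sum) (rule l2_norm_nonneg)+
    also have "\<dots> \<le> l2_norm \<Omega> v + \<bar>C\<bar> * l2_norm \<Omega> v"
      using C[OF v] mult_right_mono[OF abs_ge_self[of C] l2_norm_nonneg[of \<Omega> v]] by linarith
    also have "\<dots> = (1 + \<bar>C\<bar>) * l2_norm \<Omega> v" by (simp add: algebra_simps)
    also have "\<dots> \<le> (1 + \<bar>C\<bar>) * (c * l2_norm \<Omega> (strain \<Omega> v))"
      using l2_norm_le_strain[OF _ _ r, of v] v VH V(2) by (intro mult_left_mono) (auto simp: c_def mult.assoc)
    finally show ?thesis by (simp add: mult.assoc)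
  qed
  then show ?thesis by blast
qed

end

section \<open>The discrete dual norm\<close>

text \<open>The Poincare inequality makes the Dirichlet form definite on the mean-free functions of \<open>Q\<close>, so
  this space is a Euclidean space up to null sets.\<close>

locale mean_free_poincare = bounded_open \<Omega> for \<Omega> :: "(real ^ 'd::finite) set" +
  fixes Q :: "(real ^ 'd \<Rightarrow> real) set" and m C :: real
  assumes nonempty: "\<Omega> \<noteq> {}"
    and Q_fin: "fin_dim_space Q" and Q_H1: "Q \<subseteq> H1 \<Omega>"
    and Q_one: "\<exists>q \<in> Q. AE x in lebesgue_on \<Omega>. q x = 1"
    and m_pos: "m > 0"
    and poincare: "s \<in> mean_free \<Omega> Q \<Longrightarrow> l2_norm \<Omega> s \<le> C * l2_norm \<Omega> (wgrad \<Omega> s)"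
begin

abbreviation mean :: "(real ^ 'd \<Rightarrow> real) \<Rightarrow> real" where
  "mean s \<equiv> LINT x|lebesgue_on \<Omega>. s x"

lemma Q_D: "q \<in> Q \<Longrightarrow> q \<in> H1 \<Omega>" "q \<in> Q \<Longrightarrow> q \<in> L2 \<Omega>"
  using Q_H1 H1_L2 by auto

lemma Q_add: "f \<in> Q \<Longrightarrow> g \<in> Q \<Longrightarrow> (\<lambda>x. f x + g x) \<in> Q"
  by (rule fin_dim_space_add[OF Q_fin])

lemma Q_scale: "f \<in> Q \<Longrightarrow> (\<lambda>x. c * f x) \<in> Q"
  using fin_dim_space_scale[OF Q_fin, of f c] by simp

lemma mean_free_Q: "q \<in> mean_free \<Omega> Q \<Longrightarrow> q \<in> Q"
  by (simp add: mean_free_def)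

lemma mean_add: "f \<in> Q \<Longrightarrow> g \<in> Q \<Longrightarrow> mean (\<lambda>x. f x + g x) = mean f + mean g"
  using L2_integrable Q_D by simp

lemma mean_free_add: "f \<in> mean_free \<Omega> Q \<Longrightarrow> g \<in> mean_free \<Omega> Q \<Longrightarrow> (\<lambda>x. f x + g x) \<in> mean_free \<Omega> Q"
  using Q_add mean_add by (simp add: mean_free_def)

lemma mean_free_scale: "f \<in> mean_free \<Omega> Q \<Longrightarrow> (\<lambda>x. c * f x) \<in> mean_free \<Omega> Q"
  using Q_scale by (simp add: mean_free_def)

text \<open>The constants belong to \<open>Q\<close> only up to null sets; this is a representative of the constant one.\<close>

definition one :: "real ^ 'd \<Rightarrow> real" where
  "one = (SOME q. q \<in> Q \<and> (AE x in lebesgue_on \<Omega>. q x = 1))"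

lemma one: "one \<in> Q" "AE x in lebesgue_on \<Omega>. one x = 1"
proof -
  have "one \<in> Q \<and> (AE x in lebesgue_on \<Omega>. one x = 1)"
    unfolding one_def by (rule someI_ex[OF Q_one[unfolded Bex_def]])
  then show "one \<in> Q" "AE x in lebesgue_on \<Omega>. one x = 1" by auto
qed

lemma one_inner: "s \<in> L2 \<Omega> \<Longrightarrow> l2_inner \<Omega> s one = mean s"
proof -
  assume "s \<in> L2 \<Omega>"
  then have "l2_inner \<Omega> s one = l2_inner \<Omega> s (\<lambda>x. 1)"
    using one by (intro l2_inner_cong_AE) (auto intro: Q_D const_L2)
  then show ?thesis by (simp add: l2_inner_def)
qed

lemma one_wgrad: "AE x in lebesgue_on \<Omega>. wgrad \<Omega> one x = 0"
  using one Q_D by (intro wgrad_AE weak_grad_const) auto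

lemma one_dir: "f \<in> H1 \<Omega> \<Longrightarrow> l2_inner \<Omega> (wgrad \<Omega> f) (wgrad \<Omega> one) = 0"
proof -
  assume f: "f \<in> H1 \<Omega>"
  have "l2_inner \<Omega> (wgrad \<Omega> f) (wgrad \<Omega> one) = l2_inner \<Omega> (wgrad \<Omega> f) (\<lambda>x. 0)"
    using one_wgrad one(1) by (intro l2_inner_cong_AE wgrad_L2 f l2.zero_mem Q_D) auto
  then show ?thesis by (simp add: l2_inner_def)
qed

lemma mean_one_pos: "mean one > 0"
proof -
  have "mean one = (LINT x|lebesgue_on \<Omega>. 1)"
    using one Q_D by (intro integral_cong_AE) (auto simp: L2_def)
  also have "\<dots> = measure (lebesgue_on \<Omega>) \<Omega>" by (simp add: space_restrict_space)
  also have "\<dots> = measure lebesgue \<Omega>"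
    using open_dom by (simp add: measure_restrict_space)
  finally have eq: "mean one = measure lebesgue \<Omega>" .
  have "\<not> negligible \<Omega>" using open_dom nonempty open_not_negligible by blast
  moreover have "\<Omega> \<in> lmeasurable" using open_dom bounded_dom by (simp add: lmeasurable_open)
  ultimately have "measure lebesgue \<Omega> \<noteq> 0" using negligible_iff_measure by blast
  then show ?thesis unfolding eq using measure_nonneg[of lebesgue \<Omega>] by linarith
qed

definition center :: "(real ^ 'd \<Rightarrow> real) \<Rightarrow> real ^ 'd \<Rightarrow> real" where
  "center q = (\<lambda>x. q x + (- (mean q / mean one)) * one x)"

lemma center_mean_free:
  assumes "q \<in> Q"
  shows "center q \<in> mean_free \<Omega> Q"
proof -
  define c where "c = - (mean q / mean one)"
  have "mean (center q) = mean q + c * mean one"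
    unfolding center_def c_def[symmetric] mean_add[OF assms Q_scale[OF one(1)]] by simp
  also have "\<dots> = 0" using mean_one_pos by (simp add: c_def)
  finally show ?thesis
    using Q_add[OF assms Q_scale[OF one(1), of c]] unfolding mean_free_def center_def c_def[symmetric] by blast
qed

lemma center_id: "q \<in> mean_free \<Omega> Q \<Longrightarrow> center q = q"
  by (simp add: center_def mean_free_def)

lemma center_dir:
  assumes "q \<in> Q" "f \<in> H1 \<Omega>"
  shows "l2_inner \<Omega> (wgrad \<Omega> (center q)) (wgrad \<Omega> f) = l2_inner \<Omega> (wgrad \<Omega> q) (wgrad \<Omega> f)"
proof -
  have oneH: "one \<in> H1 \<Omega>" using one Q_D by auto
  have "l2_inner \<Omega> (wgrad \<Omega> (\<lambda>x. q x + c *\<^sub>R one x)) (wgrad \<Omega> f) = l2_inner \<Omega> (wgrad \<Omega> q) (wgrad \<Omega> f)" for c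
    unfolding dir.add_left[OF Q_D(1)[OF assms(1)] dir.scale_mem[OF oneH] assms(2)]
      dir.scale_left[OF oneH assms(2)] dir.sym[OF oneH assms(2)] one_dir[OF assms(2)] by simp
  then show ?thesis unfolding center_def real_scaleR_def .
qed

lemma center_inner:
  assumes "q \<in> Q" "\<delta> \<in> mean_free \<Omega> Q"
  shows "l2_inner \<Omega> (center q) \<delta> = l2_inner \<Omega> q \<delta>"
proof -
  have \<delta>: "\<delta> \<in> L2 \<Omega>" using assms(2) mean_free_Q Q_D by blast
  have oneL: "one \<in> L2 \<Omega>" using one Q_D by auto
  have "l2_inner \<Omega> one \<delta> = 0"
    using one_inner[OF \<delta>] l2.sym[OF oneL \<delta>] assms(2) by (simp add: mean_free_def)
  then have "l2_inner \<Omega> (\<lambda>x. q x + c *\<^sub>R one x) \<delta> = l2_inner \<Omega> q \<delta>" for c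
    unfolding l2.add_left[OF Q_D(2)[OF assms(1)] l2.scale_mem[OF oneL] \<delta>] l2.scale_left[OF oneL \<delta>] by simp
  then show ?thesis unfolding center_def real_scaleR_def .
qed

lemma center_sum:
  assumes "\<And>b. b \<in> B \<Longrightarrow> b \<in> Q"
  shows "center (\<lambda>x. \<Sum>b\<in>B. c b * b x) = (\<lambda>x. \<Sum>b\<in>B. c b * center b x)"
proof -
  have "mean (\<lambda>x. \<Sum>b\<in>B. c b * b x) = (\<Sum>b\<in>B. c b * mean b)"
    using assms Q_D L2_integrable by (subst Bochner_Integration.integral_sum) auto
  then have "- (mean (\<lambda>x. \<Sum>b\<in>B. c b * b x) / mean one) * one x = (\<Sum>b\<in>B. c b * (- (mean b / mean one) * one x))" for x
    by (simp add: sum_divide_distrib sum_distrib_right sum_negf mult.assoc)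
  then show ?thesis unfolding center_def distrib_left sum.distrib by (simp only:)
qed

text \<open>Gram-Schmidt for the Dirichlet form on the centered generators of \<open>Q\<close>; the remainder of length zero
  is mean-free with vanishing gradient, hence null.\<close>

lemma mean_free_basis:
  obtains n :: nat and e where
    "\<And>k. k < n \<Longrightarrow> e k \<in> mean_free \<Omega> Q"
    "\<And>j k. j < n \<Longrightarrow> k < n \<Longrightarrow> l2_inner \<Omega> (wgrad \<Omega> (e j)) (wgrad \<Omega> (e k)) = (if j = k then 1 else 0)"
    "\<And>f. f \<in> mean_free \<Omega> Q \<Longrightarrow>
       AE x in lebesgue_on \<Omega>. f x = (\<Sum>k<n. l2_inner \<Omega> (wgrad \<Omega> f) (wgrad \<Omega> (e k)) * e k x)"
proof -
  obtain B where B: "finite B" "Q = {\<lambda>x. \<Sum>b\<in>B. c b *\<^sub>R b x | c. True}"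
    using Q_fin by (auto simp: fin_dim_space_def)
  have BQ: "b \<in> Q" if "b \<in> B" for b
    unfolding B(2) by (rule mem_span_family[OF B(1) that])
  let ?X = "{\<lambda>x. \<Sum>b\<in>B. c b *\<^sub>R center b x | c. True}"
  have cH: "b \<in> B \<Longrightarrow> center b \<in> H1 \<Omega>" for b
    using center_mean_free BQ mean_free_Q Q_D by blast
  have X_sub: "f \<in> ?X \<Longrightarrow> f \<in> mean_free \<Omega> Q" for f
  proof -
    assume "f \<in> ?X"
    then obtain c where "f = (\<lambda>x. \<Sum>b\<in>B. c b *\<^sub>R center b x)" by blast
    then have "f = center (\<lambda>x. \<Sum>b\<in>B. c b *\<^sub>R b x)" using center_sum[of B c] BQ by simp
    moreover have "(\<lambda>x. \<Sum>b\<in>B. c b *\<^sub>R b x) \<in> Q" unfolding B(2) by blast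
    ultimately show "f \<in> mean_free \<Omega> Q" using center_mean_free by simp
  qed
  have sub_X: "f \<in> ?X" if f: "f \<in> mean_free \<Omega> Q" for f
  proof -
    obtain c where c: "f = (\<lambda>x. \<Sum>b\<in>B. c b *\<^sub>R b x)" using mean_free_Q[OF f] unfolding B(2) by blast
    have "f = (\<lambda>x. \<Sum>b\<in>B. c b *\<^sub>R center b x)"
      using center_id[OF f] center_sum[of B c] BQ unfolding c by simp
    then show ?thesis by blast
  qed
  obtain n :: nat and e where e: "\<And>k. k < n \<Longrightarrow> e k \<in> ?X"
    "\<And>j k. j < n \<Longrightarrow> k < n \<Longrightarrow> l2_inner \<Omega> (wgrad \<Omega> (e j)) (wgrad \<Omega> (e k)) = (if j = k then 1 else 0)"
    "\<And>f. f \<in> ?X \<Longrightarrow> (\<lambda>r. l2_inner \<Omega> (wgrad \<Omega> r) (wgrad \<Omega> r)) (\<lambda>x. f x - (\<Sum>k<n. l2_inner \<Omega> (wgrad \<Omega> f) (wgrad \<Omega> (e k)) *\<^sub>R e k x)) = 0"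
    by (rule dir.gram_schmidt[of B center]) (use B(1) in simp, use cH in simp, rule that)
  show ?thesis
  proof (rule that)
    fix f assume f: "f \<in> mean_free \<Omega> Q"
    define r where "r x = f x - (\<Sum>k<n. l2_inner \<Omega> (wgrad \<Omega> f) (wgrad \<Omega> (e k)) * e k x)" for x
    have r_eq: "r = (\<lambda>x. f x - (\<Sum>k<n. l2_inner \<Omega> (wgrad \<Omega> f) (wgrad \<Omega> (e k)) *\<^sub>R e k x))"
      by (simp add: r_def fun_eq_iff)
    have "(\<lambda>x. \<Sum>k<l. c k * e k x) \<in> mean_free \<Omega> Q" if "l \<le> n" for l c
      using that
    proof (induction l)
      case 0
      then show ?case using mean_free_scale[OF f, of 0] by simp
    next
      case (Suc l)
      then show ?case using mean_free_add[OF _ mean_free_scale[OF X_sub[OF e(1)]]] by simp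
    qed
    from mean_free_add[OF f mean_free_scale[OF this, of n "-1"]]
    have rM: "r \<in> mean_free \<Omega> Q" by (simp add: r_def[abs_def])
    have "l2_norm \<Omega> (wgrad \<Omega> r) = 0" using e(3)[OF sub_X[OF f]] by (simp add: l2_norm_def r_eq)
    then have "l2_norm \<Omega> r = 0" using poincare[OF rM] l2_norm_nonneg[of \<Omega> r] by simp
    moreover have "r \<in> L2 \<Omega>" using rM mean_free_Q Q_D by blast
    ultimately have "AE x in lebesgue_on \<Omega>. r x = 0"
      using l2_inner_self_eq_0_iff by (metis l2_norm_sq zero_eq_power2)
    then show "AE x in lebesgue_on \<Omega>. f x = (\<Sum>k<n. l2_inner \<Omega> (wgrad \<Omega> f) (wgrad \<Omega> (e k)) * e k x)"
      by eventually_elim (simp add: r_def)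
  qed (use e X_sub in auto)
qed

end

context mean_free_poincare
begin

lemma hm_norm_eq: "q \<in> H1 \<Omega> \<Longrightarrow> hm_norm \<Omega> m q = sqrt m * l2_norm \<Omega> (wgrad \<Omega> q)"
  unfolding hm_norm_def using l2_norm_scale[OF wgrad_L2] m_pos by simp

text \<open>With respect to a Dirichlet-orthonormal basis \<open>e\<^sub>k\<close> of the mean-free functions, the supremum that
  defines the dual norm of \<open>s\<close> is the Euclidean norm of the coefficients \<open>(s, e\<^sub>k)\<close>, divided by the
  square root of \<open>m\<close>. Hence its square is the quadratic form of a bilinear form \<open>D\<close>. The last
  property is the Riesz representation: if \<open>\<mu>\<close> solves the discrete Neumann problem with right-hand
  side \<open>g\<close>, then pairing with \<open>g\<close> in the dual inner product is pairing with \<open>\<mu>\<close> in \<open>L\<^sup>2\<close>. This turns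
  the chemical potential of the scheme into a derivative of the dual norm.\<close>

lemma dual_form:
  obtains D where
    "semi_inner (L2 \<Omega>) D"
    "\<And>s. s \<in> L2 \<Omega> \<Longrightarrow> (dual_norm \<Omega> Q m s)\<^sup>2 = D s s"
    "\<And>g \<mu> \<delta>. g \<in> L2 \<Omega> \<Longrightarrow> \<mu> \<in> Q \<Longrightarrow> \<delta> \<in> mean_free \<Omega> Q \<Longrightarrow>
       (\<And>q. q \<in> mean_free \<Omega> Q \<Longrightarrow> m * l2_inner \<Omega> (wgrad \<Omega> \<mu>) (wgrad \<Omega> q) = l2_inner \<Omega> g q) \<Longrightarrow>
       D g \<delta> = l2_inner \<Omega> \<mu> \<delta>"
proof -
  obtain n :: nat and e where e: "\<And>k. k < n \<Longrightarrow> e k \<in> mean_free \<Omega> Q"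
    "\<And>j k. j < n \<Longrightarrow> k < n \<Longrightarrow> l2_inner \<Omega> (wgrad \<Omega> (e j)) (wgrad \<Omega> (e k)) = (if j = k then 1 else 0)"
    "\<And>f. f \<in> mean_free \<Omega> Q \<Longrightarrow>
       AE x in lebesgue_on \<Omega>. f x = (\<Sum>k<n. l2_inner \<Omega> (wgrad \<Omega> f) (wgrad \<Omega> (e k)) * e k x)"
    by (rule mean_free_basis) (rule that)
  define a where "a f k = l2_inner \<Omega> (wgrad \<Omega> f) (wgrad \<Omega> (e k))" for f k
  define D where "D s t = (1 / m) * (\<Sum>k<n. l2_inner \<Omega> s (e k) * l2_inner \<Omega> t (e k))" for s t :: "real ^ 'd \<Rightarrow> real"
  have MH: "f \<in> mean_free \<Omega> Q \<Longrightarrow> f \<in> H1 \<Omega>" "f \<in> mean_free \<Omega> Q \<Longrightarrow> f \<in> L2 \<Omega>" for f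
    using mean_free_Q Q_D by auto
  have eH: "k < n \<Longrightarrow> e k \<in> H1 \<Omega>" and eL: "k < n \<Longrightarrow> e k \<in> L2 \<Omega>" for k
    using MH e(1) by auto
  have semi: "semi_inner (L2 \<Omega>) D"
  proof
    show "0 \<le> D f f" for f unfolding D_def using m_pos by (simp add: sum_nonneg)
    show "D (\<lambda>x. f x + g x) h = D f h + D g h" if "f \<in> L2 \<Omega>" "g \<in> L2 \<Omega>" for f g h
      unfolding D_def using that eL
      by (simp add: l2.add_left distrib_left distrib_right sum.distrib)
    show "D (\<lambda>x. c *\<^sub>R f x) h = c * D f h" if "f \<in> L2 \<Omega>" for f h c
    proof -
      have "l2_inner \<Omega> (\<lambda>x. c *\<^sub>R f x) (e k) = c * l2_inner \<Omega> f (e k)" if "k < n" for k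
        using l2.scale_left[OF \<open>f \<in> L2 \<Omega>\<close> eL[OF that]] .
      then have "(\<Sum>k<n. l2_inner \<Omega> (\<lambda>x. c *\<^sub>R f x) (e k) * l2_inner \<Omega> h (e k)) = c * (\<Sum>k<n. l2_inner \<Omega> f (e k) * l2_inner \<Omega> h (e k))"
        by (simp add: sum_distrib_left mult.assoc)
      then show ?thesis unfolding D_def by simp
    qed
    show "(\<lambda>x. c *\<^sub>R f x) \<in> L2 \<Omega>" if "f \<in> L2 \<Omega>" for f c using that by (rule L2_scaleR)
  qed (auto simp: D_def mult.commute l2.zero_mem L2_add)
  have comb: "(\<lambda>x. \<Sum>k<n. c k * e k x) \<in> L2 \<Omega>" for c
    using l2.sum_mem[of "{..<n}" e c] eL by simp
  have combQ: "(\<lambda>x. \<Sum>k<l. c k * e k x) \<in> mean_free \<Omega> Q" if "l \<le> n" for c l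
    using that
  proof (induction l)
    case 0
    then show ?case using mean_free_scale[OF center_mean_free[OF one(1)], of 0] by simp
  next
    case (Suc l)
    then show ?case using mean_free_add[OF _ mean_free_scale[OF e(1)]] by simp
  qed
  have inner_expand: "l2_inner \<Omega> q s = (\<Sum>k<n. a q k * l2_inner \<Omega> (e k) s)" if "q \<in> mean_free \<Omega> Q" "s \<in> L2 \<Omega>" for q s
  proof -
    have "l2_inner \<Omega> q s = l2_inner \<Omega> (\<lambda>x. \<Sum>k<n. a q k * e k x) s"
      using that e(3)[OF that(1)] MH(2) comb by (intro l2_inner_cong_AE) (auto simp: a_def)
    also have "\<dots> = (\<Sum>k<n. a q k * l2_inner \<Omega> (e k) s)"
      using l2.sum_left[of "{..<n}" e s "a q"] eL that(2) by simp
    finally show ?thesis .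
  qed
  have dir_expand: "l2_inner \<Omega> (wgrad \<Omega> q) (wgrad \<Omega> q) = (\<Sum>k<n. (a q k)\<^sup>2)" if q: "q \<in> mean_free \<Omega> Q" for q
  proof -
    define P where "P x = (\<Sum>k<n. a q k *\<^sub>R e k x)" for x
    have PH: "P \<in> H1 \<Omega>" unfolding P_def using dir.sum_mem[of "{..<n}" e] eH by simp
    have "AE x in lebesgue_on \<Omega>. q x = P x" using e(3)[OF q] by (simp add: P_def a_def)
    then have "AE x in lebesgue_on \<Omega>. q x + (-1) * P x = 0" by eventually_elim simp
    moreover have dH: "(\<lambda>x. q x + (-1) * P x) \<in> H1 \<Omega>" by (intro H1_add H1_scale MH(1)[OF q] PH)
    ultimately have "AE x in lebesgue_on \<Omega>. wgrad \<Omega> (\<lambda>x. q x + (-1) * P x) x = 0"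
      by (intro wgrad_AE weak_grad_const H1_L2)
    then have "l2_inner \<Omega> (wgrad \<Omega> (\<lambda>x. q x + (-1) * P x)) (wgrad \<Omega> (\<lambda>x. q x + (-1) * P x)) = 0"
      using l2_inner_self_eq_0_iff wgrad_L2[OF dH] by blast
    from dir.null_left[OF dH _ this]
    have "l2_inner \<Omega> (wgrad \<Omega> (\<lambda>x. q x + (-1) *\<^sub>R P x)) (wgrad \<Omega> q) = 0" using MH(1)[OF q] by simp
    then have "l2_inner \<Omega> (wgrad \<Omega> q) (wgrad \<Omega> q) = l2_inner \<Omega> (wgrad \<Omega> P) (wgrad \<Omega> q)"
      unfolding dir.add_left[OF MH(1)[OF q] dir.scale_mem[OF PH] MH(1)[OF q]] dir.scale_left[OF PH MH(1)[OF q]] by simp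
    also have "\<dots> = (\<Sum>k<n. a q k * l2_inner \<Omega> (wgrad \<Omega> (e k)) (wgrad \<Omega> q))"
      unfolding P_def using dir.sum_left[of "{..<n}" e q "a q"] eH MH(1)[OF q] by simp
    also have "\<dots> = (\<Sum>k<n. (a q k)\<^sup>2)"
      by (intro sum.cong) (auto simp: a_def power2_eq_square dir.sym[OF eH MH(1)[OF q]])
    finally show ?thesis .
  qed
  have norm_eq: "(dual_norm \<Omega> Q m s)\<^sup>2 = D s s" if s: "s \<in> L2 \<Omega>" for s
  proof -
    define S where "S = (\<Sum>k<n. (l2_inner \<Omega> s (e k))\<^sup>2)"
    have S0: "S \<ge> 0" unfolding S_def by (rule sum_nonneg) simp
    define X where "X = insert 0 {l2_inner \<Omega> s q / hm_norm \<Omega> m q | q. q \<in> mean_free \<Omega> Q \<and> \<not> (AE x in lebesgue_on \<Omega>. q x = 0)}"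
    have upper: "y \<le> sqrt (S / m)" if y: "y \<in> X" for y
    proof (cases "y = 0")
      case True
      then show ?thesis using S0 m_pos by simp
    next
      case False
      then obtain q where q: "q \<in> mean_free \<Omega> Q" "y = l2_inner \<Omega> s q / hm_norm \<Omega> m q"
        using y unfolding X_def by blast
      have hm: "hm_norm \<Omega> m q = sqrt m * sqrt (\<Sum>k<n. (a q k)\<^sup>2)"
        using hm_norm_eq[OF MH(1)[OF q(1)]] dir_expand[OF q(1)] by (simp add: l2_norm_def)
      have "l2_inner \<Omega> s q = (\<Sum>k<n. a q k * l2_inner \<Omega> s (e k))"
        using inner_expand[OF q(1) s] l2.sym[OF s MH(2)[OF q(1)]] l2.sym[OF s eL] by simp
      moreover have "(\<Sum>k<n. a q k * l2_inner \<Omega> s (e k)) \<le> sqrt ((\<Sum>k<n. (a q k)\<^sup>2) * S)"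
        unfolding S_def by (rule real_le_rsqrt) (rule Cauchy_Schwarz_ineq_sum)
      ultimately have "l2_inner \<Omega> s q \<le> sqrt (S / m) * hm_norm \<Omega> m q"
        unfolding hm using m_pos by (simp add: real_sqrt_mult real_sqrt_divide field_simps)
      moreover have "hm_norm \<Omega> m q > 0"
      proof -
        have "hm_norm \<Omega> m q \<noteq> 0" using False q(2) by auto
        moreover have "hm_norm \<Omega> m q \<ge> 0" unfolding hm_norm_def by (rule l2_norm_nonneg)
        ultimately show ?thesis by simp
      qed
      ultimately show ?thesis unfolding q(2) by (simp add: pos_divide_le_eq)
    qed
    have attained: "sqrt (S / m) \<in> X"
    proof (cases "S = 0")
      case True
      then show ?thesis by (simp add: X_def)
    next
      case False
      define q where "q x = (\<Sum>k<n. l2_inner \<Omega> s (e k) * e k x)" for x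
      have q: "q \<in> mean_free \<Omega> Q" unfolding q_def by (rule combQ) simp
      have aq: "a q j = l2_inner \<Omega> s (e j)" if "j < n" for j
      proof -
        have "a q j = (\<Sum>k<n. l2_inner \<Omega> s (e k) * l2_inner \<Omega> (wgrad \<Omega> (e k)) (wgrad \<Omega> (e j)))"
          unfolding a_def q_def using dir.sum_left[of "{..<n}" e "e j"] eH that by simp
        also have "\<dots> = (\<Sum>k<n. if k = j then l2_inner \<Omega> s (e k) else 0)"
          by (rule sum.cong) (auto simp: e(2) that)
        finally show ?thesis using that by simp
      qed
      have sq: "l2_inner \<Omega> s q = S"
        using inner_expand[OF q s] l2.sym[OF s MH(2)[OF q]] l2.sym[OF s eL] aq
        by (simp add: S_def power2_eq_square)
      have "hm_norm \<Omega> m q = sqrt m * sqrt S"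
        using hm_norm_eq[OF MH(1)[OF q]] dir_expand[OF q] aq by (simp add: l2_norm_def S_def)
      then have "l2_inner \<Omega> s q / hm_norm \<Omega> m q = sqrt (S / m)"
        unfolding sq real_sqrt_divide
        using False S0 m_pos real_sqrt_mult_self[of S] by (simp add: field_simps)
      moreover have "\<not> (AE x in lebesgue_on \<Omega>. q x = 0)"
      proof
        assume "AE x in lebesgue_on \<Omega>. q x = 0"
        then have "l2_inner \<Omega> q q = 0" using l2_inner_self_eq_0_iff[OF MH(2)[OF q]] by simp
        from l2.null_left[OF MH(2)[OF q] s this] show False
          using sq False l2.sym[OF s MH(2)[OF q]] by simp
      qed
      ultimately show ?thesis unfolding X_def using q by force
    qed
    have "dual_norm \<Omega> Q m s = sqrt (S / m)"
      unfolding dual_norm_def X_def[symmetric] by (rule cSup_eq_maximum[OF attained upper])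
    then show ?thesis using S0 m_pos by (simp add: D_def S_def power2_eq_square)
  qed
  have rep: "D g \<delta> = l2_inner \<Omega> \<mu> \<delta>"
    if g: "g \<in> L2 \<Omega>" and \<mu>: "\<mu> \<in> Q" and \<delta>: "\<delta> \<in> mean_free \<Omega> Q"
      and eq: "\<And>q. q \<in> mean_free \<Omega> Q \<Longrightarrow> m * l2_inner \<Omega> (wgrad \<Omega> \<mu>) (wgrad \<Omega> q) = l2_inner \<Omega> g q" for g \<mu> \<delta>
  proof -
    have "l2_inner \<Omega> \<mu> \<delta> = l2_inner \<Omega> (center \<mu>) \<delta>" using center_inner[OF \<mu> \<delta>] by simp
    also have "\<dots> = (\<Sum>k<n. a (center \<mu>) k * l2_inner \<Omega> (e k) \<delta>)"
      by (rule inner_expand[OF center_mean_free[OF \<mu>] MH(2)[OF \<delta>]])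
    also have "\<dots> = (\<Sum>k<n. (1 / m) * (l2_inner \<Omega> g (e k) * l2_inner \<Omega> \<delta> (e k)))"
    proof (rule sum.cong)
      fix k assume "k \<in> {..<n}"
      then have k: "k < n" by simp
      have "m * a (center \<mu>) k = l2_inner \<Omega> g (e k)"
        using center_dir[OF \<mu> eH[OF k]] eq[OF e(1)[OF k]] by (simp add: a_def)
      then show "a (center \<mu>) k * l2_inner \<Omega> (e k) \<delta> = (1 / m) * (l2_inner \<Omega> g (e k) * l2_inner \<Omega> \<delta> (e k))"
        using l2.sym[OF eL[OF k] MH(2)[OF \<delta>]] m_pos by (simp add: field_simps)
    qed simp
    finally show ?thesis by (simp add: D_def sum_distrib_left)
  qed
  show ?thesis using that[OF semi norm_eq rep] .
qed

end

section \<open>Alternating minimization\<close>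

text \<open>A convex functional of two variables: an affine set \<open>S\<close> of phases with directions \<open>M\<close> and a linear
  space \<open>V\<close> of displacements. The functionals \<open>G\<close> and \<open>H\<close> are the partial derivatives of \<open>F\<close>, \<open>N\<close> is the
  quadratic part, and \<open>B\<close> is a convex remainder in the first variable, such as the Bregman distance of
  a convex function. The constant \<open>\<beta>\<close> compares the quadratic form with its restrictions to the two
  factors; it is smaller than one when the variables are coupled.\<close>

locale alternating_minimization =
  fixes S M :: "('a \<Rightarrow> real) set" and V :: "('a \<Rightarrow> 'b::real_vector) set"
    and F :: "('a \<Rightarrow> real) \<Rightarrow> ('a \<Rightarrow> 'b) \<Rightarrow> real"
    and G :: "('a \<Rightarrow> real) \<Rightarrow> ('a \<Rightarrow> 'b) \<Rightarrow> ('a \<Rightarrow> real) \<Rightarrow> real"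
    and H :: "('a \<Rightarrow> real) \<Rightarrow> ('a \<Rightarrow> 'b) \<Rightarrow> ('a \<Rightarrow> 'b) \<Rightarrow> real"
    and N :: "('a \<Rightarrow> real) \<Rightarrow> ('a \<Rightarrow> 'b) \<Rightarrow> real"
    and B :: "('a \<Rightarrow> real) \<Rightarrow> ('a \<Rightarrow> real) \<Rightarrow> real"
    and \<beta> :: real
  assumes S_add: "s \<in> S \<Longrightarrow> q \<in> M \<Longrightarrow> (\<lambda>x. s x + q x) \<in> S"
    and S_diff: "s \<in> S \<Longrightarrow> s' \<in> S \<Longrightarrow> (\<lambda>x. s' x - s x) \<in> M"
    and M_scale: "q \<in> M \<Longrightarrow> (\<lambda>x. c * q x) \<in> M"
    and V_add: "v \<in> V \<Longrightarrow> w \<in> V \<Longrightarrow> (\<lambda>x. v x + w x) \<in> V"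
    and V_scale: "v \<in> V \<Longrightarrow> (\<lambda>x. c *\<^sub>R v x) \<in> V"
    and expansion: "\<lbrakk>s \<in> S; w \<in> V; q \<in> M; v \<in> V\<rbrakk> \<Longrightarrow>
      F (\<lambda>x. s x + q x) (\<lambda>x. w x + v x) = F s w + G s w q + H s w v + N q v / 2 + B s q"
    and G_scale: "\<lbrakk>s \<in> S; w \<in> V; q \<in> M\<rbrakk> \<Longrightarrow> G s w (\<lambda>x. c * q x) = c * G s w q"
    and H_scale: "\<lbrakk>s \<in> S; w \<in> V; v \<in> V\<rbrakk> \<Longrightarrow> H s w (\<lambda>x. c *\<^sub>R v x) = c * H s w v"
    and N_scale: "\<lbrakk>q \<in> M; v \<in> V\<rbrakk> \<Longrightarrow> N (\<lambda>x. c * q x) (\<lambda>x. c *\<^sub>R v x) = c\<^sup>2 * N q v"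
    and N_nonneg: "\<lbrakk>q \<in> M; v \<in> V\<rbrakk> \<Longrightarrow> 0 \<le> N q v"
    and N_phase: "\<lbrakk>q \<in> M; v \<in> V\<rbrakk> \<Longrightarrow> \<beta> * N q (\<lambda>x. 0) \<le> N q v"
    and N_displacement: "\<lbrakk>q \<in> M; v \<in> V\<rbrakk> \<Longrightarrow> \<beta> * N (\<lambda>x. 0) v \<le> N q v"
    and B_nonneg: "\<lbrakk>s \<in> S; q \<in> M\<rbrakk> \<Longrightarrow> 0 \<le> B s q"
    and B_convex: "\<lbrakk>s \<in> S; q \<in> M; 0 \<le> t; t \<le> 1\<rbrakk> \<Longrightarrow> B s (\<lambda>x. t * q x) \<le> t * B s q"
    and \<beta>_bounds: "0 < \<beta>" "\<beta> < 1"
begin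

lemma V_diff: "v \<in> V \<Longrightarrow> w \<in> V \<Longrightarrow> (\<lambda>x. w x - v x) \<in> V"
  using V_add[of w "\<lambda>x. (-1) *\<^sub>R v x"] V_scale[of v "-1"] by simp

lemma V_zero: "v \<in> V \<Longrightarrow> (\<lambda>x. 0) \<in> V"
  using V_scale[of v 0] by simp

lemma M_zero: "s \<in> S \<Longrightarrow> (\<lambda>x. 0) \<in> M"
  using S_diff[of s s] by simp

lemma expansion_phase:
  assumes "s \<in> S" "w \<in> V" "q \<in> M"
  shows "F (\<lambda>x. s x + q x) w = F s w + G s w q + N q (\<lambda>x. 0) / 2 + B s q"
  using expansion[OF assms V_zero[OF assms(2)]] H_scale[OF assms(1,2,2), of 0] by simp

lemma expansion_displacement:
  assumes "s \<in> S" "w \<in> V" "v \<in> V"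
  shows "F s (\<lambda>x. w x + v x) = F s w + H s w v + N (\<lambda>x. 0) v / 2"
proof -
  have "B s (\<lambda>x. 0) = 0"
    using B_nonneg[OF assms(1) M_zero[OF assms(1)]] B_convex[OF assms(1) M_zero[OF assms(1)], of 0] by simp
  then show ?thesis
    using expansion[OF assms(1,2) M_zero[OF assms(1)] assms(3)]
      G_scale[OF assms(1,2) M_zero[OF assms(1)], of 0] by simp
qed

lemma stationary_displacement_minimal:
  assumes "s \<in> S" "w \<in> V" "w' \<in> V" "\<And>v. v \<in> V \<Longrightarrow> H s w v = 0"
  shows "F s w \<le> F s w'"
  using expansion_displacement[OF assms(1,2) V_diff[OF assms(2,3)]] assms(4)[OF V_diff[OF assms(2,3)]]
    N_nonneg[OF M_zero[OF assms(1)] V_diff[OF assms(2,3)]] by simp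

lemma stationary_phase_minimal:
  assumes "s \<in> S" "s' \<in> S" "w \<in> V" "\<And>q. q \<in> M \<Longrightarrow> G s w q = 0"
  shows "F s w \<le> F s' w"
  using expansion_phase[OF assms(1,3) S_diff[OF assms(1,2)]] assms(4)[OF S_diff[OF assms(1,2)]]
    N_nonneg[OF S_diff[OF assms(1,2)] V_zero[OF assms(3)]] B_nonneg[OF assms(1) S_diff[OF assms(1,2)]] by simp

text \<open>At a point where \<open>F\<close> is stationary in the first variable, the expansion of \<open>F\<close> towards the reference
  point bounds the derivative in the second variable by minus the energy gap, with a quadratic surplus
  of weight \<open>\<beta>\<close>. Moving the second variable by the fraction \<open>\<beta>\<close> of the way to the reference point
  uses this surplus up exactly and gains \<open>\<beta>\<close> times the gap; the minimizer in the second variable is at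
  least as good.\<close>

lemma displacement_half_step:
  assumes s: "s \<in> S" and w: "w \<in> V" "w' \<in> V" and opt: "s0 \<in> S" "w0 \<in> V"
    and G0: "\<And>q. q \<in> M \<Longrightarrow> G s w q = 0" and H0: "\<And>v. v \<in> V \<Longrightarrow> H s w' v = 0"
  shows "F s w' - F s0 w0 \<le> (1 - \<beta>) * (F s w - F s0 w0)"
proof -
  define q where "q x = s0 x - s x" for x
  define v where "v x = w0 x - w x" for x
  have q: "q \<in> M" unfolding q_def by (rule S_diff[OF s opt(1)])
  have v: "v \<in> V" unfolding v_def by (rule V_diff[OF w(1) opt(2)])
  have "F s0 w0 = F s w + H s w v + N q v / 2 + B s q"
    using expansion[OF s w(1) q v] G0[OF q] by (simp add: q_def v_def)
  moreover have "\<beta> * N (\<lambda>x. 0) v \<le> N q v" by (rule N_displacement[OF q v])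
  moreover have "0 \<le> B s q" by (rule B_nonneg[OF s q])
  ultimately have lower: "H s w v + \<beta> * N (\<lambda>x. 0) v / 2 \<le> F s0 w0 - F s w" by simp
  have "F s w' \<le> F s (\<lambda>x. w x + \<beta> *\<^sub>R v x)"
    by (rule stationary_displacement_minimal[OF s w(2) V_add[OF w(1) V_scale[OF v]] H0])
  also have "\<dots> = F s w + \<beta> * (H s w v + \<beta> * N (\<lambda>x. 0) v / 2)"
    using expansion_displacement[OF s w(1) V_scale[OF v], of \<beta>] H_scale[OF s w(1) v, of \<beta>]
      N_scale[OF M_zero[OF s] v, of \<beta>] by (simp add: power2_eq_square distrib_left)
  also have "\<dots> \<le> F s w + \<beta> * (F s0 w0 - F s w)"
    using lower \<beta>_bounds(1) by simp
  finally show ?thesis by (simp add: algebra_simps)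
qed

text \<open>The same argument with the roles exchanged. The remainder \<open>B\<close> is treated like the linear part: over
  the fraction \<open>\<beta>\<close> of the segment it grows by at most \<open>\<beta>\<close> times its value at the reference point, by
  convexity.\<close>

lemma phase_half_step:
  assumes s: "s \<in> S" "s' \<in> S" and w: "w \<in> V" and opt: "s0 \<in> S" "w0 \<in> V"
    and H0: "\<And>v. v \<in> V \<Longrightarrow> H s w v = 0" and G0: "\<And>q. q \<in> M \<Longrightarrow> G s' w q = 0"
  shows "F s' w - F s0 w0 \<le> (1 - \<beta>) * (F s w - F s0 w0)"
proof -
  define q where "q x = s0 x - s x" for x
  define v where "v x = w0 x - w x" for x
  have q: "q \<in> M" unfolding q_def by (rule S_diff[OF s(1) opt(1)])
  have v: "v \<in> V" unfolding v_def by (rule V_diff[OF w opt(2)])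
  have "F s0 w0 = F s w + G s w q + N q v / 2 + B s q"
    using expansion[OF s(1) w q v] H0[OF v] by (simp add: q_def v_def)
  moreover have "\<beta> * N q (\<lambda>x. 0) \<le> N q v" by (rule N_phase[OF q v])
  moreover have "0 \<le> B s q" by (rule B_nonneg[OF s(1) q])
  ultimately have lower: "G s w q + \<beta> * N q (\<lambda>x. 0) / 2 + B s q \<le> F s0 w0 - F s w" by simp
  have \<beta>q: "(\<lambda>x. \<beta> * q x) \<in> M" by (rule M_scale[OF q])
  have N\<beta>: "N (\<lambda>x. \<beta> * q x) (\<lambda>x. 0) = \<beta>\<^sup>2 * N q (\<lambda>x. 0)"
    using N_scale[OF q V_zero[OF w], of \<beta>] by simp
  have "F s' w \<le> F (\<lambda>x. s x + \<beta> * q x) w"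
    by (rule stationary_phase_minimal[OF s(2) S_add[OF s(1) \<beta>q] w G0])
  also have "\<dots> = F s w + \<beta> * G s w q + N (\<lambda>x. \<beta> * q x) (\<lambda>x. 0) / 2 + B s (\<lambda>x. \<beta> * q x)"
    using expansion_phase[OF s(1) w \<beta>q] G_scale[OF s(1) w q, of \<beta>] by simp
  also have "\<dots> \<le> F s w + \<beta> * (G s w q + \<beta> * N q (\<lambda>x. 0) / 2 + B s q)"
    using B_convex[OF s(1) q, of \<beta>] \<beta>_bounds unfolding N\<beta> by (simp add: power2_eq_square distrib_left)
  also have "\<dots> \<le> F s w + \<beta> * (F s0 w0 - F s w)"
    using lower \<beta>_bounds(1) by simp
  finally show ?thesis by (simp add: algebra_simps)
qed

text \<open>At a minimizer the linear part together with the remainder is nonnegative, as one sees by shrinking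
  the increment, so the gap is at least the quadratic part.\<close>

lemma minimizer_quadratic_growth:
  assumes min: "s0 \<in> S" "w0 \<in> V" "\<And>s w. s \<in> S \<Longrightarrow> w \<in> V \<Longrightarrow> F s0 w0 \<le> F s w"
    and sw: "s \<in> S" "w \<in> V"
  shows "N (\<lambda>x. s x - s0 x) (\<lambda>x. w x - w0 x) / 2 \<le> F s w - F s0 w0"
proof -
  define q where "q x = s x - s0 x" for x
  define v where "v x = w x - w0 x" for x
  have q: "q \<in> M" unfolding q_def by (rule S_diff[OF min(1) sw(1)])
  have v: "v \<in> V" unfolding v_def by (rule V_diff[OF min(2) sw(2)])
  define g where "g = G s0 w0 q + H s0 w0 v + B s0 q"
  have N0: "0 \<le> N q v" by (rule N_nonneg[OF q v])
  have quad: "0 \<le> g + t * (N q v / 2)" if t: "0 < t" "t \<le> 1" for t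
  proof -
    have tq: "(\<lambda>x. t * q x) \<in> M" and tv: "(\<lambda>x. t *\<^sub>R v x) \<in> V" by (rule M_scale[OF q], rule V_scale[OF v])
    have "0 \<le> F (\<lambda>x. s0 x + t * q x) (\<lambda>x. w0 x + t *\<^sub>R v x) - F s0 w0"
      using min(3)[OF S_add[OF min(1) tq] V_add[OF min(2) tv]] by simp
    also have "\<dots> = t * (G s0 w0 q + H s0 w0 v) + t\<^sup>2 * (N q v / 2) + B s0 (\<lambda>x. t * q x)"
      using expansion[OF min(1,2) tq tv] G_scale[OF min(1,2) q, of t] H_scale[OF min(1,2) v, of t]
        N_scale[OF q v, of t] by (simp add: distrib_left)
    also have "\<dots> \<le> t * (g + t * (N q v / 2))"
      using B_convex[OF min(1) q, of t] t by (simp add: g_def power2_eq_square algebra_simps)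
    finally show ?thesis using t by (simp add: zero_le_mult_iff)
  qed
  have "0 \<le> g"
  proof (rule ccontr)
    assume "\<not> 0 \<le> g"
    then have g: "g < 0" by simp
    \<comment> \<open>so small that the quadratic term makes up for at most half of the negative linear term\<close>
    define t where "t = min 1 (- g / (N q v + 1))"
    have "0 < - g / (N q v + 1)" using g N0 by (intro divide_pos_pos) auto
    then have t: "0 < t" "t \<le> 1" by (simp_all add: t_def)
    have "t * N q v \<le> - g / (N q v + 1) * N q v" using N0 by (intro mult_right_mono) (auto simp: t_def)
    also have "\<dots> \<le> - g" using g N0 by (simp add: field_simps)
    finally show False using quad[OF t] g by linarith
  qed
  moreover have "F s w = F s0 w0 + g + N q v / 2"
    using expansion[OF min(1,2) q v] by (simp add: g_def q_def v_def)
  moreover have "q = (\<lambda>x. s x - s0 x)" "v = (\<lambda>x. w x - w0 x)"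
    by (simp_all add: q_def v_def fun_eq_iff)
  ultimately show ?thesis by simp
qed

end

section \<open>Bounded coefficients\<close>

text \<open>The derivative of a convex function is monotone, so it is Borel measurable and locally bounded.\<close>

lemma convex_deriv:
  fixes g :: "real \<Rightarrow> real"
  assumes "convex_on UNIV g" "g differentiable_on UNIV"
  shows "(g has_real_derivative deriv g x) (at x)" "g x + deriv g x * (y - x) \<le> g y" "mono (deriv g)"
    "continuous_on UNIV g"
proof -
  show d: "(g has_real_derivative deriv g x) (at x)" for x
    using assms(2) by (simp add: DERIV_deriv_iff_real_differentiable differentiable_on_def)
  show t: "g x + deriv g x * (y - x) \<le> g y" for x y
    using convex_on_imp_above_tangent[OF assms(1), of x y "deriv g x"] d by simp
  show "mono (deriv g)"
  proof (rule monoI)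
    fix x y :: real assume "x \<le> y"
    have "(deriv g x - deriv g y) * (y - x) \<le> 0" using t[of x y] t[of y x] by (simp add: algebra_simps)
    then show "deriv g x \<le> deriv g y" using \<open>x \<le> y\<close> by (cases "x = y") (auto simp: mult_le_0_iff)
  qed
  show "continuous_on UNIV g" using assms(2) by (rule differentiable_imp_continuous_on)
qed

lemma ess_bounded_mono:
  fixes a :: "real ^ 'd::finite \<Rightarrow> real" and g :: "real \<Rightarrow> real"
  assumes "ess_bounded \<Omega> a" "mono g"
  shows "ess_bounded \<Omega> (\<lambda>x. g (a x))"
proof (rule ess_bounded_compose[OF assms(1)])
  show "g \<in> borel_measurable borel" by (rule borel_measurable_mono[OF assms(2)])
  show "\<exists>K. \<forall>x. \<bar>x\<bar> \<le> c \<longrightarrow> \<bar>g x\<bar> \<le> K" for c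
  proof (intro exI[of _ "\<bar>g c\<bar> + \<bar>g (- c)\<bar>"] allI impI)
    fix x assume "\<bar>x\<bar> \<le> c"
    then have "g (- c) \<le> g x" "g x \<le> g c" by (auto intro!: monoD[OF assms(2)])
    then show "\<bar>g x\<bar> \<le> \<bar>g c\<bar> + \<bar>g (- c)\<bar>" by linarith
  qed
qed

lemma C1_deriv_continuous:
  fixes p :: "real \<Rightarrow> real"
  assumes "p C1_differentiable_on UNIV"
  shows "continuous_on UNIV (deriv p)" "continuous_on UNIV p"
proof -
  obtain D where D: "\<And>x. (p has_vector_derivative D x) (at x)" "continuous_on UNIV D"
    using assms by (auto simp: C1_differentiable_on_def)
  then have "deriv p = D"
    by (intro ext DERIV_imp_deriv) (simp add: has_real_derivative_iff_has_vector_derivative)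
  then show "continuous_on UNIV (deriv p)" using D(2) by simp
  show "continuous_on UNIV p"
    using assms by (simp add: C1_differentiable_on_eq differentiable_imp_continuous_within continuous_at_imp_continuous_on)
qed

lemma (in bounded_open) piecewise_polynomial_ess_bounded:
  assumes T: "is_mesh \<Omega> T" and f: "piecewise_polynomial \<Omega> T f" and L: "f \<in> L2 \<Omega>"
  shows "ess_bounded \<Omega> f"
proof -
  have sets: "K \<inter> \<Omega> \<in> sets lebesgue" "\<Omega> \<in> sets lebesgue" if "K \<in> T" for K
  proof -
    have "closed K" using T that unfolding is_mesh_def by (metis closed_closure)
    then show "K \<inter> \<Omega> \<in> sets lebesgue" "\<Omega> \<in> sets lebesgue" using open_dom by auto
  qed
  have "\<exists>c. AE x in lebesgue. x \<in> K \<inter> \<Omega> \<longrightarrow> \<bar>f x\<bar> \<le> c" if K: "K \<in> T" for K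
  proof -
    obtain p where p: "real_polynomial_function p" "AE x in lebesgue_on (K \<inter> \<Omega>). f x = p x"
      using f K by (auto simp: piecewise_polynomial_def)
    have "continuous_on (closure \<Omega>) p"
      using continuous_on_polymonial_function[of p] p(1) by (simp add: real_polynomial_function_eq)
    then have "bounded (p ` closure \<Omega>)"
      using bounded_dom by (intro compact_imp_bounded compact_continuous_image) auto
    then obtain c where c: "\<And>x. x \<in> closure \<Omega> \<Longrightarrow> \<bar>p x\<bar> \<le> c"
      unfolding bounded_iff by auto
    have "AE x in lebesgue. x \<in> K \<inter> \<Omega> \<longrightarrow> f x = p x"
      using p(2) sets(1)[OF K] by (simp add: AE_restrict_space_iff)
    then have "AE x in lebesgue. x \<in> K \<inter> \<Omega> \<longrightarrow> \<bar>f x\<bar> \<le> c"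
      by eventually_elim (use c closure_subset[of \<Omega>] in auto)
    then show ?thesis ..
  qed
  then obtain c where c: "\<And>K. K \<in> T \<Longrightarrow> AE x in lebesgue. x \<in> K \<inter> \<Omega> \<longrightarrow> \<bar>f x\<bar> \<le> c K" by metis
  have fin: "finite T" and cover: "\<Omega> \<subseteq> \<Union>T" using T closure_subset[of \<Omega>] by (auto simp: is_mesh_def)
  have "AE x in lebesgue. \<forall>K\<in>T. x \<in> K \<inter> \<Omega> \<longrightarrow> \<bar>f x\<bar> \<le> c K"
    using c fin by (intro AE_finite_allI)
  then have "AE x in lebesgue. x \<in> \<Omega> \<longrightarrow> \<bar>f x\<bar> \<le> (\<Sum>K\<in>T. \<bar>c K\<bar>)"
  proof eventually_elim
    case (elim x)
    show ?case
    proof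
      assume "x \<in> \<Omega>"
      then obtain K where K: "K \<in> T" "x \<in> K" using cover by auto
      then have "\<bar>f x\<bar> \<le> \<bar>c K\<bar>" using elim \<open>x \<in> \<Omega>\<close> by force
      also have "\<dots> \<le> (\<Sum>K\<in>T. \<bar>c K\<bar>)" using K(1) fin by (intro member_le_sum) auto
      finally show "\<bar>f x\<bar> \<le> (\<Sum>K\<in>T. \<bar>c K\<bar>)" .
    qed
  qed
  then have "AE x in lebesgue_on \<Omega>. \<bar>f x\<bar> \<le> (\<Sum>K\<in>T. \<bar>c K\<bar>)"
    using open_dom by (simp add: AE_restrict_space_iff)
  then show ?thesis using L2_D(1)[OF L] by (auto simp: ess_bounded_def)
qed

lemma integrable_mult_ess_bounded:
  fixes f q :: "real ^ 'd::finite \<Rightarrow> real"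
  assumes "integrable (lebesgue_on \<Omega>) f" "ess_bounded \<Omega> q"
  shows "integrable (lebesgue_on \<Omega>) (\<lambda>x. f x * q x)"
proof -
  obtain c where c: "AE x in lebesgue_on \<Omega>. norm (q x) \<le> c"
    and m[measurable]: "q \<in> borel_measurable (lebesgue_on \<Omega>)"
    using assms(2) by (auto simp: ess_bounded_def)
  note [measurable] = borel_measurable_integrable[OF assms(1)]
  show ?thesis
  proof (rule Bochner_Integration.integrable_bound)
    show "integrable (lebesgue_on \<Omega>) (\<lambda>x. c * f x)" using assms(1) by simp
    show "AE x in lebesgue_on \<Omega>. norm (f x * q x) \<le> norm (c * f x)"
      using c
    proof eventually_elim
      case (elim x)
      have "\<bar>f x\<bar> * \<bar>q x\<bar> \<le> \<bar>f x\<bar> * \<bar>c\<bar>" using elim by (intro mult_left_mono) auto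
      then show ?case by (simp add: abs_mult mult.commute)
    qed
  qed measurable
qed

section \<open>The elastic energy\<close>

text \<open>The elasticity tensor frozen at the previous phase field: by assumption its energy is a symmetric
  and coercive form on the fields of symmetric tensors.\<close>

locale elastic = bounded_open \<Omega> for \<Omega> :: "(real ^ 'd::finite) set" +
  fixes C\<^sub>m C\<^sub>p :: "'d tensor4" and \<pi> :: "real \<Rightarrow> real" and c\<^sub>C C\<^sub>C \<xi> :: real and \<phi>0 :: "real ^ 'd \<Rightarrow> real"
  assumes \<phi>0_bounded: "ess_bounded \<Omega> \<phi>0"
    and \<pi>_C1: "\<pi> C1_differentiable_on UNIV"
    and coercive_bounded: "\<And>E. \<lbrakk>E \<in> L2 \<Omega>; \<And>x. x \<in> \<Omega> \<Longrightarrow> transpose (E x) = E x\<rbrakk> \<Longrightarrow>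
         c\<^sub>C * (l2_norm \<Omega> E)\<^sup>2 \<le> l2_inner \<Omega> (\<lambda>x. blinfun_apply (elast C\<^sub>m C\<^sub>p \<pi> (\<phi>0 x)) (E x)) E \<and>
         l2_inner \<Omega> (\<lambda>x. blinfun_apply (elast C\<^sub>m C\<^sub>p \<pi> (\<phi>0 x)) (E x)) E \<le> C\<^sub>C * (l2_norm \<Omega> E)\<^sup>2"
    and symmetric: "\<And>E W. \<lbrakk>E \<in> L2 \<Omega>; \<And>x. x \<in> \<Omega> \<Longrightarrow> transpose (E x) = E x;
                 W \<in> L2 \<Omega>; \<And>x. x \<in> \<Omega> \<Longrightarrow> transpose (W x) = W x\<rbrakk> \<Longrightarrow>
         l2_inner \<Omega> (\<lambda>x. blinfun_apply (elast C\<^sub>m C\<^sub>p \<pi> (\<phi>0 x)) (E x)) W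
           = l2_inner \<Omega> (\<lambda>x. blinfun_apply (elast C\<^sub>m C\<^sub>p \<pi> (\<phi>0 x)) (W x)) E"
    and c\<^sub>C_pos: "c\<^sub>C > 0" and C\<^sub>C_pos: "C\<^sub>C > 0"
begin

definition stress :: "(real ^ 'd \<Rightarrow> real ^ 'd ^ 'd) \<Rightarrow> real ^ 'd \<Rightarrow> real ^ 'd ^ 'd" where
  "stress E = (\<lambda>x. blinfun_apply (elast C\<^sub>m C\<^sub>p \<pi> (\<phi>0 x)) (E x))"

definition sym_tensors :: "(real ^ 'd \<Rightarrow> real ^ 'd ^ 'd) set" where
  "sym_tensors = {E \<in> L2 \<Omega>. \<forall>x\<in>\<Omega>. transpose (E x) = E x}"

text \<open>The stress-free strain that a phase field induces.\<close>

definition dilation :: "(real ^ 'd \<Rightarrow> real) \<Rightarrow> real ^ 'd \<Rightarrow> real ^ 'd ^ 'd" where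
  "dilation q x = (\<xi> * q x) *\<^sub>R mat 1"

lemma elastic_strain_eq: "elastic_strain \<Omega> \<xi> q v = (\<lambda>x. strain \<Omega> v x - dilation q x)"
  by (simp add: fun_eq_iff elastic_strain_def dilation_def)

lemma stress_L2:
  assumes "E \<in> L2 \<Omega>"
  shows "stress E \<in> L2 \<Omega>"
proof -
  have "(\<lambda>x. blinfun_apply C\<^sub>m (E x) + \<pi> (\<phi>0 x) *\<^sub>R blinfun_apply (C\<^sub>p - C\<^sub>m) (E x)) \<in> L2 \<Omega>"
    by (intro L2_add L2_mult_bounded L2_linear_image[OF assms] ess_bounded_continuous[OF \<phi>0_bounded]
        C1_deriv_continuous(2)[OF \<pi>_C1] blinfun.bounded_linear_right)
  moreover have "stress E = (\<lambda>x. blinfun_apply C\<^sub>m (E x) + \<pi> (\<phi>0 x) *\<^sub>R blinfun_apply (C\<^sub>p - C\<^sub>m) (E x))"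
    by (simp add: fun_eq_iff stress_def elast_def blinfun.add_left blinfun.scaleR_left)
  ultimately show ?thesis by simp
qed

lemma elast'_L2:
  assumes "E \<in> L2 \<Omega>"
  shows "(\<lambda>x. blinfun_apply (elast' C\<^sub>m C\<^sub>p \<pi> (\<phi>0 x)) (E x)) \<in> L2 \<Omega>"
proof -
  have "(\<lambda>x. deriv \<pi> (\<phi>0 x) *\<^sub>R blinfun_apply (C\<^sub>p - C\<^sub>m) (E x)) \<in> L2 \<Omega>"
    by (intro L2_mult_bounded L2_linear_image[OF assms] ess_bounded_continuous[OF \<phi>0_bounded]
        C1_deriv_continuous(1)[OF \<pi>_C1] blinfun.bounded_linear_right)
  then show ?thesis by (simp add: elast'_def blinfun.scaleR_left)
qed

lemma sym_tensors_L2: "E \<in> sym_tensors \<Longrightarrow> E \<in> L2 \<Omega>"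
  by (simp add: sym_tensors_def)

sublocale el: semi_inner sym_tensors "\<lambda>E W. l2_inner \<Omega> (stress E) W"
proof
  fix E W U :: "real ^ 'd \<Rightarrow> real ^ 'd ^ 'd" and c :: real
  show "(\<lambda>x. 0) \<in> sym_tensors" by (simp add: sym_tensors_def l2.zero_mem transpose_def vec_eq_iff)
  assume E: "E \<in> sym_tensors"
  show "(\<lambda>x. c *\<^sub>R E x) \<in> sym_tensors"
    using E L2_scaleR[of E \<Omega> c] by (auto simp: sym_tensors_def transpose_def vec_eq_iff)
  have "0 \<le> c\<^sub>C * (l2_norm \<Omega> E)\<^sup>2" using c\<^sub>C_pos by simp
  also have "\<dots> \<le> l2_inner \<Omega> (stress E) E"
    using E coercive_bounded[of E] by (simp add: stress_def sym_tensors_def)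
  finally show "0 \<le> l2_inner \<Omega> (stress E) E" .
  show "l2_inner \<Omega> (stress (\<lambda>x. c *\<^sub>R E x)) U = c * l2_inner \<Omega> (stress E) U" if "U \<in> sym_tensors"
    using l2.scale_left[OF stress_L2[OF sym_tensors_L2[OF E]] sym_tensors_L2[OF that], of c]
    by (simp add: stress_def blinfun.scaleR_right)
  assume W: "W \<in> sym_tensors"
  show "(\<lambda>x. E x + W x) \<in> sym_tensors"
    using E W L2_add[of E \<Omega> W] by (auto simp: sym_tensors_def transpose_def vec_eq_iff)
  show "l2_inner \<Omega> (stress E) W = l2_inner \<Omega> (stress W) E"
    using symmetric[of E W] E W by (simp add: stress_def sym_tensors_def)
  show "l2_inner \<Omega> (stress (\<lambda>x. E x + W x)) U = l2_inner \<Omega> (stress E) U + l2_inner \<Omega> (stress W) U" if "U \<in> sym_tensors"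
    using l2.add_left[OF stress_L2[OF sym_tensors_L2[OF E]] stress_L2[OF sym_tensors_L2[OF W]] sym_tensors_L2[OF that]]
    by (simp add: stress_def blinfun.add_right)
qed

lemma el_cong_AE:
  assumes "E \<in> sym_tensors" "E' \<in> sym_tensors" "W \<in> sym_tensors" "W' \<in> sym_tensors"
    and "AE x in lebesgue_on \<Omega>. E x = E' x" "AE x in lebesgue_on \<Omega>. W x = W' x"
  shows "l2_inner \<Omega> (stress E) W = l2_inner \<Omega> (stress E') W'"
proof (rule l2_inner_cong_AE)
  show "AE x in lebesgue_on \<Omega>. stress E x = stress E' x"
    using assms(5) by eventually_elim (simp add: stress_def)
qed (use assms stress_L2 sym_tensors_L2 in auto)

lemma dilation_sym:
  assumes "q \<in> L2 \<Omega>"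
  shows "dilation q \<in> sym_tensors"
proof -
  have "bounded_linear (\<lambda>t :: real. (\<xi> * t) *\<^sub>R (mat 1 :: real ^ 'd ^ 'd))"
    by (intro bounded_linear_intros)
  then have "dilation q \<in> L2 \<Omega>"
    unfolding dilation_def[abs_def] using L2_linear_image[OF assms] by blast
  then show ?thesis by (auto simp: sym_tensors_def dilation_def transpose_def mat_def vec_eq_iff)
qed

lemma strain_sym: "v \<in> vH1 \<Omega> \<Longrightarrow> strain \<Omega> v \<in> sym_tensors"
  by (simp add: sym_tensors_def strain_L2 strain_symmetric)

lemma elastic_strain_sym: "q \<in> L2 \<Omega> \<Longrightarrow> v \<in> vH1 \<Omega> \<Longrightarrow> elastic_strain \<Omega> \<xi> q v \<in> sym_tensors"
  unfolding elastic_strain_eq by (intro el.diff_mem strain_sym dilation_sym)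

lemma elastic_strain_add:
  assumes "w \<in> vH1 \<Omega>" "v \<in> vH1 \<Omega>"
  shows "AE x in lebesgue_on \<Omega>. elastic_strain \<Omega> \<xi> (\<lambda>x. s x + q x) (\<lambda>x. w x + v x) x
     = elastic_strain \<Omega> \<xi> s w x + elastic_strain \<Omega> \<xi> q v x"
  using strain_add[OF assms] by eventually_elim (simp add: elastic_strain_def algebra_simps)

lemma elastic_strain_scale:
  assumes "v \<in> vH1 \<Omega>"
  shows "AE x in lebesgue_on \<Omega>. elastic_strain \<Omega> \<xi> (\<lambda>x. c * q x) (\<lambda>x. c *\<^sub>R v x) x
     = c *\<^sub>R elastic_strain \<Omega> \<xi> q v x"
  using strain_scale[OF assms, of c] by eventually_elim (simp add: elastic_strain_def algebra_simps)

lemma vH1_zero: "(\<lambda>x. 0) \<in> vH1 \<Omega>"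
  by (rule vl2.zero_mem)

lemma dilation_norm:
  "(l2_norm \<Omega> (dilation q))\<^sup>2 = \<xi>\<^sup>2 * ((mat 1 :: real ^ 'd ^ 'd) \<bullet> mat 1) * (l2_norm \<Omega> q)\<^sup>2"
proof -
  have "l2_inner \<Omega> (dilation q) (dilation q) = (LINT x|lebesgue_on \<Omega>. (\<xi>\<^sup>2 * ((mat 1 :: real ^ 'd ^ 'd) \<bullet> mat 1)) * (q x * q x))"
    by (simp add: l2_inner_def dilation_def power2_eq_square mult_ac)
  then show ?thesis by (simp add: l2_norm_sq l2_inner_def)
qed

lemma dilation_bounds:
  assumes "q \<in> L2 \<Omega>"
  shows "c\<^sub>C * (\<xi>\<^sup>2 * ((mat 1 :: real ^ 'd ^ 'd) \<bullet> mat 1)) * (l2_norm \<Omega> q)\<^sup>2 \<le> l2_inner \<Omega> (stress (dilation q)) (dilation q)"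
    "l2_inner \<Omega> (stress (dilation q)) (dilation q) \<le> C\<^sub>C * (\<xi>\<^sup>2 * ((mat 1 :: real ^ 'd ^ 'd) \<bullet> mat 1)) * (l2_norm \<Omega> q)\<^sup>2"
  using coercive_bounded[of "dilation q"] dilation_sym[OF assms]
  by (auto simp: sym_tensors_def stress_def dilation_norm mult.assoc)

lemma el_coercive: "E \<in> sym_tensors \<Longrightarrow> c\<^sub>C * (l2_norm \<Omega> E)\<^sup>2 \<le> l2_inner \<Omega> (stress E) E"
  using coercive_bounded[of E] by (auto simp: sym_tensors_def stress_def)

end

section \<open>One time step of the discretized system\<close>

text \<open>The discrete problem of one time step; the parameter \<open>D\<close> stands for the bilinear form of the squared
  dual norm.\<close>

locale time_step =
  mean_free_poincare \<Omega> Q m C\<^sub>\<Omega> + elastic \<Omega> C\<^sub>m C\<^sub>p \<pi> c\<^sub>C C\<^sub>C \<xi> \<phi>0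
  for \<Omega> :: "(real ^ 'd::finite) set" and Q m C\<^sub>\<Omega> C\<^sub>m C\<^sub>p \<pi> c\<^sub>C C\<^sub>C \<xi> \<phi>0 +
  fixes V :: "(real ^ 'd \<Rightarrow> real ^ 'd) set" and h \<gamma> ell \<tau> C\<^sub>i\<^sub>n\<^sub>v :: real
    and R :: "real ^ 'd \<Rightarrow> real" and f :: "real ^ 'd \<Rightarrow> real ^ 'd" and \<Psi>\<^sub>c \<Psi>\<^sub>e :: "real \<Rightarrow> real"
    and u0 :: "real ^ 'd \<Rightarrow> real ^ 'd"
    and D :: "(real ^ 'd \<Rightarrow> real) \<Rightarrow> (real ^ 'd \<Rightarrow> real) \<Rightarrow> real"
  assumes V_fin: "fin_dim_space V" and V_H10: "v \<in> V \<Longrightarrow> (\<lambda>x. v x $ i) \<in> H10 \<Omega>"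
    and Q_bounded: "q \<in> Q \<Longrightarrow> ess_bounded \<Omega> q"
    and pos: "\<gamma> > 0" "ell > 0" "\<tau> > 0" "h > 0" "C\<^sub>i\<^sub>n\<^sub>v > 0" "C\<^sub>\<Omega> > 0" "\<xi> \<noteq> 0"
    and data: "R \<in> L2 \<Omega>" "f \<in> L2 \<Omega>"
    and \<Psi>\<^sub>c: "convex_on UNIV \<Psi>\<^sub>c" "\<Psi>\<^sub>c differentiable_on UNIV"
    and \<Psi>\<^sub>e: "convex_on UNIV \<Psi>\<^sub>e" "\<Psi>\<^sub>e differentiable_on UNIV"
    and prev: "\<phi>0 \<in> Q" "u0 \<in> V"
    and inverse_estimate: "s \<in> mean_free \<Omega> Q \<Longrightarrow> C\<^sub>i\<^sub>n\<^sub>v * inverse h * dual_norm \<Omega> Q m s \<ge> l2_norm \<Omega> s"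
    and D_semi: "semi_inner (L2 \<Omega>) D"
    and D_norm: "s \<in> L2 \<Omega> \<Longrightarrow> (dual_norm \<Omega> Q m s)\<^sup>2 = D s s"
    and D_rep: "\<lbrakk>g \<in> L2 \<Omega>; \<mu> \<in> Q; \<delta> \<in> mean_free \<Omega> Q;
       \<And>q. q \<in> mean_free \<Omega> Q \<Longrightarrow> m * l2_inner \<Omega> (wgrad \<Omega> \<mu>) (wgrad \<Omega> q) = l2_inner \<Omega> g q\<rbrakk> \<Longrightarrow>
       D g \<delta> = l2_inner \<Omega> \<mu> \<delta>"
begin

sublocale dual: semi_inner "L2 \<Omega>" D
  by (rule D_semi)

abbreviation F :: "(real ^ 'd \<Rightarrow> real) \<Rightarrow> (real ^ 'd \<Rightarrow> real ^ 'd) \<Rightarrow> real" where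
  "F \<equiv> F_tau \<Omega> Q \<gamma> ell \<tau> m \<xi> \<Psi>\<^sub>c \<Psi>\<^sub>e (elast C\<^sub>m C\<^sub>p \<pi>) (elast' C\<^sub>m C\<^sub>p \<pi>) R f \<phi>0 u0"

abbreviation es :: "(real ^ 'd \<Rightarrow> real) \<Rightarrow> (real ^ 'd \<Rightarrow> real ^ 'd) \<Rightarrow> real ^ 'd \<Rightarrow> real ^ 'd ^ 'd" where
  "es \<equiv> elastic_strain \<Omega> \<xi>"

abbreviation explicit_energy :: "real ^ 'd \<Rightarrow> real" where
  "explicit_energy \<equiv> E_ee \<Omega> \<xi> (elast' C\<^sub>m C\<^sub>p \<pi>) \<phi>0 u0"

definition residual :: "(real ^ 'd \<Rightarrow> real) \<Rightarrow> real ^ 'd \<Rightarrow> real" where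
  "residual s = (\<lambda>x. s x - \<phi>0 x - \<tau> * R x)"

text \<open>The derivative of \<open>F\<close> at \<open>(s, w)\<close> in the phase direction \<open>q\<close>; the derivative in the displacement
  direction follows. The quadratic part of \<open>F\<close> is half of the form \<open>F_form\<close>, which couples the two
  directions through the elastic strain.\<close>

definition F_phase :: "(real ^ 'd \<Rightarrow> real) \<Rightarrow> (real ^ 'd \<Rightarrow> real ^ 'd) \<Rightarrow> (real ^ 'd \<Rightarrow> real) \<Rightarrow> real" where
  "F_phase s w q = D (residual s) q / \<tau> + \<gamma> * ell * l2_inner \<Omega> (wgrad \<Omega> s) (wgrad \<Omega> q)
     - l2_inner \<Omega> (stress (es s w)) (dilation q) + l2_inner \<Omega> explicit_energy q
     - \<gamma> / ell * l2_inner \<Omega> (\<lambda>x. deriv \<Psi>\<^sub>e (\<phi>0 x)) q + \<gamma> / ell * l2_inner \<Omega> (\<lambda>x. deriv \<Psi>\<^sub>c (s x)) q"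

definition F_displacement :: "(real ^ 'd \<Rightarrow> real) \<Rightarrow> (real ^ 'd \<Rightarrow> real ^ 'd) \<Rightarrow> (real ^ 'd \<Rightarrow> real ^ 'd) \<Rightarrow> real" where
  "F_displacement s w v = l2_inner \<Omega> (stress (es s w)) (strain \<Omega> v) - l2_inner \<Omega> f v"

definition phase_form :: "(real ^ 'd \<Rightarrow> real) \<Rightarrow> real" where
  "phase_form q = D q q / \<tau> + \<gamma> * ell * l2_inner \<Omega> (wgrad \<Omega> q) (wgrad \<Omega> q)"

definition F_form :: "(real ^ 'd \<Rightarrow> real) \<Rightarrow> (real ^ 'd \<Rightarrow> real ^ 'd) \<Rightarrow> real" where
  "F_form q v = phase_form q + l2_inner \<Omega> (stress (es q v)) (es q v)"

definition bregman :: "(real ^ 'd \<Rightarrow> real) \<Rightarrow> (real ^ 'd \<Rightarrow> real) \<Rightarrow> real" where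
  "bregman s q = \<gamma> / ell * (LINT x|lebesgue_on \<Omega>. \<Psi>\<^sub>c (s x + q x) - \<Psi>\<^sub>c (s x) - deriv \<Psi>\<^sub>c (s x) * q x)"

lemma V_vH1: "v \<in> V \<Longrightarrow> v \<in> vH1 \<Omega>"
  using V_H10 by (auto simp: vH1_def H10_def)

lemma V_add: "v \<in> V \<Longrightarrow> w \<in> V \<Longrightarrow> (\<lambda>x. v x + w x) \<in> V"
  by (rule fin_dim_space_add[OF V_fin])

lemma V_scale: "v \<in> V \<Longrightarrow> (\<lambda>x. c *\<^sub>R v x) \<in> V"
  by (rule fin_dim_space_scale[OF V_fin])

lemma es_sym: "q \<in> Q \<Longrightarrow> v \<in> V \<Longrightarrow> es q v \<in> sym_tensors"
  by (rule elastic_strain_sym[OF Q_D(2) V_vH1])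

lemma residual_L2: "s \<in> Q \<Longrightarrow> residual s \<in> L2 \<Omega>"
  using l2.diff_mem[OF l2.diff_mem[OF Q_D(2) Q_D(2)[OF prev(1)]] L2_scaleR[OF data(1), of \<tau>]]
  by (simp add: residual_def)

lemma \<Psi>_L2:
  assumes "s \<in> Q"
  shows "(\<lambda>x. \<Psi>\<^sub>c (s x)) \<in> L2 \<Omega>" "(\<lambda>x. deriv \<Psi>\<^sub>c (s x)) \<in> L2 \<Omega>" "(\<lambda>x. deriv \<Psi>\<^sub>e (s x)) \<in> L2 \<Omega>"
  by (rule ess_bounded_L2[OF ess_bounded_continuous[OF Q_bounded[OF assms] convex_deriv(4)[OF \<Psi>\<^sub>c]]],
      rule ess_bounded_L2[OF ess_bounded_mono[OF Q_bounded[OF assms] convex_deriv(3)[OF \<Psi>\<^sub>c]]],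
      rule ess_bounded_L2[OF ess_bounded_mono[OF Q_bounded[OF assms] convex_deriv(3)[OF \<Psi>\<^sub>e]]])

lemma explicit_energy_integrable: "integrable (lebesgue_on \<Omega>) explicit_energy"
proof -
  have "es \<phi>0 u0 \<in> L2 \<Omega>" using es_sym[OF prev] sym_tensors_L2 by blast
  from L2_integrable_inner[OF this elast'_L2[OF this]] show ?thesis
    by (simp add: E_ee_def[abs_def])
qed

lemma explicit_energy_add:
  assumes "s \<in> Q" "q \<in> Q"
  shows "l2_inner \<Omega> explicit_energy (\<lambda>x. s x + q x) = l2_inner \<Omega> explicit_energy s + l2_inner \<Omega> explicit_energy q"
  using integrable_mult_ess_bounded[OF explicit_energy_integrable Q_bounded[OF assms(1)]]
    integrable_mult_ess_bounded[OF explicit_energy_integrable Q_bounded[OF assms(2)]]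
  by (simp add: l2_inner_def distrib_left)

lemma E_cc_eq:
  assumes "s \<in> Q" "w \<in> V"
  shows "E_cc \<Omega> \<gamma> ell \<xi> \<Psi>\<^sub>c (elast C\<^sub>m C\<^sub>p \<pi>) s w \<phi>0 = \<gamma> / ell * (LINT x|lebesgue_on \<Omega>. \<Psi>\<^sub>c (s x))
     + \<gamma> * ell / 2 * l2_inner \<Omega> (wgrad \<Omega> s) (wgrad \<Omega> s) + l2_inner \<Omega> (stress (es s w)) (es s w) / 2"
proof -
  have eL: "es s w \<in> L2 \<Omega>" using es_sym[OF assms] sym_tensors_L2 by blast
  note L2_integrable[OF \<Psi>_L2(1)[OF assms(1)], simp] L2_D(2)[OF wgrad_L2[OF Q_D(1)[OF assms(1)]], simp]
    L2_integrable_inner[OF stress_L2[OF eL] eL, simp]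
  have "E_cc \<Omega> \<gamma> ell \<xi> \<Psi>\<^sub>c (elast C\<^sub>m C\<^sub>p \<pi>) s w \<phi>0 = (LINT x|lebesgue_on \<Omega>. \<gamma> / ell * \<Psi>\<^sub>c (s x)
      + \<gamma> * ell / 2 * (norm (wgrad \<Omega> s x))\<^sup>2 + 1 / 2 * (stress (es s w) x \<bullet> es s w x))"
    by (simp add: E_cc_def stress_def inner_commute)
  also have "\<dots> = \<gamma> / ell * (LINT x|lebesgue_on \<Omega>. \<Psi>\<^sub>c (s x)) + \<gamma> * ell / 2 * (LINT x|lebesgue_on \<Omega>. (norm (wgrad \<Omega> s x))\<^sup>2)
      + 1 / 2 * (LINT x|lebesgue_on \<Omega>. stress (es s w) x \<bullet> es s w x)"
    by (subst Bochner_Integration.integral_add, simp, simp, subst Bochner_Integration.integral_add, simp, simp) simp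
  finally show ?thesis by (simp add: l2_inner_def power2_norm_eq_inner)
qed

lemma F_eq:
  assumes "s \<in> Q" "w \<in> V"
  shows "F s w = D (residual s) (residual s) / (2 * \<tau>) + \<gamma> / ell * (LINT x|lebesgue_on \<Omega>. \<Psi>\<^sub>c (s x))
     + \<gamma> * ell / 2 * l2_inner \<Omega> (wgrad \<Omega> s) (wgrad \<Omega> s) + l2_inner \<Omega> (stress (es s w)) (es s w) / 2
     + l2_inner \<Omega> explicit_energy s - \<gamma> / ell * l2_inner \<Omega> (\<lambda>x. deriv \<Psi>\<^sub>e (\<phi>0 x)) s - l2_inner \<Omega> f w"
  using E_cc_eq[OF assms] D_norm[OF residual_L2[OF assms(1)]] by (simp add: F_tau_def residual_def)

text \<open>All parts of the energy but the convex part of the double-well potential are quadratic, so the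
  second-order expansion is exact up to a multiple of the Bregman distance of that part.\<close>

lemma F_expansion:
  assumes s: "s \<in> Q" and w: "w \<in> V" and q: "q \<in> Q" and v: "v \<in> V"
  shows "F (\<lambda>x. s x + q x) (\<lambda>x. w x + v x)
     = F s w + F_phase s w q + F_displacement s w v + F_form q v / 2 + bregman s q"
proof -
  note sq = Q_add[OF s q] and wv = V_add[OF w v]
  have r: "residual (\<lambda>x. s x + q x) = (\<lambda>x. residual s x + q x)" by (simp add: residual_def fun_eq_iff)
  have 1: "D (residual (\<lambda>x. s x + q x)) (residual (\<lambda>x. s x + q x))
      = D (residual s) (residual s) + 2 * D (residual s) q + D q q"
    unfolding r by (rule dual.expand[OF residual_L2[OF s] Q_D(2)[OF q]])
  note 2 = dir.expand[OF Q_D(1)[OF s] Q_D(1)[OF q]]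
  have "l2_inner \<Omega> (stress (es (\<lambda>x. s x + q x) (\<lambda>x. w x + v x))) (es (\<lambda>x. s x + q x) (\<lambda>x. w x + v x))
      = l2_inner \<Omega> (stress (\<lambda>x. es s w x + es q v x)) (\<lambda>x. es s w x + es q v x)"
    by (intro el_cong_AE es_sym el.add_mem sq wv s w q v elastic_strain_add V_vH1)
  then have 3: "l2_inner \<Omega> (stress (es (\<lambda>x. s x + q x) (\<lambda>x. w x + v x))) (es (\<lambda>x. s x + q x) (\<lambda>x. w x + v x))
      = l2_inner \<Omega> (stress (es s w)) (es s w) + 2 * l2_inner \<Omega> (stress (es s w)) (es q v) + l2_inner \<Omega> (stress (es q v)) (es q v)"
    unfolding el.expand[OF es_sym[OF s w] es_sym[OF q v]] .
  have 4: "l2_inner \<Omega> (stress (es s w)) (es q v)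
      = l2_inner \<Omega> (stress (es s w)) (strain \<Omega> v) - l2_inner \<Omega> (stress (es s w)) (dilation q)"
    unfolding elastic_strain_eq[of q v]
    by (rule el.diff_right[OF strain_sym[OF V_vH1[OF v]] dilation_sym[OF Q_D(2)[OF q]] es_sym[OF s w]])
  note 5 = explicit_energy_add[OF s q]
  note 6 = l2.add_right[OF Q_D(2)[OF s] Q_D(2)[OF q] \<Psi>_L2(3)[OF prev(1)]]
  note 7 = l2.add_right[OF vH1_L2[OF V_vH1[OF w]] vH1_L2[OF V_vH1[OF v]] data(2)]
  have "(LINT x|lebesgue_on \<Omega>. \<Psi>\<^sub>c (s x + q x) - \<Psi>\<^sub>c (s x) - deriv \<Psi>\<^sub>c (s x) * q x)
      = (LINT x|lebesgue_on \<Omega>. \<Psi>\<^sub>c (s x + q x)) - (LINT x|lebesgue_on \<Omega>. \<Psi>\<^sub>c (s x)) - l2_inner \<Omega> (\<lambda>x. deriv \<Psi>\<^sub>c (s x)) q"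
    using L2_integrable[OF \<Psi>_L2(1)[OF s]] L2_integrable[OF \<Psi>_L2(1)[OF sq]] L2_integrable_inner[OF \<Psi>_L2(2)[OF s] Q_D(2)[OF q]]
    by (simp add: l2_inner_def)
  then have 8: "\<gamma> / ell * (LINT x|lebesgue_on \<Omega>. \<Psi>\<^sub>c (s x + q x)) = \<gamma> / ell * (LINT x|lebesgue_on \<Omega>. \<Psi>\<^sub>c (s x))
      + \<gamma> / ell * l2_inner \<Omega> (\<lambda>x. deriv \<Psi>\<^sub>c (s x)) q + bregman s q"
    unfolding bregman_def by (simp add: right_diff_distrib)
  define k where "k = \<gamma> / ell"
  show ?thesis
    unfolding F_eq[OF sq wv] F_eq[OF s w] F_phase_def F_displacement_def F_form_def phase_form_def 1 2 3 4 5 6 7 8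
    unfolding k_def[symmetric]
    by (simp add: add_divide_distrib diff_divide_distrib algebra_simps)
qed

lemma bregman_integrable:
  assumes "s \<in> Q" "q \<in> Q"
  shows "integrable (lebesgue_on \<Omega>) (\<lambda>x. \<Psi>\<^sub>c (s x + q x) - \<Psi>\<^sub>c (s x) - deriv \<Psi>\<^sub>c (s x) * q x)"
  using L2_integrable[OF \<Psi>_L2(1)[OF assms(1)]] L2_integrable[OF \<Psi>_L2(1)[OF Q_add[OF assms]]]
    L2_integrable_inner[OF \<Psi>_L2(2)[OF assms(1)] Q_D(2)[OF assms(2)]] by simp

lemma bregman_nonneg: "0 \<le> bregman s q"
proof -
  have "0 \<le> \<Psi>\<^sub>c (s x + q x) - \<Psi>\<^sub>c (s x) - deriv \<Psi>\<^sub>c (s x) * q x" for x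
    using convex_deriv(2)[OF \<Psi>\<^sub>c, of "s x" "s x + q x"] by simp
  then show ?thesis unfolding bregman_def using pos by (intro mult_nonneg_nonneg integral_nonneg_AE) auto
qed

lemma bregman_convex:
  assumes "s \<in> Q" "q \<in> Q" "0 \<le> t" "t \<le> 1"
  shows "bregman s (\<lambda>x. t * q x) \<le> t * bregman s q"
proof -
  have "(LINT x|lebesgue_on \<Omega>. \<Psi>\<^sub>c (s x + t * q x) - \<Psi>\<^sub>c (s x) - deriv \<Psi>\<^sub>c (s x) * (t * q x))
      \<le> (LINT x|lebesgue_on \<Omega>. t * (\<Psi>\<^sub>c (s x + q x) - \<Psi>\<^sub>c (s x) - deriv \<Psi>\<^sub>c (s x) * q x))"
  proof (rule integral_mono)
    fix x
    have "\<Psi>\<^sub>c ((1 - t) *\<^sub>R s x + t *\<^sub>R (s x + q x)) \<le> (1 - t) * \<Psi>\<^sub>c (s x) + t * \<Psi>\<^sub>c (s x + q x)"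
      using convex_onD[OF \<Psi>\<^sub>c(1) assms(3,4)] by simp
    moreover have "(1 - t) *\<^sub>R s x + t *\<^sub>R (s x + q x) = s x + t * q x" by (simp add: algebra_simps)
    ultimately show "\<Psi>\<^sub>c (s x + t * q x) - \<Psi>\<^sub>c (s x) - deriv \<Psi>\<^sub>c (s x) * (t * q x)
        \<le> t * (\<Psi>\<^sub>c (s x + q x) - \<Psi>\<^sub>c (s x) - deriv \<Psi>\<^sub>c (s x) * q x)"
      by (simp add: algebra_simps)
  qed (use bregman_integrable[OF assms(1) Q_scale[OF assms(2)]] bregman_integrable[OF assms(1,2)] in simp_all)
  then have "\<gamma> / ell * (LINT x|lebesgue_on \<Omega>. \<Psi>\<^sub>c (s x + t * q x) - \<Psi>\<^sub>c (s x) - deriv \<Psi>\<^sub>c (s x) * (t * q x))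
      \<le> \<gamma> / ell * (t * (LINT x|lebesgue_on \<Omega>. \<Psi>\<^sub>c (s x + q x) - \<Psi>\<^sub>c (s x) - deriv \<Psi>\<^sub>c (s x) * q x))"
    using pos by (intro mult_left_mono) auto
  then show ?thesis unfolding bregman_def by (simp add: mult.left_commute)
qed

text \<open>The inverse estimate and the Poincare inequality bound the phase part of the form from below by \<open>\<kappa>\<close>
  times the squared \<open>L\<^sup>2\<close> norm. The ratio \<open>\<rho>\<close> compares this with the elastic energy of the dilation,
  that is, with the strength of the coupling.\<close>

definition \<kappa> :: real where
  "\<kappa> = h\<^sup>2 / (\<tau> * C\<^sub>i\<^sub>n\<^sub>v\<^sup>2) + \<gamma> * ell / C\<^sub>\<Omega>\<^sup>2"

definition \<rho> :: real where
  "\<rho> = \<kappa> / (C\<^sub>C * (\<xi>\<^sup>2 * ((mat 1 :: real ^ 'd ^ 'd) \<bullet> mat 1)))"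

lemma mat_1_pos: "(mat 1 :: real ^ 'd ^ 'd) \<bullet> mat 1 > 0"
proof -
  have "(mat 1 :: real ^ 'd ^ 'd) \<noteq> 0" by (simp add: vec_eq_iff mat_def)
  then show ?thesis by simp
qed

lemma \<kappa>_pos: "\<kappa> > 0"
  unfolding \<kappa>_def using pos by (intro add_pos_pos divide_pos_pos mult_pos_pos zero_less_power) auto

lemma \<rho>_pos: "\<rho> > 0"
  unfolding \<rho>_def using \<kappa>_pos C\<^sub>C_pos mat_1_pos pos by (intro divide_pos_pos mult_pos_pos) auto

lemma phase_form_ge:
  assumes q: "q \<in> mean_free \<Omega> Q"
  shows "\<gamma> * ell * l2_inner \<Omega> (wgrad \<Omega> q) (wgrad \<Omega> q) \<le> phase_form q" "\<kappa> * (l2_norm \<Omega> q)\<^sup>2 \<le> phase_form q"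
proof -
  have qL: "q \<in> L2 \<Omega>" using q mean_free_Q Q_D by blast
  show "\<gamma> * ell * l2_inner \<Omega> (wgrad \<Omega> q) (wgrad \<Omega> q) \<le> phase_form q"
    unfolding phase_form_def using dual.nonneg[OF qL] pos by simp
  have "(l2_norm \<Omega> q)\<^sup>2 \<le> (C\<^sub>i\<^sub>n\<^sub>v * inverse h * dual_norm \<Omega> Q m q)\<^sup>2"
    by (intro power_mono inverse_estimate q l2_norm_nonneg)
  also have "\<dots> = C\<^sub>i\<^sub>n\<^sub>v\<^sup>2 / h\<^sup>2 * D q q"
    by (simp add: power_mult_distrib D_norm[OF qL] divide_inverse power_inverse)
  finally have 1: "h\<^sup>2 / (\<tau> * C\<^sub>i\<^sub>n\<^sub>v\<^sup>2) * (l2_norm \<Omega> q)\<^sup>2 \<le> D q q / \<tau>"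
    using pos by (simp add: field_simps)
  have "(l2_norm \<Omega> q)\<^sup>2 \<le> (C\<^sub>\<Omega> * l2_norm \<Omega> (wgrad \<Omega> q))\<^sup>2"
    by (intro power_mono poincare q l2_norm_nonneg)
  then have "(l2_norm \<Omega> q)\<^sup>2 \<le> C\<^sub>\<Omega>\<^sup>2 * l2_inner \<Omega> (wgrad \<Omega> q) (wgrad \<Omega> q)"
    by (simp add: power_mult_distrib l2_norm_sq)
  then have "\<gamma> * ell * (l2_norm \<Omega> q)\<^sup>2 \<le> \<gamma> * ell * (C\<^sub>\<Omega>\<^sup>2 * l2_inner \<Omega> (wgrad \<Omega> q) (wgrad \<Omega> q))"
    using pos by (intro mult_left_mono) auto
  then have 2: "\<gamma> * ell / C\<^sub>\<Omega>\<^sup>2 * (l2_norm \<Omega> q)\<^sup>2 \<le> \<gamma> * ell * l2_inner \<Omega> (wgrad \<Omega> q) (wgrad \<Omega> q)"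
    using pos by (simp add: field_simps)
  show "\<kappa> * (l2_norm \<Omega> q)\<^sup>2 \<le> phase_form q"
    using add_mono[OF 1 2] by (simp add: \<kappa>_def phase_form_def distrib_right)
qed

lemma dilation_le_phase_form:
  assumes q: "q \<in> mean_free \<Omega> Q"
  shows "\<rho> * l2_inner \<Omega> (stress (dilation q)) (dilation q) \<le> phase_form q"
proof -
  have qL: "q \<in> L2 \<Omega>" using q mean_free_Q Q_D by blast
  define c where "c = C\<^sub>C * (\<xi>\<^sup>2 * ((mat 1 :: real ^ 'd ^ 'd) \<bullet> mat 1))"
  have "c > 0" unfolding c_def using C\<^sub>C_pos mat_1_pos pos by (intro mult_pos_pos) auto
  have "\<rho> * l2_inner \<Omega> (stress (dilation q)) (dilation q) \<le> \<rho> * (c * (l2_norm \<Omega> q)\<^sup>2)"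
    using \<rho>_pos dilation_bounds(2)[OF qL] by (intro mult_left_mono) (auto simp: c_def)
  also have "\<dots> = (\<rho> * c) * (l2_norm \<Omega> q)\<^sup>2" by (simp only: mult.assoc)
  also have "\<rho> * c = \<kappa>" unfolding \<rho>_def c_def[symmetric] using \<open>c > 0\<close> by simp
  finally show ?thesis using phase_form_ge(2)[OF q] by linarith
qed

lemma F_form_zero_displacement:
  assumes q: "q \<in> mean_free \<Omega> Q"
  shows "F_form q (\<lambda>x. 0) = phase_form q + l2_inner \<Omega> (stress (dilation q)) (dilation q)"
proof -
  have qL: "q \<in> L2 \<Omega>" using q mean_free_Q Q_D by blast
  have "AE x in lebesgue_on \<Omega>. strain \<Omega> (\<lambda>x. 0) x = 0"
    using strain_scale[OF vH1_zero, of 0] by simp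
  then have ae: "AE x in lebesgue_on \<Omega>. es q (\<lambda>x. 0) x = (-1) *\<^sub>R dilation q x"
    by eventually_elim (simp add: elastic_strain_eq)
  have "l2_inner \<Omega> (stress (es q (\<lambda>x. 0))) (es q (\<lambda>x. 0))
      = l2_inner \<Omega> (stress (\<lambda>x. (-1) *\<^sub>R dilation q x)) (\<lambda>x. (-1) *\<^sub>R dilation q x)"
    by (intro el_cong_AE ae elastic_strain_sym vH1_zero qL el.scale_mem dilation_sym)
  also have "\<dots> = l2_inner \<Omega> (stress (dilation q)) (dilation q)"
    using el.scale_scale[OF dilation_sym[OF qL], of "-1"] by simp
  finally show ?thesis by (simp add: F_form_def)
qed

lemma F_form_zero_phase: "F_form (\<lambda>x. 0) v = l2_inner \<Omega> (stress (strain \<Omega> v)) (strain \<Omega> v)"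
proof -
  have "es (\<lambda>x. 0) v = strain \<Omega> v" by (simp add: elastic_strain_def fun_eq_iff)
  then show ?thesis
    using dual.zero_left[OF l2.zero_mem] dir.zero_left[OF H1_zero] by (simp add: F_form_def phase_form_def)
qed

lemma F_form_ge_phase_form:
  assumes "q \<in> mean_free \<Omega> Q" "v \<in> V"
  shows "phase_form q \<le> F_form q v"
  using el.nonneg[OF es_sym[OF mean_free_Q[OF assms(1)] assms(2)]] by (simp add: F_form_def)

text \<open>This is \<open>\<rho> / (\<rho> + 1)\<close>, the fraction of the energy of one variable that no choice of the other variable
  can relax.\<close>

definition \<beta> :: real where
  "\<beta> = 1 - inverse (\<rho> + 1)"

lemma \<beta>_eq: "\<beta> * (\<rho> + 1) = \<rho>"
  unfolding \<beta>_def using \<rho>_pos by (simp add: left_diff_distrib)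

lemma \<beta>_bounds: "0 < \<beta>" "\<beta> < 1"
proof -
  have "inverse (\<rho> + 1) > 0" "inverse (\<rho> + 1) < 1"
    using \<rho>_pos by (simp_all add: inverse_less_1_iff)
  then show "0 < \<beta>" "\<beta> < 1" by (auto simp: \<beta>_def)
qed

text \<open>The phase part absorbs the dilation energy up to the factor \<open>\<rho>\<close>.\<close>

lemma F_form_ge_phase:
  assumes q: "q \<in> mean_free \<Omega> Q" and v: "v \<in> V"
  shows "\<beta> * F_form q (\<lambda>x. 0) \<le> F_form q v"
proof -
  let ?a = "l2_inner \<Omega> (stress (dilation q)) (dilation q)"
  have "(\<rho> + 1) * (\<beta> * (phase_form q + ?a)) = \<rho> * phase_form q + \<rho> * ?a"
    using \<beta>_eq by (simp add: mult.assoc[symmetric] mult.commute[of _ \<beta>] distrib_left)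
  also have "\<dots> \<le> (\<rho> + 1) * phase_form q"
    using dilation_le_phase_form[OF q] by (simp add: distrib_right)
  finally have "\<beta> * (phase_form q + ?a) \<le> phase_form q"
    using \<rho>_pos by (simp add: mult_le_cancel_left)
  then show ?thesis
    using F_form_zero_displacement[OF q] F_form_ge_phase_form[OF q v] by simp
qed

text \<open>Minimizing the squared distance of the strain and the dilation plus \<open>\<rho>\<close> times the dilation energy
  over the dilation gives the factor \<open>\<rho> / (\<rho> + 1)\<close>; the minimum is attained where the dilation is
  \<open>1 / (\<rho> + 1)\<close> times the strain, which is why this multiple is tested below.\<close>

lemma F_form_ge_displacement:
  assumes q: "q \<in> mean_free \<Omega> Q" and v: "v \<in> V"
  shows "\<beta> * F_form (\<lambda>x. 0) v \<le> F_form q v"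
proof -
  have dS: "dilation q \<in> sym_tensors" and sS: "strain \<Omega> v \<in> sym_tensors"
    using dilation_sym[OF Q_D(2)[OF mean_free_Q[OF q]]] strain_sym[OF V_vH1[OF v]] by auto
  define a where "a = l2_inner \<Omega> (stress (dilation q)) (dilation q)"
  define b where "b = l2_inner \<Omega> (stress (strain \<Omega> v)) (strain \<Omega> v)"
  define c where "c = l2_inner \<Omega> (stress (strain \<Omega> v)) (dilation q)"
  define y where "y = inverse (\<rho> + 1)"
  have y: "y * (\<rho> + 1) = 1" "\<rho> + 1 > 0" using \<rho>_pos by (auto simp: y_def)
  have "0 \<le> y\<^sup>2 * b - 2 * (y * c) + a"
    using el.nonneg[OF el.diff_mem[OF el.scale_mem[OF sS, of y] dS]]
    unfolding el.expand_diff[OF el.scale_mem[OF sS] dS] el.scale_scale[OF sS] el.scale_left[OF sS dS] a_def b_def c_def .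
  then have "0 \<le> (\<rho> + 1) * (y\<^sup>2 * b - 2 * (y * c) + a)"
    using y(2) by (intro mult_nonneg_nonneg) auto
  also have "\<dots> = (y * (\<rho> + 1)) * (y * b - 2 * c) + (\<rho> + 1) * a"
    by (simp add: power2_eq_square algebra_simps)
  finally have "0 \<le> y * b - 2 * c + (\<rho> + 1) * a" unfolding y(1) by simp
  moreover have "\<rho> * a \<le> phase_form q" using dilation_le_phase_form[OF q] by (simp add: a_def)
  ultimately have "(1 - y) * b \<le> phase_form q + (b - 2 * c + a)" by (simp add: algebra_simps)
  moreover have "F_form q v = phase_form q + (b - 2 * c + a)"
    unfolding F_form_def elastic_strain_eq el.expand_diff[OF sS dS] by (simp add: a_def b_def c_def)
  ultimately show ?thesis unfolding F_form_zero_phase by (simp add: \<beta>_def y_def b_def)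
qed

end

context time_step
begin

lemma Q_bar_Q: "s \<in> Q_bar \<Omega> Q \<tau> R \<phi>0 \<Longrightarrow> s \<in> Q"
  by (simp add: Q_bar_def)

lemma mean_quotient:
  assumes "s \<in> Q"
  shows "(LINT x|lebesgue_on \<Omega>. (s x - \<phi>0 x) / \<tau>) = (mean s - mean \<phi>0) / \<tau>"
  using L2_integrable[OF Q_D(2)[OF assms]] L2_integrable[OF Q_D(2)[OF prev(1)]] by simp

lemma Q_bar_iff: "s \<in> Q_bar \<Omega> Q \<tau> R \<phi>0 \<longleftrightarrow> s \<in> Q \<and> (mean s - mean \<phi>0) / \<tau> = mean R"
  by (simp only: Q_bar_def mem_Collect_eq mean_quotient cong: conj_cong)

lemma strain_inner_scale:
  assumes "E \<in> sym_tensors" "v \<in> V"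
  shows "l2_inner \<Omega> (stress E) (strain \<Omega> (\<lambda>x. c *\<^sub>R v x)) = c * l2_inner \<Omega> (stress E) (strain \<Omega> v)"
proof -
  have vH: "v \<in> vH1 \<Omega>" by (rule V_vH1[OF assms(2)])
  have "l2_inner \<Omega> (stress E) (strain \<Omega> (\<lambda>x. c *\<^sub>R v x)) = l2_inner \<Omega> (stress E) (\<lambda>x. c *\<^sub>R strain \<Omega> v x)"
    by (rule el_cong_AE) (auto intro: assms(1) strain_sym vH1_scale vH el.scale_mem strain_scale)
  then show ?thesis using el.scale_right[OF strain_sym[OF vH] assms(1)] by simp
qed

lemma F_phase_scale:
  assumes "s \<in> Q" "w \<in> V" "q \<in> Q"
  shows "F_phase s w (\<lambda>x. c * q x) = c * F_phase s w q"
proof -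
  have dil: "dilation (\<lambda>x. c * q x) = (\<lambda>x. c *\<^sub>R dilation q x)" by (simp add: dilation_def fun_eq_iff)
  have Ee: "l2_inner \<Omega> explicit_energy (\<lambda>x. c *\<^sub>R q x) = c * l2_inner \<Omega> explicit_energy q"
    by (simp add: l2_inner_def mult.left_commute)
  note qL = Q_D(2)[OF assms(3)]
  show ?thesis
    unfolding F_phase_def dil el.scale_right[OF dilation_sym[OF qL] es_sym[OF assms(1,2)]]
      dual.scale_right[OF qL residual_L2[OF assms(1)], unfolded real_scaleR_def]
      dir.scale_right[OF Q_D(1)[OF assms(3)] Q_D(1)[OF assms(1)], unfolded real_scaleR_def]
      Ee[unfolded real_scaleR_def] l2.scale_right[OF qL \<Psi>_L2(3)[OF prev(1)], unfolded real_scaleR_def]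
      l2.scale_right[OF qL \<Psi>_L2(2)[OF assms(1)], unfolded real_scaleR_def]
    by (simp add: algebra_simps)
qed

lemma F_form_scale:
  assumes "q \<in> Q" "v \<in> V"
  shows "F_form (\<lambda>x. c * q x) (\<lambda>x. c *\<^sub>R v x) = c\<^sup>2 * F_form q v"
proof -
  have "l2_inner \<Omega> (stress (es (\<lambda>x. c * q x) (\<lambda>x. c *\<^sub>R v x))) (es (\<lambda>x. c * q x) (\<lambda>x. c *\<^sub>R v x))
      = l2_inner \<Omega> (stress (\<lambda>x. c *\<^sub>R es q v x)) (\<lambda>x. c *\<^sub>R es q v x)"
    by (intro el_cong_AE es_sym el.scale_mem elastic_strain_scale V_vH1 Q_scale V_scale assms)
  then show ?thesis
    unfolding F_form_def phase_form_def
    using el.scale_scale[OF es_sym[OF assms], of c] dual.scale_scale[OF Q_D(2)[OF assms(1)], of c]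
      dir.scale_scale[OF Q_D(1)[OF assms(1)], of c]
    by (simp add: algebra_simps)
qed

sublocale alt: alternating_minimization "Q_bar \<Omega> Q \<tau> R \<phi>0" "mean_free \<Omega> Q" V F F_phase F_displacement F_form bregman \<beta>
proof
  fix s s' q w v c
  assume s: "s \<in> Q_bar \<Omega> Q \<tau> R \<phi>0"
  note sQ = Q_bar_Q[OF s]
  show "(\<lambda>x. s' x - s x) \<in> mean_free \<Omega> Q" if s': "s' \<in> Q_bar \<Omega> Q \<tau> R \<phi>0"
  proof -
    have "mean s' = mean s" using s s' pos(3) by (simp add: Q_bar_iff divide_eq_eq)
    then show ?thesis
      using Q_add[OF Q_bar_Q[OF s'] Q_scale[OF sQ, of "-1"]] L2_integrable[OF Q_D(2)[OF sQ]]
        L2_integrable[OF Q_D(2)[OF Q_bar_Q[OF s']]] by (simp add: mean_free_def)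
  qed
  show "0 \<le> bregman s q" by (rule bregman_nonneg)
  show "F_displacement s w (\<lambda>x. c *\<^sub>R v x) = c * F_displacement s w v" if "w \<in> V" "v \<in> V"
    unfolding F_displacement_def strain_inner_scale[OF es_sym[OF sQ that(1)] that(2)]
      l2.scale_right[OF vH1_L2[OF V_vH1[OF that(2)]] data(2)]
    by (simp add: right_diff_distrib)
  assume q: "q \<in> mean_free \<Omega> Q"
  note qQ = mean_free_Q[OF q]
  show "(\<lambda>x. s x + q x) \<in> Q_bar \<Omega> Q \<tau> R \<phi>0"
    using s q Q_add[OF sQ qQ] mean_add[OF sQ qQ] by (auto simp: Q_bar_iff mean_free_def)
  show "F (\<lambda>x. s x + q x) (\<lambda>x. w x + v x) = F s w + F_phase s w q + F_displacement s w v + F_form q v / 2 + bregman s q"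
    if "w \<in> V" "v \<in> V"
    by (rule F_expansion[OF sQ that(1) qQ that(2)])
  show "F_phase s w (\<lambda>x. c * q x) = c * F_phase s w q" if "w \<in> V"
    by (rule F_phase_scale[OF sQ that qQ])
  show "bregman s (\<lambda>x. c * q x) \<le> c * bregman s q" if "0 \<le> c" "c \<le> 1"
    by (rule bregman_convex[OF sQ qQ that])
next
  fix q v c
  assume q: "q \<in> mean_free \<Omega> Q"
  show "(\<lambda>x. c * q x) \<in> mean_free \<Omega> Q" by (rule mean_free_scale[OF q])
  assume v: "v \<in> V"
  show "F_form (\<lambda>x. c * q x) (\<lambda>x. c *\<^sub>R v x) = c\<^sup>2 * F_form q v"
    by (rule F_form_scale[OF mean_free_Q[OF q] v])
  have "0 \<le> \<kappa> * (l2_norm \<Omega> q)\<^sup>2" using \<kappa>_pos by simp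
  then show "0 \<le> F_form q v"
    using phase_form_ge(2)[OF q] F_form_ge_phase_form[OF q v] by linarith
  show "\<beta> * F_form q (\<lambda>x. 0) \<le> F_form q v" by (rule F_form_ge_phase[OF q v])
  show "\<beta> * F_form (\<lambda>x. 0) v \<le> F_form q v" by (rule F_form_ge_displacement[OF q v])
qed (rule V_add V_scale \<beta>_bounds; assumption?)+

text \<open>Testing the phase equation with the constant one removes the gradient term and leaves the mass
  balance.\<close>

lemma phase_eq_Q_bar:
  assumes "s \<in> Q" "\<mu> \<in> Q" and eq: "phase_eq \<Omega> Q \<tau> m R \<phi>0 s \<mu>"
  shows "s \<in> Q_bar \<Omega> Q \<tau> R \<phi>0"
proof -
  have L: "(\<lambda>x. (s x - \<phi>0 x) / \<tau>) \<in> L2 \<Omega>"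
    using L2_scaleR[OF l2.diff_mem[OF Q_D(2)[OF assms(1)] Q_D(2)[OF prev(1)]], of "1 / \<tau>"] by simp
  have "l2_inner \<Omega> (\<lambda>x. m *\<^sub>R wgrad \<Omega> \<mu> x) (wgrad \<Omega> one) = 0"
    using l2.scale_left[OF wgrad_L2[OF Q_D(1)[OF assms(2)]] wgrad_L2[OF Q_D(1)[OF one(1)]]]
      one_dir[OF Q_D(1)[OF assms(2)]] by simp
  then have "l2_inner \<Omega> (\<lambda>x. (s x - \<phi>0 x) / \<tau>) one - l2_inner \<Omega> R one = 0"
    using eq one(1) by (auto simp: phase_eq_def)
  then show ?thesis
    unfolding one_inner[OF L] one_inner[OF data(1)] using assms(1) by (simp add: Q_bar_def)
qed

text \<open>The phase equation says that \<open>- \<tau> \<mu>\<close> is the Riesz representative of the residual, so the derivative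
  of the dual norm term is pairing with \<open>- \<mu>\<close>.\<close>

lemma residual_dual_inner:
  assumes "s \<in> Q" "\<mu> \<in> Q" and eq: "phase_eq \<Omega> Q \<tau> m R \<phi>0 s \<mu>" and \<delta>: "\<delta> \<in> mean_free \<Omega> Q"
  shows "D (residual s) \<delta> / \<tau> = - l2_inner \<Omega> \<mu> \<delta>"
proof -
  have "D (residual s) \<delta> = l2_inner \<Omega> (\<lambda>x. (- \<tau>) * \<mu> x) \<delta>"
  proof (rule D_rep[OF residual_L2[OF assms(1)] Q_scale[OF assms(2)] \<delta>])
    fix q assume "q \<in> mean_free \<Omega> Q"
    then have q: "q \<in> Q" by (rule mean_free_Q)
    note qL = Q_D(2)[OF q] and qH = Q_D(1)[OF q] and \<mu>H = Q_D(1)[OF assms(2)]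
    have sL: "(\<lambda>x. s x - \<phi>0 x) \<in> L2 \<Omega>" by (rule l2.diff_mem[OF Q_D(2)[OF assms(1)] Q_D(2)[OF prev(1)]])
    have "l2_inner \<Omega> (\<lambda>x. (s x - \<phi>0 x) / \<tau>) q = (1 / \<tau>) * l2_inner \<Omega> (\<lambda>x. s x - \<phi>0 x) q"
      using l2.scale_left[OF sL qL, of "1 / \<tau>"] by simp
    moreover have "l2_inner \<Omega> (\<lambda>x. m *\<^sub>R wgrad \<Omega> \<mu> x) (wgrad \<Omega> q) = m * l2_inner \<Omega> (wgrad \<Omega> \<mu>) (wgrad \<Omega> q)"
      by (rule l2.scale_left[OF wgrad_L2[OF \<mu>H] wgrad_L2[OF qH]])
    ultimately have "(1 / \<tau>) * l2_inner \<Omega> (\<lambda>x. s x - \<phi>0 x) q + m * l2_inner \<Omega> (wgrad \<Omega> \<mu>) (wgrad \<Omega> q) - l2_inner \<Omega> R q = 0"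
      using eq q by (auto simp: phase_eq_def)
    then have "l2_inner \<Omega> (\<lambda>x. s x - \<phi>0 x) q - \<tau> * l2_inner \<Omega> R q = - \<tau> * (m * l2_inner \<Omega> (wgrad \<Omega> \<mu>) (wgrad \<Omega> q))"
      using pos(3) by (simp add: field_simps)
    moreover have "l2_inner \<Omega> (residual s) q = l2_inner \<Omega> (\<lambda>x. s x - \<phi>0 x) q - \<tau> * l2_inner \<Omega> R q"
      using l2.diff_left[OF sL L2_scaleR[OF data(1)] qL, of \<tau>] l2.scale_left[OF data(1) qL, of \<tau>]
      by (simp add: residual_def)
    ultimately show "m * l2_inner \<Omega> (wgrad \<Omega> (\<lambda>x. (- \<tau>) * \<mu> x)) (wgrad \<Omega> q) = l2_inner \<Omega> (residual s) q"
      using dir.scale_left[OF \<mu>H qH, of "- \<tau>"] by simp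
  qed
  also have "\<dots> = - \<tau> * l2_inner \<Omega> \<mu> \<delta>"
    using l2.scale_left[OF Q_D(2)[OF assms(2)] Q_D(2)[OF mean_free_Q[OF \<delta>]], of "- \<tau>"] by simp
  finally show ?thesis using pos(3) by simp
qed

lemma E_si_inner:
  assumes "s \<in> Q" "w \<in> V" "q \<in> Q"
  shows "l2_inner \<Omega> (E_si \<Omega> \<xi> (elast C\<^sub>m C\<^sub>p \<pi>) (elast' C\<^sub>m C\<^sub>p \<pi>) s w \<phi>0 u0) q
    = l2_inner \<Omega> explicit_energy q - l2_inner \<Omega> (stress (es s w)) (dilation q)"
proof -
  have "E_si \<Omega> \<xi> (elast C\<^sub>m C\<^sub>p \<pi>) (elast' C\<^sub>m C\<^sub>p \<pi>) s w \<phi>0 u0 x \<bullet> q x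
      = explicit_energy x * q x - stress (es s w) x \<bullet> dilation q x" for x
    by (simp add: E_si_def stress_def dilation_def algebra_simps inner_commute)
  then show ?thesis
    using integrable_mult_ess_bounded[OF explicit_energy_integrable Q_bounded[OF assms(3)]]
      L2_integrable_inner[OF stress_L2[OF sym_tensors_L2[OF es_sym[OF assms(1,2)]]] sym_tensors_L2[OF dilation_sym[OF Q_D(2)[OF assms(3)]]]]
    by (simp add: l2_inner_def)
qed

text \<open>The phase and potential equations together are the Euler-Lagrange equation of the phase
  minimization with fixed displacement.\<close>

lemma phase_stationary:
  assumes "s \<in> Q" "\<mu> \<in> Q" "w \<in> V" and "phase_eq \<Omega> Q \<tau> m R \<phi>0 s \<mu>"
    and eq: "potential_eq \<Omega> Q \<gamma> ell \<xi> \<Psi>\<^sub>c \<Psi>\<^sub>e (elast C\<^sub>m C\<^sub>p \<pi>) (elast' C\<^sub>m C\<^sub>p \<pi>) \<phi>0 u0 s \<mu> w"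
    and q: "q \<in> mean_free \<Omega> Q"
  shows "F_phase s w q = 0"
proof -
  note qQ = mean_free_Q[OF q]
  have "l2_inner \<Omega> (\<lambda>x. deriv \<Psi>\<^sub>c (s x) - deriv \<Psi>\<^sub>e (\<phi>0 x)) q
      = l2_inner \<Omega> (\<lambda>x. deriv \<Psi>\<^sub>c (s x)) q - l2_inner \<Omega> (\<lambda>x. deriv \<Psi>\<^sub>e (\<phi>0 x)) q"
    by (rule l2.diff_left[OF \<Psi>_L2(2)[OF assms(1)] \<Psi>_L2(3)[OF prev(1)] Q_D(2)[OF qQ]])
  then have "l2_inner \<Omega> \<mu> q - \<gamma> * ell * l2_inner \<Omega> (wgrad \<Omega> s) (wgrad \<Omega> q)
      - \<gamma> / ell * (l2_inner \<Omega> (\<lambda>x. deriv \<Psi>\<^sub>c (s x)) q - l2_inner \<Omega> (\<lambda>x. deriv \<Psi>\<^sub>e (\<phi>0 x)) q)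
      - (l2_inner \<Omega> explicit_energy q - l2_inner \<Omega> (stress (es s w)) (dilation q)) = 0"
    using eq qQ E_si_inner[OF assms(1,3) qQ] by (auto simp: potential_eq_def)
  then show ?thesis
    unfolding F_phase_def residual_dual_inner[OF assms(1,2,4) q] by (simp add: right_diff_distrib)
qed

lemma displacement_stationary:
  assumes "elasticity_eq \<Omega> V \<xi> (elast C\<^sub>m C\<^sub>p \<pi>) f \<phi>0 s w" "v \<in> V"
  shows "F_displacement s w v = 0"
  using assms by (simp add: elasticity_eq_def F_displacement_def stress_def)

lemma tendsto_zero_if_le_sqrt:
  fixes a e :: "nat \<Rightarrow> real"
  assumes "e \<longlonglongrightarrow> 0" "\<And>i. 1 \<le> i \<Longrightarrow> 0 \<le> a i" "\<And>i. 1 \<le> i \<Longrightarrow> a i \<le> K * sqrt (c * e i)"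
  shows "a \<longlonglongrightarrow> 0"
proof (rule tendsto_sandwich)
  show "\<forall>\<^sub>F i in sequentially. 0 \<le> a i" "\<forall>\<^sub>F i in sequentially. a i \<le> K * sqrt (c * e i)"
    using assms(2,3) by (auto intro!: eventually_sequentiallyI[of 1])
  have "(\<lambda>i. K * sqrt (c * e i)) \<longlonglongrightarrow> K * sqrt (c * 0)"
    by (intro tendsto_intros assms(1))
  then show "(\<lambda>i. K * sqrt (c * e i)) \<longlonglongrightarrow> 0" by simp
qed simp

context
  fixes \<phi> \<mu> :: "nat \<Rightarrow> real ^ 'd \<Rightarrow> real" and u :: "nat \<Rightarrow> real ^ 'd \<Rightarrow> real ^ 'd"
    and \<phi>s :: "real ^ 'd \<Rightarrow> real" and us :: "real ^ 'd \<Rightarrow> real ^ 'd"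
  assumes start: "\<phi> 0 = \<phi>0" "u 0 = u0"
    and scheme: "\<And>i. i \<ge> 1 \<Longrightarrow> \<phi> i \<in> Q \<and> \<mu> i \<in> Q \<and> u i \<in> V"
      "\<And>i. i \<ge> 1 \<Longrightarrow> phase_eq \<Omega> Q \<tau> m R \<phi>0 (\<phi> i) (\<mu> i)"
      "\<And>i. i \<ge> 1 \<Longrightarrow> potential_eq \<Omega> Q \<gamma> ell \<xi> \<Psi>\<^sub>c \<Psi>\<^sub>e (elast C\<^sub>m C\<^sub>p \<pi>) (elast' C\<^sub>m C\<^sub>p \<pi>) \<phi>0 u0 (\<phi> i) (\<mu> i) (u (i - 1))"
      "\<And>i. i \<ge> 1 \<Longrightarrow> elasticity_eq \<Omega> V \<xi> (elast C\<^sub>m C\<^sub>p \<pi>) f \<phi>0 (\<phi> i) (u i)"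
    and minimizer: "\<phi>s \<in> Q_bar \<Omega> Q \<tau> R \<phi>0" "us \<in> V"
      "\<And>s w. \<lbrakk>s \<in> Q_bar \<Omega> Q \<tau> R \<phi>0; w \<in> V\<rbrakk> \<Longrightarrow> F \<phi>s us \<le> F s w"
begin

lemma u_V: "u i \<in> V"
  using scheme(1)[of i] start prev by (cases i) auto

lemma iterate_Q_bar: "i \<ge> 1 \<Longrightarrow> \<phi> i \<in> Q_bar \<Omega> Q \<tau> R \<phi>0"
  using scheme(1,2) phase_eq_Q_bar by blast

lemma iterate_phase_stationary: "i \<ge> 1 \<Longrightarrow> q \<in> mean_free \<Omega> Q \<Longrightarrow> F_phase (\<phi> i) (u (i - 1)) q = 0"
  using scheme(1)[of i] by (intro phase_stationary[OF _ _ u_V scheme(2,3)]) auto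

lemma iterate_displacement_stationary: "i \<ge> 1 \<Longrightarrow> v \<in> V \<Longrightarrow> F_displacement (\<phi> i) (u i) v = 0"
  by (rule displacement_stationary[OF scheme(4)])

lemma iterate_displacement_half_step:
  assumes "i \<ge> 1"
  shows "F (\<phi> i) (u i) - F \<phi>s us \<le> (1 - \<beta>) * (F (\<phi> i) (u (i - 1)) - F \<phi>s us)"
  by (rule alt.displacement_half_step[OF iterate_Q_bar[OF assms] u_V u_V minimizer(1,2)
        iterate_phase_stationary[OF assms] iterate_displacement_stationary[OF assms]])

text \<open>From the second iteration on, the previous iterate satisfies the mass balance and the elasticity
  equation, which the phase half step requires of its starting point; the initial guess need not.\<close>

lemma iterate_step:
  assumes i: "i \<ge> 1" and
    prev_step: "i \<ge> 2 \<or> (\<phi>0 \<in> Q_bar \<Omega> Q \<tau> R \<phi>0 \<and> elasticity_eq \<Omega> V \<xi> (elast C\<^sub>m C\<^sub>p \<pi>) f \<phi>0 \<phi>0 u0)"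
  shows "F \<phi>s us \<le> F (\<phi> (i - 1)) (u (i - 1))"
    "F (\<phi> i) (u i) - F \<phi>s us \<le> (1 - \<beta>) * (1 - \<beta>) * (F (\<phi> (i - 1)) (u (i - 1)) - F \<phi>s us)"
proof -
  have S: "\<phi> (i - 1) \<in> Q_bar \<Omega> Q \<tau> R \<phi>0"
  proof (cases "i \<ge> 2")
    case False
    then show ?thesis using i prev_step start by (simp add: le_Suc_eq numeral_2_eq_2)
  qed (simp add: iterate_Q_bar)
  have H: "F_displacement (\<phi> (i - 1)) (u (i - 1)) v = 0" if v: "v \<in> V" for v
  proof (cases "i \<ge> 2")
    case True
    then show ?thesis using iterate_displacement_stationary[of "i - 1" v] v by simp
  next
    case False
    then have "i = 1" using i by simp
    then show ?thesis using False prev_step start displacement_stationary[of \<phi>0 u0 v] v by simp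
  qed
  show "F \<phi>s us \<le> F (\<phi> (i - 1)) (u (i - 1))" by (rule minimizer(3)[OF S u_V])
  have "F (\<phi> i) (u (i - 1)) - F \<phi>s us \<le> (1 - \<beta>) * (F (\<phi> (i - 1)) (u (i - 1)) - F \<phi>s us)"
    by (rule alt.phase_half_step[OF S iterate_Q_bar[OF i] u_V minimizer(1,2) H iterate_phase_stationary[OF i]])
  then have "(1 - \<beta>) * (F (\<phi> i) (u (i - 1)) - F \<phi>s us)
      \<le> (1 - \<beta>) * ((1 - \<beta>) * (F (\<phi> (i - 1)) (u (i - 1)) - F \<phi>s us))"
    using \<beta>_bounds by (intro mult_left_mono) auto
  then show "F (\<phi> i) (u i) - F \<phi>s us \<le> (1 - \<beta>) * (1 - \<beta>) * (F (\<phi> (i - 1)) (u (i - 1)) - F \<phi>s us)"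
    using iterate_displacement_half_step[OF i] by (simp add: mult.assoc)
qed

lemma first_step:
  assumes "\<phi>0 \<in> Q_bar \<Omega> Q \<tau> R \<phi>0"
  shows "F (\<phi> 1) (u 1) - F \<phi>s us \<le> (1 - \<beta>) * (F (\<phi> 0) (u 0) - F \<phi>s us)"
proof -
  have "F (\<phi> 1) (u 0) \<le> F (\<phi> 0) (u 0)"
    using alt.stationary_phase_minimal[OF iterate_Q_bar, of 1 "\<phi> 0" "u 0"] iterate_phase_stationary[of 1]
      assms start u_V[of 0] by simp
  then have "(1 - \<beta>) * (F (\<phi> 1) (u 0) - F \<phi>s us) \<le> (1 - \<beta>) * (F (\<phi> 0) (u 0) - F \<phi>s us)"
    using \<beta>_bounds by (intro mult_left_mono) auto
  then show ?thesis using iterate_displacement_half_step[of 1] by simp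
qed

lemma energy_converges: "(\<lambda>i. F (\<phi> i) (u i)) \<longlonglongrightarrow> F \<phi>s us"
proof -
  define r where "r = (1 - \<beta>) * (1 - \<beta>)"
  have r: "0 \<le> r" "r < 1"
    using \<beta>_bounds mult_strict_mono[of "1 - \<beta>" 1 "1 - \<beta>" 1] by (auto simp: r_def)
  define E where "E k = F (\<phi> (Suc k)) (u (Suc k)) - F \<phi>s us" for k
  have E0: "0 \<le> E k" for k using iterate_step(1)[of "Suc (Suc k)"] by (simp add: E_def)
  have E_le: "E k \<le> r ^ k * E 0" for k
  proof (induction k)
    case (Suc k)
    have "E (Suc k) \<le> r * E k" using iterate_step(2)[of "Suc (Suc k)"] by (simp add: E_def r_def)
    also have "\<dots> \<le> r * (r ^ k * E 0)" using r Suc by (intro mult_left_mono) auto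
    finally show ?case by (simp add: mult.assoc)
  qed simp
  have "(\<lambda>k. r ^ k * E 0) \<longlonglongrightarrow> 0"
    using tendsto_mult_right[OF LIMSEQ_power_zero[of r], of "E 0"] r by simp
  then have "E \<longlonglongrightarrow> 0"
    using tendsto_sandwich[of "\<lambda>k. 0" E sequentially "\<lambda>k. r ^ k * E 0" 0] E0 E_le by simp
  then have "(\<lambda>k. F (\<phi> (Suc k)) (u (Suc k))) \<longlonglongrightarrow> F \<phi>s us"
    unfolding E_def by (simp add: LIM_zero_iff)
  then show ?thesis by (rule LIMSEQ_imp_Suc)
qed

lemma iterate_form_le:
  assumes i: "i \<ge> 1"
  shows "F_form (\<lambda>x. \<phi> i x - \<phi>s x) (\<lambda>x. u i x - us x) \<le> 2 * (F (\<phi> i) (u i) - F \<phi>s us)"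
  using alt.minimizer_quadratic_growth[OF minimizer iterate_Q_bar[OF i] u_V[of i]] by simp

lemma phase_converges: "(\<lambda>i. h1_norm \<Omega> (\<lambda>x. \<phi> i x - \<phi>s x)) \<longlonglongrightarrow> 0"
proof (rule tendsto_zero_if_le_sqrt[where K = 1 and c = "(1 / \<kappa> + 1 / (\<gamma> * ell)) * 2" and e = "\<lambda>i. F (\<phi> i) (u i) - F \<phi>s us"])
  show "(\<lambda>i. F (\<phi> i) (u i) - F \<phi>s us) \<longlonglongrightarrow> 0" using energy_converges by (simp add: LIM_zero_iff)
  fix i :: nat assume i: "1 \<le> i"
  define q where "q = (\<lambda>x. \<phi> i x - \<phi>s x)"
  have q: "q \<in> mean_free \<Omega> Q" unfolding q_def by (rule alt.S_diff[OF minimizer(1) iterate_Q_bar[OF i]])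
  show "0 \<le> h1_norm \<Omega> (\<lambda>x. \<phi> i x - \<phi>s x)" by (simp add: h1_norm_def)
  have P: "phase_form q \<le> 2 * (F (\<phi> i) (u i) - F \<phi>s us)"
    using F_form_ge_phase_form[OF q alt.V_diff[OF minimizer(2) u_V[of i]]] iterate_form_le[OF i] by (simp add: q_def)
  have "(l2_norm \<Omega> q)\<^sup>2 + (l2_norm \<Omega> (wgrad \<Omega> q))\<^sup>2 \<le> phase_form q / \<kappa> + phase_form q / (\<gamma> * ell)"
    using phase_form_ge[OF q] \<kappa>_pos pos by (intro add_mono) (auto simp: pos_le_divide_eq l2_norm_sq mult.commute)
  also have "\<dots> = (1 / \<kappa> + 1 / (\<gamma> * ell)) * phase_form q" by (simp add: distrib_right)
  also have "\<dots> \<le> (1 / \<kappa> + 1 / (\<gamma> * ell)) * (2 * (F (\<phi> i) (u i) - F \<phi>s us))"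
    using P \<kappa>_pos pos by (intro mult_left_mono) auto
  finally show "h1_norm \<Omega> (\<lambda>x. \<phi> i x - \<phi>s x) \<le> 1 * sqrt ((1 / \<kappa> + 1 / (\<gamma> * ell)) * 2 * (F (\<phi> i) (u i) - F \<phi>s us))"
    unfolding h1_norm_def q_def[symmetric] mult_1 mult.assoc[of _ 2] by (rule real_sqrt_le_mono)
qed

lemma displacement_converges: "(\<lambda>i. vh1_norm \<Omega> (\<lambda>x. u i x - us x)) \<longlonglongrightarrow> 0"
proof -
  obtain K where K: "\<And>v. v \<in> V \<Longrightarrow> vh1_norm \<Omega> v \<le> K * l2_norm \<Omega> (strain \<Omega> v)"
    using vh1_norm_le_strain[OF V_fin V_H10] by blast
  show ?thesis
  proof (rule tendsto_zero_if_le_sqrt[where K = "\<bar>K\<bar>" and c = "2 / (\<beta> * c\<^sub>C)" and e = "\<lambda>i. F (\<phi> i) (u i) - F \<phi>s us"])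
    show "(\<lambda>i. F (\<phi> i) (u i) - F \<phi>s us) \<longlonglongrightarrow> 0" using energy_converges by (simp add: LIM_zero_iff)
    fix i :: nat assume i: "1 \<le> i"
    define q where "q = (\<lambda>x. \<phi> i x - \<phi>s x)"
    define v where "v = (\<lambda>x. u i x - us x)"
    have q: "q \<in> mean_free \<Omega> Q" unfolding q_def by (rule alt.S_diff[OF minimizer(1) iterate_Q_bar[OF i]])
    have v: "v \<in> V" unfolding v_def by (rule alt.V_diff[OF minimizer(2) u_V])
    show "0 \<le> vh1_norm \<Omega> (\<lambda>x. u i x - us x)" by (simp add: vh1_norm_def)
    have "\<beta> * (c\<^sub>C * (l2_norm \<Omega> (strain \<Omega> v))\<^sup>2) \<le> \<beta> * F_form (\<lambda>x. 0) v"
      unfolding F_form_zero_phase using el_coercive[OF strain_sym[OF V_vH1[OF v]]] \<beta>_bounds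
      by (intro mult_left_mono) auto
    also have "\<dots> \<le> F_form q v" by (rule F_form_ge_displacement[OF q v])
    also have "\<dots> \<le> 2 * (F (\<phi> i) (u i) - F \<phi>s us)" unfolding q_def v_def by (rule iterate_form_le[OF i])
    finally have "(l2_norm \<Omega> (strain \<Omega> v))\<^sup>2 \<le> 2 / (\<beta> * c\<^sub>C) * (F (\<phi> i) (u i) - F \<phi>s us)"
      using \<beta>_bounds c\<^sub>C_pos by (simp add: field_simps)
    then have "l2_norm \<Omega> (strain \<Omega> v) \<le> sqrt (2 / (\<beta> * c\<^sub>C) * (F (\<phi> i) (u i) - F \<phi>s us))"
      by (rule real_le_rsqrt)
    then have "\<bar>K\<bar> * l2_norm \<Omega> (strain \<Omega> v) \<le> \<bar>K\<bar> * sqrt (2 / (\<beta> * c\<^sub>C) * (F (\<phi> i) (u i) - F \<phi>s us))"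
      by (intro mult_left_mono) auto
    moreover have "K * l2_norm \<Omega> (strain \<Omega> v) \<le> \<bar>K\<bar> * l2_norm \<Omega> (strain \<Omega> v)"
      by (intro mult_right_mono l2_norm_nonneg) auto
    ultimately show "vh1_norm \<Omega> (\<lambda>x. u i x - us x) \<le> \<bar>K\<bar> * sqrt (2 / (\<beta> * c\<^sub>C) * (F (\<phi> i) (u i) - F \<phi>s us))"
      using K[OF v] by (simp add: v_def)
  qed
qed

end

end

theorem corollary1:
  fixes \<Omega> :: "(real ^ 'd::finite) set"
    and T :: "(real ^ 'd) set set"
    and Q :: "(real ^ 'd \<Rightarrow> real) set"
    and V :: "(real ^ 'd \<Rightarrow> real ^ 'd) set"
    and h \<gamma> ell \<tau> m \<xi> C\<^sub>i\<^sub>n\<^sub>v C\<^sub>\<Omega> L\<^sub>\<Psi> c\<^sub>C C\<^sub>C \<beta>\<^sub>c\<^sub>h \<beta>\<^sub>e L\<^sub>c\<^sub>h :: real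
    and R :: "real ^ 'd \<Rightarrow> real"
    and f :: "real ^ 'd \<Rightarrow> real ^ 'd"
    and \<Psi> \<Psi>\<^sub>c \<Psi>\<^sub>e \<pi> :: "real \<Rightarrow> real"
    and C\<^sub>m C\<^sub>p :: "'d tensor4"
    and A A' :: "real \<Rightarrow> 'd tensor4"
    and \<phi>0 :: "real ^ 'd \<Rightarrow> real"
    and u0 :: "real ^ 'd \<Rightarrow> real ^ 'd"
    and \<phi> \<mu> :: "nat \<Rightarrow> real ^ 'd \<Rightarrow> real"
    and u :: "nat \<Rightarrow> real ^ 'd \<Rightarrow> real ^ 'd"
    and \<phi>s :: "real ^ 'd \<Rightarrow> real"
    and us :: "real ^ 'd \<Rightarrow> real ^ 'd"
    and F :: "(real ^ 'd \<Rightarrow> real) \<Rightarrow> (real ^ 'd \<Rightarrow> real ^ 'd) \<Rightarrow> real"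
  assumes domain: "lipschitz_domain \<Omega>"
    and mesh: "is_mesh \<Omega> T" "h = mesh_diameter T" "h > 0"
    and spaces: "scalar_fe_space \<Omega> T Q" "vector_fe_space \<Omega> T V"
    and params: "\<gamma> > 0" "ell > 0" "\<tau> > 0" "m > 0" "\<xi> \<noteq> 0"
    and data: "R \<in> L2 \<Omega>" "f \<in> L2 \<Omega>"
    and C_inv: "C\<^sub>i\<^sub>n\<^sub>v > 0"
      "\<And>s. s \<in> mean_free \<Omega> Q \<Longrightarrow> C\<^sub>i\<^sub>n\<^sub>v * inverse h * dual_norm \<Omega> Q m s \<ge> l2_norm \<Omega> s"
    and C_Omega: "C\<^sub>\<Omega> > 0"
      "\<And>s. s \<in> mean_free \<Omega> Q \<Longrightarrow> l2_norm \<Omega> s \<le> C\<^sub>\<Omega> * l2_norm \<Omega> (wgrad \<Omega> s)"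
    and double_well: "\<And>a. \<Psi> a = \<Psi>\<^sub>c a - \<Psi>\<^sub>e a"
      "convex_on UNIV \<Psi>\<^sub>c" "convex_on UNIV \<Psi>\<^sub>e"
      "\<Psi>\<^sub>c differentiable_on UNIV" "\<Psi>\<^sub>e differentiable_on UNIV"
      "\<And>a b. (deriv \<Psi>\<^sub>c a - deriv \<Psi>\<^sub>c b) * (a - b) \<le> L\<^sub>\<Psi> * (a - b)\<^sup>2"
    and interpolation: "\<pi> C1_differentiable_on UNIV"
    and tensors: "A = elast C\<^sub>m C\<^sub>p \<pi>" "A' = elast' C\<^sub>m C\<^sub>p \<pi>"
    and elast_bounds: "c\<^sub>C > 0" "C\<^sub>C > 0"
      "\<And>e s. \<lbrakk>e \<in> L2 \<Omega>; \<And>x. x \<in> \<Omega> \<Longrightarrow> transpose (e x) = e x; s \<in> Linf \<Omega>\<rbrakk> \<Longrightarrow>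
         c\<^sub>C * (l2_norm \<Omega> e)\<^sup>2 \<le> l2_inner \<Omega> (\<lambda>x. blinfun_apply (A (s x)) (e x)) e \<and>
         l2_inner \<Omega> (\<lambda>x. blinfun_apply (A (s x)) (e x)) e \<le> C\<^sub>C * (l2_norm \<Omega> e)\<^sup>2"
    and elast_symmetric:
      "\<And>e w s. \<lbrakk>e \<in> L2 \<Omega>; \<And>x. x \<in> \<Omega> \<Longrightarrow> transpose (e x) = e x;
                 w \<in> L2 \<Omega>; \<And>x. x \<in> \<Omega> \<Longrightarrow> transpose (w x) = w x; s \<in> Linf \<Omega>\<rbrakk> \<Longrightarrow>
         l2_inner \<Omega> (\<lambda>x. blinfun_apply (A (s x)) (e x)) w
           = l2_inner \<Omega> (\<lambda>x. blinfun_apply (A (s x)) (w x)) e"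
    and previous: "\<phi>0 \<in> Q" "u0 \<in> V"
    and start: "\<phi> 0 = \<phi>0" "u 0 = u0"
    and scheme:
      "\<And>i. i \<ge> 1 \<Longrightarrow> \<phi> i \<in> Q \<and> \<mu> i \<in> Q \<and> u i \<in> V"
      "\<And>i. i \<ge> 1 \<Longrightarrow> phase_eq \<Omega> Q \<tau> m R \<phi>0 (\<phi> i) (\<mu> i)"
      "\<And>i. i \<ge> 1 \<Longrightarrow> potential_eq \<Omega> Q \<gamma> ell \<xi> \<Psi>\<^sub>c \<Psi>\<^sub>e A A' \<phi>0 u0 (\<phi> i) (\<mu> i) (u (i - 1))"
      "\<And>i. i \<ge> 1 \<Longrightarrow> elasticity_eq \<Omega> V \<xi> A f \<phi>0 (\<phi> i) (u i)"
    and F_def: "F = F_tau \<Omega> Q \<gamma> ell \<tau> m \<xi> \<Psi>\<^sub>c \<Psi>\<^sub>e A A' R f \<phi>0 u0"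
    and minimizer: "\<phi>s \<in> Q_bar \<Omega> Q \<tau> R \<phi>0" "us \<in> V"
      "\<And>s w. \<lbrakk>s \<in> Q_bar \<Omega> Q \<tau> R \<phi>0; w \<in> V\<rbrakk> \<Longrightarrow> F \<phi>s us \<le> F s w"
    and beta_ch: "\<beta>\<^sub>c\<^sub>h = 1 - inverse
        (h\<^sup>2 / (\<tau> * C\<^sub>i\<^sub>n\<^sub>v\<^sup>2 * \<xi>\<^sup>2 * ((mat 1 :: real ^ 'd ^ 'd) \<bullet> mat 1) * C\<^sub>C)
         + \<gamma> * ell / (C\<^sub>\<Omega>\<^sup>2 * \<xi>\<^sup>2 * ((mat 1 :: real ^ 'd ^ 'd) \<bullet> mat 1) * C\<^sub>C) + 1)"
    and beta_e: "\<beta>\<^sub>e = \<beta>\<^sub>c\<^sub>h"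
    and L_ch: "L\<^sub>c\<^sub>h = 1 + L\<^sub>\<Psi> * inverse
        (h\<^sup>2 / (\<tau> * C\<^sub>i\<^sub>n\<^sub>v\<^sup>2) + \<gamma> * ell / C\<^sub>\<Omega>\<^sup>2
         + \<xi>\<^sup>2 * ((mat 1 :: real ^ 'd ^ 'd) \<bullet> mat 1) * c\<^sub>C)"
  shows
    \<comment> \<open>The first iteration attains the full rate only if the initial guess satisfies the mass
       constraint and the elasticity equation, as all later iterates do; the mass constraint alone
       gives the factor of the elasticity half step.\<close>
    "(\<forall>i \<ge> 1. i \<ge> 2 \<or> (\<phi>0 \<in> Q_bar \<Omega> Q \<tau> R \<phi>0 \<and> elasticity_eq \<Omega> V \<xi> A f \<phi>0 \<phi>0 u0) \<longrightarrow>
        F (\<phi> i) (u i) - F \<phi>s us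
          \<le> (1 - \<beta>\<^sub>c\<^sub>h / L\<^sub>c\<^sub>h) * (1 - \<beta>\<^sub>e) * (F (\<phi> (i - 1)) (u (i - 1)) - F \<phi>s us)) \<and>
     (\<phi>0 \<in> Q_bar \<Omega> Q \<tau> R \<phi>0 \<longrightarrow>
        F (\<phi> 1) (u 1) - F \<phi>s us \<le> (1 - \<beta>\<^sub>e) * (F (\<phi> 0) (u 0) - F \<phi>s us)) \<and>
     (\<lambda>i. F (\<phi> i) (u i)) \<longlonglongrightarrow> F \<phi>s us \<and>
     (\<lambda>i. h1_norm \<Omega> (\<lambda>x. \<phi> i x - \<phi>s x)) \<longlonglongrightarrow> 0 \<and>
     (\<lambda>i. vh1_norm \<Omega> (\<lambda>x. u i x - us x)) \<longlonglongrightarrow> 0"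
proof -
  have \<Omega>: "open \<Omega>" "bounded \<Omega>" "\<Omega> \<noteq> {}" using domain by (auto simp: lipschitz_domain_def)
  interpret bounded_open \<Omega> by unfold_locales (use \<Omega> in auto)
  have Q: "fin_dim_space Q" "Q \<subseteq> H1 \<Omega>" "\<exists>q\<in>Q. AE x in lebesgue_on \<Omega>. q x = 1"
    "\<And>q. q \<in> Q \<Longrightarrow> piecewise_polynomial \<Omega> T q"
    using spaces(1) by (auto simp: scalar_fe_space_def)
  interpret mean_free_poincare \<Omega> Q m C\<^sub>\<Omega>
    by unfold_locales (use \<Omega> Q params C_Omega in auto)
  have Q_bounded: "ess_bounded \<Omega> q" if "q \<in> Q" for q
    using piecewise_polynomial_ess_bounded[OF mesh(1) Q(4)[OF that] Q_D(2)[OF that]] .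
  have \<phi>0_bounded: "ess_bounded \<Omega> \<phi>0" using Q_bounded previous(1) .
  then have \<phi>0_Linf: "\<phi>0 \<in> Linf \<Omega>" by (simp add: ess_bounded_def Linf_def)
  interpret elastic \<Omega> C\<^sub>m C\<^sub>p \<pi> c\<^sub>C C\<^sub>C \<xi> \<phi>0
  proof
    show "c\<^sub>C * (l2_norm \<Omega> E)\<^sup>2 \<le> l2_inner \<Omega> (\<lambda>x. blinfun_apply (elast C\<^sub>m C\<^sub>p \<pi> (\<phi>0 x)) (E x)) E \<and>
        l2_inner \<Omega> (\<lambda>x. blinfun_apply (elast C\<^sub>m C\<^sub>p \<pi> (\<phi>0 x)) (E x)) E \<le> C\<^sub>C * (l2_norm \<Omega> E)\<^sup>2"
      if "E \<in> L2 \<Omega>" "\<And>x. x \<in> \<Omega> \<Longrightarrow> transpose (E x) = E x" for E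
      using elast_bounds(3)[OF that \<phi>0_Linf] unfolding tensors .
    show "l2_inner \<Omega> (\<lambda>x. blinfun_apply (elast C\<^sub>m C\<^sub>p \<pi> (\<phi>0 x)) (E x)) W
        = l2_inner \<Omega> (\<lambda>x. blinfun_apply (elast C\<^sub>m C\<^sub>p \<pi> (\<phi>0 x)) (W x)) E"
      if "E \<in> L2 \<Omega>" "\<And>x. x \<in> \<Omega> \<Longrightarrow> transpose (E x) = E x"
        "W \<in> L2 \<Omega>" "\<And>x. x \<in> \<Omega> \<Longrightarrow> transpose (W x) = W x" for E W
      using elast_symmetric[OF that \<phi>0_Linf] unfolding tensors .
  qed (rule \<phi>0_bounded interpolation elast_bounds(1,2))+
  obtain D where D: "semi_inner (L2 \<Omega>) D"
    "\<And>s. s \<in> L2 \<Omega> \<Longrightarrow> (dual_norm \<Omega> Q m s)\<^sup>2 = D s s"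
    "\<And>g \<mu> \<delta>. g \<in> L2 \<Omega> \<Longrightarrow> \<mu> \<in> Q \<Longrightarrow> \<delta> \<in> mean_free \<Omega> Q \<Longrightarrow>
       (\<And>q. q \<in> mean_free \<Omega> Q \<Longrightarrow> m * l2_inner \<Omega> (wgrad \<Omega> \<mu>) (wgrad \<Omega> q) = l2_inner \<Omega> g q) \<Longrightarrow>
       D g \<delta> = l2_inner \<Omega> \<mu> \<delta>"
  proof (rule dual_form)
    fix D
    assume D: "semi_inner (L2 \<Omega>) D"
      "\<And>s. s \<in> L2 \<Omega> \<Longrightarrow> (dual_norm \<Omega> Q m s)\<^sup>2 = D s s"
      "\<And>g \<mu> \<delta>. g \<in> L2 \<Omega> \<Longrightarrow> \<mu> \<in> Q \<Longrightarrow> \<delta> \<in> mean_free \<Omega> Q \<Longrightarrow>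
         (\<And>q. q \<in> mean_free \<Omega> Q \<Longrightarrow> m * l2_inner \<Omega> (wgrad \<Omega> \<mu>) (wgrad \<Omega> q) = l2_inner \<Omega> g q) \<Longrightarrow>
         D g \<delta> = l2_inner \<Omega> \<mu> \<delta>"
    show thesis using that[OF D] .
  qed
  have V: "fin_dim_space V" "\<And>v i. v \<in> V \<Longrightarrow> (\<lambda>x. v x $ i) \<in> H10 \<Omega>"
    using spaces(2) by (auto simp: vector_fe_space_def)
  interpret ts: time_step \<Omega> Q m C\<^sub>\<Omega> C\<^sub>m C\<^sub>p \<pi> c\<^sub>C C\<^sub>C \<xi> \<phi>0 V h \<gamma> ell \<tau> C\<^sub>i\<^sub>n\<^sub>v R f \<Psi>\<^sub>c \<Psi>\<^sub>e u0 D
  proof (intro time_step.intro time_step_axioms.intro)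
    show "mean_free_poincare \<Omega> Q m C\<^sub>\<Omega>" "elastic \<Omega> C\<^sub>m C\<^sub>p \<pi> c\<^sub>C C\<^sub>C \<phi>0" by unfold_locales
    show "D g \<delta> = l2_inner \<Omega> \<mu> \<delta>" if "g \<in> L2 \<Omega>" "\<mu> \<in> Q" "\<delta> \<in> mean_free \<Omega> Q"
      "\<And>q. q \<in> mean_free \<Omega> Q \<Longrightarrow> m * l2_inner \<Omega> (wgrad \<Omega> \<mu>) (wgrad \<Omega> q) = l2_inner \<Omega> g q" for g \<mu> \<delta>
      using D(3)[OF that] .
  qed (simp_all add: V Q_bounded params mesh(3) C_inv C_Omega(1) data double_well(2-5) previous D(1,2))
  have F: "F = ts.F" unfolding F_def tensors ..
  note it = start scheme[unfolded tensors] minimizer[unfolded F]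
  let ?n = "(mat 1 :: real ^ 'd ^ 'd) \<bullet> mat 1"
  have \<beta>: "\<beta>\<^sub>c\<^sub>h = ts.\<beta>"
    unfolding beta_ch ts.\<beta>_def ts.\<rho>_def ts.\<kappa>_def by (simp add: add_divide_distrib mult_ac)
  have "L\<^sub>\<Psi> \<ge> 0"
  proof -
    have "deriv \<Psi>\<^sub>c 0 \<le> deriv \<Psi>\<^sub>c 1"
      using convex_deriv(3)[OF double_well(2,4)] by (simp add: monoD)
    then show ?thesis using double_well(6)[of 1 0] by simp
  qed
  moreover have "ts.\<kappa> + \<xi>\<^sup>2 * ?n * c\<^sub>C > 0"
    using ts.\<kappa>_pos ts.mat_1_pos elast_bounds(1) params(5) by (intro add_pos_pos mult_pos_pos) auto
  ultimately have L: "L\<^sub>c\<^sub>h \<ge> 1" unfolding L_ch ts.\<kappa>_def by simp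
  \<comment> \<open>both half steps contract by one minus beta, and the constant in the denominator is at least one\<close>
  have rate: "(1 - ts.\<beta>) * (1 - ts.\<beta>) \<le> (1 - \<beta>\<^sub>c\<^sub>h / L\<^sub>c\<^sub>h) * (1 - \<beta>\<^sub>e)"
  proof -
    have "ts.\<beta> / L\<^sub>c\<^sub>h \<le> ts.\<beta>" using L ts.\<beta>_bounds by (simp add: divide_le_eq mult_le_cancel_left1)
    then show ?thesis using ts.\<beta>_bounds unfolding beta_e \<beta> by (intro mult_right_mono) auto
  qed
  show ?thesis
  proof (intro conjI allI impI)
    fix i :: nat
    assume i: "i \<ge> 1" "i \<ge> 2 \<or> (\<phi>0 \<in> Q_bar \<Omega> Q \<tau> R \<phi>0 \<and> elasticity_eq \<Omega> V \<xi> A f \<phi>0 \<phi>0 u0)"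
    note step = ts.iterate_step[OF it i[unfolded tensors], folded F]
    have "(1 - ts.\<beta>) * (1 - ts.\<beta>) * (F (\<phi> (i - 1)) (u (i - 1)) - F \<phi>s us)
        \<le> (1 - \<beta>\<^sub>c\<^sub>h / L\<^sub>c\<^sub>h) * (1 - \<beta>\<^sub>e) * (F (\<phi> (i - 1)) (u (i - 1)) - F \<phi>s us)"
      using rate step(1) by (intro mult_right_mono) auto
    then show "F (\<phi> i) (u i) - F \<phi>s us
        \<le> (1 - \<beta>\<^sub>c\<^sub>h / L\<^sub>c\<^sub>h) * (1 - \<beta>\<^sub>e) * (F (\<phi> (i - 1)) (u (i - 1)) - F \<phi>s us)"
      using step(2) by linarith
  next
    assume mass: "\<phi>0 \<in> Q_bar \<Omega> Q \<tau> R \<phi>0"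
    show "F (\<phi> 1) (u 1) - F \<phi>s us \<le> (1 - \<beta>\<^sub>e) * (F (\<phi> 0) (u 0) - F \<phi>s us)"
      unfolding beta_e \<beta> by (rule ts.first_step[OF it mass, folded F])
  next
    show "(\<lambda>i. F (\<phi> i) (u i)) \<longlonglongrightarrow> F \<phi>s us"
      by (rule ts.energy_converges[OF it, folded F])
  next
    show "(\<lambda>i. h1_norm \<Omega> (\<lambda>x. \<phi> i x - \<phi>s x)) \<longlonglongrightarrow> 0" by (rule ts.phase_converges[OF it])
  next
    show "(\<lambda>i. vh1_norm \<Omega> (\<lambda>x. u i x - us x)) \<longlonglongrightarrow> 0" by (rule ts.displacement_converges[OF it])
  qed
qed

end
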